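(* Let $T_1>0$, $T_0\in[0,T_1)$ and $\tfrac12<\beta<\alpha<1$. Let $p>1$ and let $(\lambda_k)_{k\ge0}$ be positive weights with $\lambda_k\to\infty$ and $\lambda_k^{1/\beta}/k^p\to0$ as $k\to\infty$. Suppose $F:\mathcal T^{(p)}(\mathbb R^m)\to L(\mathbb R^d,\mathbb R^m)$ is locally Lipschitz and satisfies the homogeneous linear growth condition: for every $r>0$ there exists $C_F>0$ such that $$|F(\delta_\lambda\mathbf g)|\le C_F(1+\lambda)\quad\text{for all }\mathbf g\in S(B^\beta(r))\text{ and }\lambda\ge0 .$$ Then for every Lipschitz control $x:[0,T_1]\to\mathbb R^d$ and every initial history $w\in\mathcal C^\alpha([0,T_0],\mathbb R^m)$, the signature controlled differential equation $$y|_{[0,T_0]}=w,\qquad y_t=w_{T_0}+\int_{T_0}^tF\big(S(y)_{0,s}\big)\,\mathrm dx_s,\quad t\in[T_0,T_1],$$ possesses a unique solution on $[0,T_1]$.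
   Context: $\mathcal C^\gamma([0,T],\mathbb R^m)$ is the space of $\gamma$-H\"older paths with norm $|y_0|+\|y\|_{\gamma;[0,T]}$, $\|y\|_{\gamma;[0,T]}=\sup_{s<t}|y_t-y_s|/|t-s|^\gamma$. $B^\beta(r)$ is the closed ball of radius $r$ centred at $0$ in $\mathcal C^\beta([0,T_1],\mathbb R^m)$. $T((\mathbb R^m))=\prod_{n\ge0}(\mathbb R^m)^{\otimes n}$, with elements $\mathbf a=(\mathbf a^{(n)})_{n\ge0}$; each level carries the Euclidean norm $|\cdot|$. The dilation is $(\delta_\lambda\mathbf a)^{(n)}=\lambda^n\mathbf a^{(n)}$. For a $\gamma$-H\"older path $y$, $\gamma>\frac12$, the signature is $S(y)_{0,t}=(1,S^{(1)}(y)_{0,t},S^{(2)}(y)_{0,t},\dots)\in T((\mathbb R^m))$ with $S^{(n)}(y)_{0,t}=\int_{0<t_1<\dots<t_n<t}\mathrm dy_{t_1}\otimes\cdots\otimes\mathrm dy_{t_n}$ (iterated Young integrals), and $S(B^\beta(r))=\{S(y)_{0,T_1}:y\in B^\beta(r)\}$. $\|\mathbf a\|_{1,\lambda}=\sum_{n\ge0}\lambda^n|\mathbf a^{(n)}|$, and $$\mathcal T^{(p)}(\mathbb R^m)=\Big\{\mathbf a\in T((\mathbb R^m)):\ \|\mathbf a\|_{(p)}:=\frac1{Z_p}\sum_{k\ge0}e^{-k^p}\|\mathbf a\|_{1,\lambda_k}<\infty\Big\},\quad Z_p=\sum_{k\ge0}e^{-k^p},$$ a Banach space (defined relative to the fixed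 weights $(\lambda_k)$). Integrals against $x$ are Riemann–Stieltjes: $\int F\,\mathrm dx=\sum_j\int F^j\,\mathrm dx^j$. A solution is a path $y\in\mathcal C^\alpha([0,T_1],\mathbb R^m)$ satisfying the equation. *)

theory Defs
  imports "HOL-Analysis.Analysis"
begin

section \<open>Hoelder paths\<close>

text \<open>A path on \<open>[0,T]\<close> is a total function on the reals of which only the values on \<open>{0..T}\<close>
  matter. Norms that may be infinite are \<^typ>\<open>ennreal\<close>-valued.\<close>

definition hoelder_seminorm :: "real \<Rightarrow> real \<Rightarrow> (real \<Rightarrow> 'a::real_normed_vector) \<Rightarrow> ennreal" where
  "hoelder_seminorm \<gamma> T y =
     (SUP (s, t) \<in> {(s, t). 0 \<le> s \<and> s < t \<and> t \<le> T}.
        ennreal (norm (y t - y s) / \<bar>t - s\<bar> powr \<gamma>))"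

definition hoelder_norm :: "real \<Rightarrow> real \<Rightarrow> (real \<Rightarrow> 'a::real_normed_vector) \<Rightarrow> ennreal" where
  "hoelder_norm \<gamma> T y = ennreal (norm (y 0)) + hoelder_seminorm \<gamma> T y"

definition hoelder_space :: "real \<Rightarrow> real \<Rightarrow> (real \<Rightarrow> 'a::real_normed_vector) set" where
  "hoelder_space \<gamma> T = {y. hoelder_norm \<gamma> T y < \<infinity>}"

definition hoelder_ball :: "real \<Rightarrow> real \<Rightarrow> real \<Rightarrow> (real \<Rightarrow> 'a::real_normed_vector) set" where
  "hoelder_ball \<gamma> T r = {y \<in> hoelder_space \<gamma> T. hoelder_norm \<gamma> T y \<le> ennreal r}"

section \<open>Riemann--Stieltjes (Young) integrals\<close>

text \<open>Limit of Riemann--Stieltjes sums \<open>\<Sum> f(\<xi>) (g(v) - g(u))\<close> over tagged partitions as the mesh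
  tends to 0. The mesh condition is fineness with respect to a gauge of constant radius; for a
  non-constant gauge one would get the Henstock--Stieltjes integral instead. For Hoelder \<open>f\<close>, \<open>g\<close>
  with exponents summing to more than 1 this is the Young integral.\<close>

definition has_rs_integral ::
    "(real \<Rightarrow> 'a::real_normed_vector) \<Rightarrow> (real \<Rightarrow> real) \<Rightarrow> real \<Rightarrow> real \<Rightarrow> 'a \<Rightarrow> bool" where
  "has_rs_integral f g a b I \<longleftrightarrow>
     (\<forall>\<epsilon>>0. \<exists>\<delta>>0. \<forall>p. p tagged_division_of {a..b} \<and> (\<lambda>\<xi>. ball \<xi> \<delta>) fine p \<longrightarrow>
        norm ((\<Sum>(\<xi>, K)\<in>p. (g (Sup K) - g (Inf K)) *\<^sub>R f \<xi>) - I) < \<epsilon>)"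

definition rs_integral ::
    "(real \<Rightarrow> 'a::real_normed_vector) \<Rightarrow> (real \<Rightarrow> real) \<Rightarrow> real \<Rightarrow> real \<Rightarrow> 'a" where
  "rs_integral f g a b = (THE I. has_rs_integral f g a b I)"

section \<open>Tensor series and the signature\<close>

text \<open>An element of \<open>T((\<real>\<^sup>m))\<close> is given by its coordinates: the coefficient at the word
  \<open>[i\<^sub>1, \<dots>, i\<^sub>n]\<close> is the coordinate of \<open>a\<^sup>(\<^sup>n\<^sup>)\<close> along \<open>e\<^bsub>i\<^sub>1\<^esub> \<otimes> \<dots> \<otimes> e\<^bsub>i\<^sub>n\<^esub>\<close>, so level \<open>n\<close> is the
  restriction to the words of length \<open>n\<close>.\<close>

type_synonym 'm tensor_series = "'m list \<Rightarrow> real"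

definition level_norm :: "nat \<Rightarrow> ('m::finite) tensor_series \<Rightarrow> real" where
  "level_norm n a = L2_set a {u. length u = n}"

definition dilation :: "real \<Rightarrow> 'm tensor_series \<Rightarrow> 'm tensor_series" where
  "dilation c a = (\<lambda>u. c ^ length u * a u)"

text \<open>Recursion on the last letter:
  \<open>S(y)\<^bsub>0,t\<^esub>[i\<^sub>1,\<dots>,i\<^sub>n] = \<integral>\<^sub>0\<^sup>t S(y)\<^bsub>0,s\<^esub>[i\<^sub>1,\<dots>,i\<^bsub>n-1\<^esub>] dy\<^sub>s[i\<^sub>n]\<close>. The auxiliary function
  takes the word reversed.\<close>

primrec signature_rev :: "(real \<Rightarrow> real ^ 'm) \<Rightarrow> 'm list \<Rightarrow> real \<Rightarrow> real" where
  "signature_rev y [] = (\<lambda>t. 1)"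
| "signature_rev y (i # u) = (\<lambda>t. rs_integral (signature_rev y u) (\<lambda>s. y s $ i) 0 t)"

definition signature :: "(real \<Rightarrow> real ^ 'm) \<Rightarrow> real \<Rightarrow> 'm tensor_series" where
  "signature y t = (\<lambda>u. signature_rev y (rev u) t)"

section \<open>The weighted tensor spaces\<close>

definition norm1 :: "real \<Rightarrow> ('m::finite) tensor_series \<Rightarrow> ennreal" where
  "norm1 c a = (\<Sum>n. ennreal (c ^ n * level_norm n a))"

definition Z_const :: "real \<Rightarrow> ennreal" where
  "Z_const p = (\<Sum>k. ennreal (exp (- (real k powr p))))"

definition weighted_norm :: "real \<Rightarrow> (nat \<Rightarrow> real) \<Rightarrow> ('m::finite) tensor_series \<Rightarrow> ennreal" where
  "weighted_norm p lam a =
     (\<Sum>k. ennreal (exp (- (real k powr p))) * norm1 (lam k) a) / Z_const p"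

definition weighted_space :: "real \<Rightarrow> (nat \<Rightarrow> real) \<Rightarrow> ('m::finite) tensor_series set" where
  "weighted_space p lam = {a. weighted_norm p lam a < \<infinity>}"

text \<open>Every point of the weighted space has a ball on which \<open>F\<close> is Lipschitz. The distance is
  \<open>\<lambda>a b. weighted_norm p lam (a - b)\<close>, with the pointwise difference of functions.\<close>

definition locally_lipschitz ::
    "real \<Rightarrow> (nat \<Rightarrow> real) \<Rightarrow> (('m::finite) tensor_series \<Rightarrow> 'b::real_normed_vector) \<Rightarrow> bool" where
  "locally_lipschitz p lam F \<longleftrightarrow>
     (\<forall>a \<in> weighted_space p lam. \<exists>r>0. \<exists>L\<ge>0. \<forall>b \<in> weighted_space p lam. \<forall>c \<in> weighted_space p lam.
        weighted_norm p lam (b - a) < ennreal r \<longrightarrow> weighted_norm p lam (c - a) < ennreal r \<longrightarrow>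
        ennreal (norm (F b - F c)) \<le> ennreal L * weighted_norm p lam (b - c))"

section \<open>Signature controlled differential equations\<close>

text \<open>\<open>F\<^sup>j\<close>, the \<open>j\<close>-th column of \<open>F\<close>, is \<open>F\<close> applied to the basis vector \<open>axis j 1\<close>. The existence
  of the integrals \<open>\<integral> F\<^sup>j dx\<^sup>j\<close> is part of being a solution.\<close>

definition signature_cde_solution ::
    "real \<Rightarrow> real \<Rightarrow> real \<Rightarrow> ('m tensor_series \<Rightarrow> (real ^ 'd) \<Rightarrow>\<^sub>L (real ^ 'm::finite)) \<Rightarrow>
     (real \<Rightarrow> real ^ 'd) \<Rightarrow> (real \<Rightarrow> real ^ 'm) \<Rightarrow> (real \<Rightarrow> real ^ 'm) \<Rightarrow> bool" where
  "signature_cde_solution \<alpha> T0 T1 F x w y \<longleftrightarrow>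
     y \<in> hoelder_space \<alpha> T1 \<and>
     (\<forall>t\<in>{0..T0}. y t = w t) \<and>
     (\<forall>t\<in>{T0..T1}. \<exists>I.
        (\<forall>j. has_rs_integral (\<lambda>s. blinfun_apply (F (signature y s)) (axis j 1)) (\<lambda>s. x s $ j) T0 t (I j)) \<and>
        y t = w T0 + (\<Sum>j\<in>UNIV. I j))"

end

theory Submission
  imports Defs
begin

text \<open>Let \<open>y\<close> be \<open>\<beta>\<close>-Hoelder. On an interval of length \<open>h\<close> with \<open>\<lambda> h\<^sup>\<beta>\<close> small, the Young--Loeve estimate applied
  level by level bounds the Hoelder constants of the weighted \<open>\<ell>\<^sup>1\<close> sum of the coordinates of \<open>S(y)\<close> by its
  value at the left end point, so this sum at most doubles over the interval. Covering \<open>[0,t]\<close> by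
  \<open>O(\<lambda>\<^bsup>1/\<beta>\<^esup>)\<close> such intervals bounds \<open>\<parallel>S(y)\<parallel>\<^bsub>1,\<lambda>\<^esub>\<close> by \<open>exp (C \<lambda>\<^bsup>1/\<beta>\<^esup>)\<close>, with neither Chen's identity nor factorial
  decay, and the same argument makes \<open>y \<mapsto> S(y)\<close> Lipschitz from \<open>\<beta>\<close>-Hoelder balls to the weighted space.

  Since \<open>S(y)\<^bsub>0,s\<^esub>\<close> is the signature at \<open>T\<^sub>1\<close> of the path stopped at \<open>s\<close>, the equation is a functional
  equation whose coefficient is locally Lipschitz in the path and, by the dilation hypothesis applied
  to \<open>y / \<mu>\<close> with \<open>\<mu> = 1 + \<parallel>y\<parallel>\<^sub>\<beta>\<close>, of linear growth in the Hoelder seminorm. Picard iteration in the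
  Lipschitz seminorm gives local existence and uniqueness. The growth bound gives a Lipschitz constant
  common to all solutions, so that a solution extends to the end of the interval.\<close>

section \<open>Hoelder functions\<close>

text \<open>Two gaps between exponents do the work. Signatures are Lipschitz in the path for the
  \<open>\<beta>\<close>-Hoelder distance, but for this distance a stopped path need not depend
  continuously on the stopping time. Along paths of a higher exponent \<open>\<gamma>\<close> it
  does, with modulus |t - s|^(\<gamma> - \<beta>); this is how \<beta> < \<alpha> makes the
  coefficient F(S(y)) continuous in time. The control is Lipschitz, so bounded coefficients produce
  Lipschitz increments, and the gap between 1 and \<beta> supplies the small factor of the
  contraction. Continuity is all that is established for the integrand, so the integrals against the
  control are built as Stieltjes integrals of continuous functions, whereas Young integrals serve
  for the signature itself. The obstacle to global existence is that the local Lipschitz data of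
  \<open>F\<close> depend on the point, so the local step lengths come with no uniform lower bound.
  The extension therefore passes through the supremum of the existence times and a limit at that
  time.\<close>

definition holder :: "real \<Rightarrow> real \<Rightarrow> real \<Rightarrow> real \<Rightarrow> (real \<Rightarrow> 'a::real_normed_vector) \<Rightarrow> bool" where
  "holder \<gamma> H a b f \<longleftrightarrow> (\<forall>s t. a \<le> s \<longrightarrow> s \<le> t \<longrightarrow> t \<le> b \<longrightarrow> norm (f t - f s) \<le> H * (t - s) powr \<gamma>)"

lemma holderI:
  "(\<And>s t. a \<le> s \<Longrightarrow> s \<le> t \<Longrightarrow> t \<le> b \<Longrightarrow> norm (f t - f s) \<le> H * (t - s) powr \<gamma>) \<Longrightarrow> holder \<gamma> H a b f"
  by (simp add: holder_def)

lemma holderD: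
  "holder \<gamma> H a b f \<Longrightarrow> a \<le> s \<Longrightarrow> s \<le> t \<Longrightarrow> t \<le> b \<Longrightarrow> norm (f t - f s) \<le> H * (t - s) powr \<gamma>"
  by (simp add: holder_def)

lemma holder_subinterval: "holder \<gamma> H a b f \<Longrightarrow> a \<le> a' \<Longrightarrow> b' \<le> b \<Longrightarrow> holder \<gamma> H a' b' f"
  by (auto simp: holder_def)

lemma holder_weaken: "holder \<gamma> H a b f \<Longrightarrow> H \<le> H' \<Longrightarrow> holder \<gamma> H' a b f"
  by (rule holderI) (blast intro: order_trans[OF holderD] mult_right_mono powr_ge_zero)

lemma holder_cong: "(\<And>t. a \<le> t \<Longrightarrow> t \<le> b \<Longrightarrow> f t = g t) \<Longrightarrow> holder \<gamma> H a b f \<longleftrightarrow> holder \<gamma> H a b g"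
  by (auto simp: holder_def)

lemma holder_add:
  assumes "holder \<gamma> H a b f" "holder \<gamma> H' a b g"
  shows "holder \<gamma> (H + H') a b (\<lambda>t. f t + g t)"
proof (rule holderI)
  fix s t assume "a \<le> s" "s \<le> t" "t \<le> b"
  note * = holderD[OF assms(1) this] holderD[OF assms(2) this]
  have "norm (f t + g t - (f s + g s)) \<le> norm (f t - f s) + norm (g t - g s)"
    by (metis add_diff_add norm_triangle_ineq)
  with * show "norm (f t + g t - (f s + g s)) \<le> (H + H') * (t - s) powr \<gamma>"
    by (simp add: distrib_right)
qed

lemma holder_uminus: "holder \<gamma> H a b f \<Longrightarrow> holder \<gamma> H a b (\<lambda>t. - f t)"
  by (rule holderI, drule holderD) (simp_all add: norm_minus_commute)

lemma holder_diff:
  assumes "holder \<gamma> H a b f" "holder \<gamma> H' a b g"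
  shows "holder \<gamma> (H + H') a b (\<lambda>t. f t - g t)"
  using holder_add[OF assms(1) holder_uminus[OF assms(2)]] by simp

lemma holder_scaleR:
  assumes "holder \<gamma> H a b f"
  shows "holder \<gamma> (\<bar>c\<bar> * H) a b (\<lambda>t. c *\<^sub>R f t)"
proof (rule holderI)
  fix s t assume "a \<le> s" "s \<le> t" "t \<le> b"
  from mult_left_mono[OF holderD[OF assms this], of "\<bar>c\<bar>"]
  show "norm (c *\<^sub>R f t - c *\<^sub>R f s) \<le> \<bar>c\<bar> * H * (t - s) powr \<gamma>"
    by (simp add: mult.assoc flip: scaleR_right_diff_distrib)
qed

lemma holder_const: "0 \<le> H \<Longrightarrow> holder \<gamma> H a b (\<lambda>t. c)"
  by (simp add: holder_def)

lemma holder_component: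
  assumes "holder \<gamma> H a b y"
  shows "holder \<gamma> H a b (\<lambda>t. y t $ i)"
proof (rule holderI)
  fix s t assume "a \<le> s" "s \<le> t" "t \<le> b"
  from order_trans[OF Finite_Cartesian_Product.norm_nth_le holderD[OF assms this]]
  show "norm (y t $ i - y s $ i) \<le> H * (t - s) powr \<gamma>"
    by (metis vector_minus_component)
qed

lemma holder_exponent:
  assumes f: "holder \<gamma> R a b f" and "\<beta> \<le> \<gamma>" "a \<le> b" "0 \<le> R"
  shows "holder \<beta> (R * (b - a) powr (\<gamma> - \<beta>)) a b f"
proof (rule holderI)
  fix s t assume st: "a \<le> s" "s \<le> t" "t \<le> b"
  have "(t - s) powr \<gamma> = (t - s) powr (\<gamma> - \<beta>) * (t - s) powr \<beta>"
    by (metis diff_add_cancel powr_add)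
  also have "\<dots> \<le> (b - a) powr (\<gamma> - \<beta>) * (t - s) powr \<beta>"
    using assms st by (intro mult_right_mono powr_mono2) auto
  finally show "norm (f t - f s) \<le> R * (b - a) powr (\<gamma> - \<beta>) * (t - s) powr \<beta>"
    using order_trans[OF holderD[OF f st] mult_left_mono[OF _ \<open>0 \<le> R\<close>]] by (simp add: mult.assoc)
qed

lemma holder_imp_continuous_on:
  assumes f: "holder \<gamma> H a b f" and "0 < \<gamma>"
  shows "continuous_on {a..b} f"
proof -
  have "(f \<longlongrightarrow> f s) (at s within {a..b})" if "s \<in> {a..b}" for s
  proof -
    have "((\<lambda>t. H * \<bar>t - s\<bar> powr \<gamma>) \<longlongrightarrow> H * \<bar>s - s\<bar> powr \<gamma>) (at s within {a..b})"
      using \<open>0 < \<gamma>\<close> by (intro tendsto_intros tendsto_powr') auto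
    then have "((\<lambda>t. H * \<bar>t - s\<bar> powr \<gamma>) \<longlongrightarrow> 0) (at s within {a..b})"
      using \<open>0 < \<gamma>\<close> by simp
    moreover have "\<forall>\<^sub>F t in at s within {a..b}. norm (f t - f s) \<le> H * \<bar>t - s\<bar> powr \<gamma>"
    proof (rule eventually_at_topological[THEN iffD2], intro exI[of _ UNIV] conjI ballI impI)
      fix t assume "t \<in> {a..b}"
      then show "norm (f t - f s) \<le> H * \<bar>t - s\<bar> powr \<gamma>"
        using that holderD[OF f, of s t] holderD[OF f, of t s]
        by (cases "s \<le> t") (auto simp: norm_minus_commute abs_minus_commute)
    qed auto
    ultimately have "((\<lambda>t. f t - f s) \<longlongrightarrow> 0) (at s within {a..b})"
      by (rule Lim_null_comparison[rotated])
    then show ?thesis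
      by (simp add: LIM_zero_iff)
  qed
  then show ?thesis
    by (auto simp: continuous_on_def)
qed

text \<open>An exponent above 1 sends all difference quotients to 0, so the derivative vanishes on
  the interval. Every uniqueness statement about primitives of germs rests on this.\<close>

lemma constant_if_superlinear_modulus:
  fixes h :: "real \<Rightarrow> 'a::real_normed_vector"
  assumes h: "holder \<theta> K a b h" and "1 < \<theta>" and "a \<le> u" "u \<le> v" "v \<le> b"
  shows "h v = h u"
proof -
  have "(h has_derivative (\<lambda>h. 0)) (at s within {a..b})" if s: "s \<in> {a..b}" for s
  proof -
    have "((\<lambda>t. K * \<bar>t - s\<bar> powr (\<theta> - 1)) \<longlongrightarrow> K * \<bar>s - s\<bar> powr (\<theta> - 1)) (at s within {a..b})"
      using \<open>1 < \<theta>\<close> by (intro tendsto_intros tendsto_powr') auto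
    then have lim: "((\<lambda>t. K * \<bar>t - s\<bar> powr (\<theta> - 1)) \<longlongrightarrow> 0) (at s within {a..b})"
      using \<open>1 < \<theta>\<close> by simp
    have "norm ((h t - h s) /\<^sub>R norm (t - s)) \<le> K * \<bar>t - s\<bar> powr (\<theta> - 1)" if "t \<in> {a..b}" "t \<noteq> s" for t
    proof -
      have "norm (h t - h s) \<le> K * \<bar>t - s\<bar> powr \<theta>"
        using that s holderD[OF h, of s t] holderD[OF h, of t s]
        by (cases "s \<le> t") (auto simp: norm_minus_commute abs_minus_commute)
      also have "\<bar>t - s\<bar> powr \<theta> = \<bar>t - s\<bar> powr (\<theta> - 1) * \<bar>t - s\<bar>"
        using that by (simp add: powr_diff)
      finally show ?thesis
        using that by (simp add: divide_inverse_commute[symmetric] pos_divide_le_eq mult.assoc)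
    qed
    then have "((\<lambda>t. (h t - h s) /\<^sub>R norm (t - s)) \<longlongrightarrow> 0) (at s within {a..b})"
      by (intro Lim_null_comparison[OF _ lim]) (auto simp: eventually_at_topological intro!: exI[of _ UNIV])
    then show ?thesis
      by (simp add: has_derivative_within inverse_eq_divide)
  qed
  then obtain c where "\<And>s. s \<in> {a..b} \<Longrightarrow> h s = c"
    using has_derivative_zero_constant[of "{a..b}" h] by auto
  with assms show ?thesis by auto
qed

section \<open>Young integrals\<close>

text \<open>The solution of \<kappa> = 2^(1 - \<theta>) \<kappa> + 2, the equation that lets the
  induction over bisections close.\<close>

definition young_const :: "real \<Rightarrow> real" where
  "young_const \<theta> = 2 / (1 - 2 powr (1 - \<theta>))"

lemma young_const_pos:
  assumes "1 < \<theta>"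
  shows "0 < young_const \<theta>"
proof -
  have "2 powr (1 - \<theta>) < (2::real) powr 0"
    using assms by (intro powr_less_mono) auto
  then show ?thesis by (simp add: young_const_def)
qed

text \<open>The index range is bisected at the midpoint of \<open>[t i, t j]\<close>; the two halves contribute
  \<open>2\<^bsup>1-\<theta>\<^esup>\<close> times the bound, which is where \<^const>\<open>young_const\<close> comes from.\<close>

lemma discrete_sewing:
  fixes A :: "real \<Rightarrow> real \<Rightarrow> 'a::real_normed_vector" and t :: "nat \<Rightarrow> real"
  assumes \<theta>: "1 < \<theta>" and C: "0 \<le> C"
    and defect: "\<And>u w v. a \<le> u \<Longrightarrow> u \<le> w \<Longrightarrow> w \<le> v \<Longrightarrow> v \<le> b \<Longrightarrow>
      norm (A u w + A w v - A u v) \<le> C * (v - u) powr \<theta>"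
    and t: "mono t" "\<And>i. t i \<in> {a..b}"
    and "i \<le> j"
  shows "norm ((\<Sum>k = i..<j. A (t k) (t (Suc k))) - A (t i) (t j)) \<le> young_const \<theta> * C * (t j - t i) powr \<theta>"
  using \<open>i \<le> j\<close>
proof (induction "j - i" arbitrary: i j rule: less_induct)
  case less
  define \<kappa> where "\<kappa> = young_const \<theta> * C"
  define S where "S i j = (\<Sum>k = i..<j. A (t k) (t (Suc k)))" for i j
  have t_mono: "i \<le> j \<Longrightarrow> t i \<le> t j" for i j using t(1) by (simp add: monoD)
  have t_in: "a \<le> t i" "t i \<le> b" for i using t(2)[of i] by auto
  \<comment> \<open>With all three points equal the defect is the germ itself and its bound is a
    multiple of \<open>0 powr \<theta>\<close>, which is 0.\<close>
  have A_diag: "A (t i) (t i) = 0" for i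
    using defect[of "t i" "t i" "t i"] t_in[of i] by simp
  show ?case
  proof (cases "i = j")
    case True
    then show ?thesis by (simp add: A_diag)
  next
    case False
    define l where "l = t j - t i"
    define m where "m = (t i + t j) / 2"
    have l: "0 \<le> l" using t_mono[OF less.prems] by (simp add: l_def)
    \<comment> \<open>The first index after \<open>i\<close> whose point has reached the midpoint
      \<open>m\<close>. Then neither [t i, t k] nor [t k', t j] is longer than l / 2, and the one
      interval that may straddle \<open>m\<close> is treated separately.\<close>
    define k' where "k' = (LEAST k. i < k \<and> m \<le> t k)"
    have j: "i < j \<and> m \<le> t j" using False less.prems t_mono[OF less.prems] by (auto simp: m_def)
    have k': "i < k'" "m \<le> t k'" "k' \<le> j"
      unfolding k'_def using LeastI[of "\<lambda>k. i < k \<and> m \<le> t k" j] Least_le[of "\<lambda>k. i < k \<and> m \<le> t k" j] j by auto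
    define k where "k = k' - 1"
    have k: "k' = Suc k" "i \<le> k" "k < j" using k' by (auto simp: k_def)
    have tk: "t k \<le> m"
    proof (cases "k = i")
      case True then show ?thesis using t_mono[OF less.prems] by (simp add: m_def)
    next
      case False
      then have "\<not> (i < k \<and> m \<le> t k)" using k not_less_Least[of k "\<lambda>k. i < k \<and> m \<le> t k"] by (simp add: k'_def[symmetric])
      then show ?thesis using False k by auto
    qed
    have half: "x powr \<theta> \<le> 2 powr (- \<theta>) * l powr \<theta>" if "0 \<le> x" "x \<le> l / 2" for x
    proof -
      have "x powr \<theta> \<le> (l / 2) powr \<theta>" using that \<theta> by (intro powr_mono2) auto
      also have "\<dots> = 2 powr (- \<theta>) * l powr \<theta>"
        using l by (simp add: powr_divide powr_minus field_simps)
      finally show ?thesis .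
    qed
    have \<kappa>: "0 \<le> \<kappa>" using young_const_pos[OF \<theta>] C by (simp add: \<kappa>_def)
    have 1: "norm (S i k - A (t i) (t k)) \<le> \<kappa> * (2 powr (- \<theta>) * l powr \<theta>)"
    proof -
      have "norm (S i k - A (t i) (t k)) \<le> \<kappa> * (t k - t i) powr \<theta>"
        unfolding S_def \<kappa>_def using k by (intro less.hyps) auto
      also have "\<dots> \<le> \<kappa> * (2 powr (- \<theta>) * l powr \<theta>)"
        using t_mono[OF k(2)] tk \<kappa> by (intro mult_left_mono half) (auto simp: l_def m_def field_simps)
      finally show ?thesis .
    qed
    have 2: "norm (S k' j - A (t k') (t j)) \<le> \<kappa> * (2 powr (- \<theta>) * l powr \<theta>)"
    proof -
      have "norm (S k' j - A (t k') (t j)) \<le> \<kappa> * (t j - t k') powr \<theta>"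
        unfolding S_def \<kappa>_def using k' by (intro less.hyps) auto
      also have "\<dots> \<le> \<kappa> * (2 powr (- \<theta>) * l powr \<theta>)"
        using t_mono[OF k'(3)] k' \<kappa> by (intro mult_left_mono half) (auto simp: l_def m_def field_simps)
      finally show ?thesis .
    qed
    have 3: "norm (A (t i) (t k) + A (t k) (t k') - A (t i) (t k')) \<le> C * l powr \<theta>"
    proof -
      have "norm (A (t i) (t k) + A (t k) (t k') - A (t i) (t k')) \<le> C * (t k' - t i) powr \<theta>"
        using k k' t_in t_mono by (intro defect) auto
      also have "\<dots> \<le> C * l powr \<theta>"
        using t_mono[of i k'] t_mono[OF k'(3)] k' \<theta> C by (intro mult_left_mono powr_mono2) (auto simp: l_def)
      finally show ?thesis .
    qed
    have 4: "norm (A (t i) (t k') + A (t k') (t j) - A (t i) (t j)) \<le> C * l powr \<theta>"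
      unfolding l_def using k' t_in t_mono by (intro defect) auto
    have split: "S i j = S i k + A (t k) (t k') + S k' j"
    proof -
      have "S i j = S i k + S k j"
        unfolding S_def using k by (intro sum.atLeastLessThan_concat[symmetric]) auto
      also have "S k j = A (t k) (t k') + S k' j"
        unfolding S_def using k by (simp add: sum.atLeast_Suc_lessThan)
      finally show ?thesis by (simp add: add.assoc)
    qed
    \<comment> \<open>The intermediate points \<open>t k\<close> and \<open>t k'\<close> are
      inserted one after the other, each at the price of one defect; this is the summand 2 in the
      equation for \<open>young_const\<close>.\<close>
    have "S i j - A (t i) (t j) = (S i k - A (t i) (t k)) + (S k' j - A (t k') (t j))
       + (A (t i) (t k) + A (t k) (t k') - A (t i) (t k')) + (A (t i) (t k') + A (t k') (t j) - A (t i) (t j))"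
      unfolding split by simp
    then have "norm (S i j - A (t i) (t j)) \<le> \<kappa> * (2 powr (- \<theta>) * l powr \<theta>) + \<kappa> * (2 powr (- \<theta>) * l powr \<theta>)
       + C * l powr \<theta> + C * l powr \<theta>"
      using 1 2 3 4 by (simp only:) (intro norm_triangle_mono order_refl)
    also have "\<dots> = (\<kappa> * 2 powr (1 - \<theta>) + 2 * C) * l powr \<theta>"
      by (simp add: powr_diff powr_minus field_simps)
    also have "\<kappa> * 2 powr (1 - \<theta>) + 2 * C = \<kappa>"
    proof -
      have "1 - 2 powr (1 - \<theta>) \<noteq> (0::real)"
        using young_const_pos[OF \<theta>] by (auto simp: young_const_def)
      then show ?thesis by (simp add: \<kappa>_def young_const_def field_simps)
    qed
    finally show ?thesis by (simp add: S_def \<kappa>_def l_def)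
  qed
qed

text \<open>The germ (g v - g u) f u has defect (g v - g w)(f w - f u), of order \<gamma> + \<delta>
  > 1, so its sums over dyadic partitions converge, and \<open>discrete_sewing\<close> passes to the
  limit.\<close>

lemma sewing:
  fixes f :: "real \<Rightarrow> 'a::banach" and g :: "real \<Rightarrow> real"
  assumes f: "holder \<gamma> P a b f" and g: "holder \<delta> Q a b g"
    and pos: "0 \<le> P" "0 \<le> Q" "0 < \<gamma>" "0 < \<delta>" and \<theta>: "1 < \<gamma> + \<delta>"
  shows "\<exists>I. \<forall>u v. a \<le> u \<longrightarrow> u \<le> v \<longrightarrow> v \<le> b \<longrightarrow>
    norm (I v - I u - (g v - g u) *\<^sub>R f u) \<le> young_const (\<gamma> + \<delta>) * (P * Q) * (v - u) powr (\<gamma> + \<delta>)"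
proof (cases "a < b")
  case False
  then have "u = v" if "a \<le> u" "u \<le> v" "v \<le> b" for u v
    using that by linarith
  then show ?thesis by (intro exI[of _ "\<lambda>_. 0"]) fastforce
next
  case ab: True
  define \<theta> where "\<theta> = \<gamma> + \<delta>"
  define C where "C = P * Q"
  define A where "A u v = (g v - g u) *\<^sub>R f u" for u v
  \<comment> \<open>One dyadic grid of [a, b] cut off at \<open>v\<close>: later points collapse
    onto \<open>v\<close>, where the germ vanishes. Hence the sums for u < v share their terms below
    \<open>u\<close>, and their difference is local already before the limit.\<close>
  define tt where "tt n v i = min (a + (b - a) * real i / 2 ^ n) v" for n v i
  define I where "I n v = (\<Sum>k = 0..<2 ^ n. A (tt n v k) (tt n v (Suc k)))" for n v
  have C: "0 \<le> C" using pos by (simp add: C_def)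
  have \<theta>': "1 < \<theta>" using \<theta> by (simp add: \<theta>_def)
  have defect: "norm (A u w + A w v - A u v) \<le> C * (v - u) powr \<theta>"
    if "a \<le> u" "u \<le> w" "w \<le> v" "v \<le> b" for u w v
  proof -
    have "A u w + A w v - A u v = (g v - g w) *\<^sub>R (f w - f u)"
      by (simp add: A_def algebra_simps)
    then have "norm (A u w + A w v - A u v) = \<bar>g v - g w\<bar> * norm (f w - f u)"
      by simp
    also have "\<dots> \<le> (Q * (v - w) powr \<delta>) * (P * (w - u) powr \<gamma>)"
      using holderD[OF f, of u w] holderD[OF g, of w v] that pos by (intro mult_mono) auto
    also have "\<dots> \<le> (Q * (v - u) powr \<delta>) * (P * (v - u) powr \<gamma>)"
      using that pos by (intro mult_mono powr_mono2 mult_nonneg_nonneg) auto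
    also have "\<dots> = C * (v - u) powr \<theta>"
      by (simp add: C_def \<theta>_def powr_add)
    finally show ?thesis .
  qed
  have tt_mono: "mono (tt n v)" for n v
    using ab unfolding mono_def tt_def
    by (intro allI impI min.mono add_left_mono divide_right_mono mult_left_mono) auto
  have tt_in: "tt n v i \<in> {a..b}" if "v \<in> {a..b}" for n v i
    using that ab by (auto simp: tt_def min_le_iff_disj)
  have tt_0: "tt n v 0 = a" and tt_last: "tt n v (2 ^ n) = v" if "v \<in> {a..b}" for n v
    using that by (auto simp: tt_def)
  have tt_even: "tt (Suc n) v (2 * k) = tt n v k" for n v k
    by (simp add: tt_def)
  have tt_step: "tt n v (Suc k) - tt n v k \<le> (b - a) / 2 ^ n" for n v k
  proof -
    have "(b - a) * real (Suc k) / 2 ^ n = (b - a) * real k / 2 ^ n + (b - a) / 2 ^ n"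
      by (simp add: ring_distribs add_divide_distrib)
    moreover have "0 \<le> (b - a) / 2 ^ n" using ab by simp
    ultimately show ?thesis unfolding tt_def by linarith
  qed
  \<comment> \<open>Halving the cells costs one defect for each of the 2^n cells, in total of order
    2^n * 2^(- n \<theta>): a geometric series.\<close>
  have refine: "norm (I (Suc n) v - I n v) \<le> C * (b - a) powr \<theta> * (2 powr (1 - \<theta>)) ^ n"
    if v: "v \<in> {a..b}" for n v
  proof -
    let ?t = "tt (Suc n) v"
    have "I (Suc n) v = (\<Sum>k<2 ^ n. \<Sum>i = k * 2..<k * 2 + 2. A (?t i) (?t (Suc i)))"
      unfolding I_def sum.nat_group by (simp add: atLeast0LessThan mult.commute)
    also have "\<dots> = (\<Sum>k<2 ^ n. A (?t (2 * k)) (?t (2 * k + 1)) + A (?t (2 * k + 1)) (?t (2 * (k + 1))))"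
      by (intro sum.cong refl) (simp add: numeral_2_eq_2 mult.commute)
    finally have "I (Suc n) v - I n v = (\<Sum>k<2 ^ n. A (tt n v k) (?t (2 * k + 1))
        + A (?t (2 * k + 1)) (tt n v (Suc k)) - A (tt n v k) (tt n v (Suc k)))"
      unfolding tt_even by (simp add: I_def atLeast0LessThan sum_subtractf)
    also have "norm \<dots> \<le> (\<Sum>k<(2::nat) ^ n. C * ((b - a) / 2 ^ n) powr \<theta>)"
    proof (rule sum_norm_le)
      fix k
      have le: "tt n v k \<le> ?t (2 * k + 1)" "?t (2 * k + 1) \<le> tt n v (Suc k)"
        using monoD[OF tt_mono[of "Suc n" v], of "2 * k" "2 * k + 1"]
          monoD[OF tt_mono[of "Suc n" v], of "2 * k + 1" "2 * Suc k"]
        unfolding tt_even by simp_all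
      have "norm (A (tt n v k) (?t (2 * k + 1)) + A (?t (2 * k + 1)) (tt n v (Suc k)) - A (tt n v k) (tt n v (Suc k)))
          \<le> C * (tt n v (Suc k) - tt n v k) powr \<theta>"
        using le tt_in[OF v, of n k] tt_in[OF v, of n "Suc k"] by (intro defect) auto
      also have "\<dots> \<le> C * ((b - a) / 2 ^ n) powr \<theta>"
        using \<theta>' C le tt_step by (intro mult_left_mono powr_mono2) auto
      finally show "norm (A (tt n v k) (?t (2 * k + 1)) + A (?t (2 * k + 1)) (tt n v (Suc k)) - A (tt n v k) (tt n v (Suc k)))
          \<le> C * ((b - a) / 2 ^ n) powr \<theta>" .
    qed
    also have "\<dots> = C * (b - a) powr \<theta> * (2 ^ n / (2 ^ n) powr \<theta>)"
      using ab by (simp add: powr_divide)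
    also have "2 ^ n / (2 ^ n) powr \<theta> = (2 powr (1 - \<theta>)) ^ n"
      by (simp add: powr_diff power_divide powr_realpow[symmetric] powr_powr mult.commute)
    finally show ?thesis .
  qed
  have "\<exists>L. (\<lambda>n. I n v) \<longlonglongrightarrow> L" if v: "v \<in> {a..b}" for v
  proof -
    have "2 powr (1 - \<theta>) < (2::real) powr 0"
      using \<theta>' by (intro powr_less_mono) auto
    then have "summable (\<lambda>n. C * (b - a) powr \<theta> * (2 powr (1 - \<theta>)) ^ n)"
      by (intro summable_mult summable_geometric) auto
    then have "summable (\<lambda>n. I (Suc n) v - I n v)"
      by (rule summable_comparison_test'[where N = 0]) (use refine[OF v] in auto)
    from summable_LIMSEQ[OF this]
    have "(\<lambda>n. I n v - I 0 v) \<longlonglongrightarrow> (\<Sum>n. I (Suc n) v - I n v)"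
      unfolding sum_lessThan_telescope[of "\<lambda>n. I n v"] .
    from tendsto_add[OF this tendsto_const[of "I 0 v"]] show ?thesis by auto
  qed
  then obtain J where J: "\<And>v. v \<in> {a..b} \<Longrightarrow> (\<lambda>n. I n v) \<longlonglongrightarrow> J v" by metis
  have "norm (J v - J u - (g v - g u) *\<^sub>R f u) \<le> young_const \<theta> * C * (v - u) powr \<theta>"
    if uv: "a \<le> u" "u \<le> v" "v \<le> b" for u v
  proof -
    \<comment> \<open>The index of the last grid point \<open>s n\<close> that is not beyond
      \<open>u\<close>; it tends to \<open>u\<close> because the mesh does to 0.\<close>
    define j where "j n = nat \<lfloor>(u - a) * 2 ^ n / (b - a)\<rfloor>" for n
    define s where "s n = a + (b - a) * real (j n) / 2 ^ n" for n
    have j1: "real (j n) \<le> (u - a) * 2 ^ n / (b - a)" "(u - a) * 2 ^ n / (b - a) < real (j n) + 1" for n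
      unfolding j_def using uv ab by (auto simp: divide_nonneg_pos)
    have s1: "s n \<le> u" for n
      using j1(1)[of n] ab by (simp add: s_def field_simps)
    have s2: "u - s n \<le> (b - a) * (1 / 2) ^ n" for n
    proof -
      have "(u - a) * 2 ^ n \<le> (b - a) * real (j n) + (b - a)"
        using j1(2)[of n] ab by (simp add: pos_divide_less_eq algebra_simps)
      then have "u - a \<le> ((b - a) * real (j n) + (b - a)) / 2 ^ n"
        by (simp add: pos_le_divide_eq)
      then show ?thesis by (simp add: s_def add_divide_distrib power_one_over)
    qed
    have s3: "a \<le> s n" for n using ab by (simp add: s_def)
    have j2: "j n \<le> 2 ^ n" for n
    proof -
      have "(u - a) * 2 ^ n / (b - a) \<le> 2 ^ n" using uv ab by (simp add: field_simps)
      then have "real (j n) \<le> real (2 ^ n)"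
        unfolding of_nat_power of_nat_numeral by (rule order_trans[OF j1(1)])
      then show ?thesis by (simp only: of_nat_le_iff)
    qed
    have tt_le: "tt n w i = a + (b - a) * real i / 2 ^ n" if "i \<le> j n" "u \<le> w" for n w i
    proof -
      have "a + (b - a) * real i / 2 ^ n \<le> s n"
        unfolding s_def using that ab by (intro add_left_mono divide_right_mono mult_left_mono) auto
      with s1[of n] that show ?thesis by (simp add: tt_def)
    qed
    have tt_j: "tt n w (j n) = s n" if "u \<le> w" for n w
      using tt_le[OF order_refl that] by (simp add: s_def)
    \<comment> \<open>The part of the sum after \<open>s n\<close>. It is within a sewing error of
      the single germ over [s n, w]; for w = u this error vanishes in the limit, for w = v it
      becomes the claimed bound.\<close>
    define R where "R n w = (\<Sum>k = j n..<2 ^ n. A (tt n w k) (tt n w (Suc k)))" for n w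
    have split: "I n w = (\<Sum>k = 0..<j n. A (tt n u k) (tt n u (Suc k))) + R n w" if "u \<le> w" for n w
    proof -
      have "I n w = (\<Sum>k = 0..<j n. A (tt n w k) (tt n w (Suc k))) + R n w"
        unfolding I_def R_def using j2 by (intro sum.atLeastLessThan_concat[symmetric]) auto
      also have "(\<Sum>k = 0..<j n. A (tt n w k) (tt n w (Suc k))) = (\<Sum>k = 0..<j n. A (tt n u k) (tt n u (Suc k)))"
        using that by (intro sum.cong refl) (simp add: tt_le)
      finally show ?thesis .
    qed
    have R: "norm (R n w - A (s n) w) \<le> young_const \<theta> * C * (w - s n) powr \<theta>" if "u \<le> w" "w \<le> b" for n w
    proof -
      have "w \<in> {a..b}" using that uv by auto
      then show ?thesis
        using discrete_sewing[OF \<theta>' C defect tt_mono[of n w] tt_in j2[of n]]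
        by (simp add: R_def tt_j[OF \<open>u \<le> w\<close>] tt_last)
    qed
    have "norm (I n v - I n u - (g v - g u) *\<^sub>R f (s n))
        \<le> young_const \<theta> * C * (v - s n) powr \<theta> + young_const \<theta> * C * (u - s n) powr \<theta>" for n
    proof -
      have "I n v - I n u - (g v - g u) *\<^sub>R f (s n) = (R n v - A (s n) v) - (R n u - A (s n) u)"
        using uv by (simp add: split A_def algebra_simps)
      also have "norm \<dots> \<le> norm (R n v - A (s n) v) + norm (R n u - A (s n) u)"
        by (rule norm_triangle_ineq4)
      finally show ?thesis using R[of v n] R[of u n] uv by simp
    qed
    moreover have s_lim: "s \<longlonglongrightarrow> u"
    proof -
      have "(\<lambda>n. (b - a) * (1 / 2) ^ n) \<longlonglongrightarrow> (b - a) * 0"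
        by (intro tendsto_intros LIMSEQ_power_zero) auto
      then have "(\<lambda>n. u - s n) \<longlonglongrightarrow> 0"
        using s1 s2 by (intro tendsto_sandwich[of "\<lambda>_. 0" "\<lambda>n. u - s n" sequentially "\<lambda>n. (b - a) * (1 / 2) ^ n"]) auto
      from tendsto_diff[OF tendsto_const[of u] this] show ?thesis by simp
    qed
    moreover have "(\<lambda>n. f (s n)) \<longlonglongrightarrow> f u"
      using s3 s1 uv
      by (intro continuous_on_tendsto_compose[OF holder_imp_continuous_on[OF f \<open>0 < \<gamma>\<close>] s_lim])
        (auto intro!: always_eventually order_trans[OF s1])
    moreover have "(\<lambda>n. young_const \<theta> * C * (v - s n) powr \<theta> + young_const \<theta> * C * (u - s n) powr \<theta>)
        \<longlonglongrightarrow> young_const \<theta> * C * (v - u) powr \<theta> + young_const \<theta> * C * (u - u) powr \<theta>"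
      using s_lim s1 uv \<theta>' by (intro tendsto_intros tendsto_powr') (auto intro!: always_eventually order_trans[OF s1])
    moreover have "(\<lambda>n. norm (I n v - I n u - (g v - g u) *\<^sub>R f (s n))) \<longlonglongrightarrow> norm (J v - J u - (g v - g u) *\<^sub>R f u)"
      using uv calculation(3) by (intro tendsto_intros J) auto
    ultimately have "norm (J v - J u - (g v - g u) *\<^sub>R f u)
        \<le> young_const \<theta> * C * (v - u) powr \<theta> + young_const \<theta> * C * (u - u) powr \<theta>"
      by (intro LIMSEQ_le[where X = "\<lambda>n. norm (I n v - I n u - (g v - g u) *\<^sub>R f (s n))"]) auto
    then show ?thesis by simp
  qed
  then show ?thesis by (auto simp: \<theta>_def C_def intro!: exI[of _ J])
qed

section \<open>Riemann-Stieltjes integrals from germs\<close>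

lemma tagged_division_of_atLeastAtMostE:
  fixes a b :: real
  assumes "p tagged_division_of {a..b}" "(\<xi>, K) \<in> p"
  obtains u v where "K = {u..v}" "u \<le> \<xi>" "\<xi> \<le> v" "a \<le> u" "v \<le> b" "Inf K = u" "Sup K = v"
proof -
  obtain u v where K: "K = cbox u v"
    using tagged_division_ofD(4)[OF assms] by auto
  then have "K = {u..v}" by simp
  moreover have "\<xi> \<in> K" "K \<subseteq> {a..b}"
    using tagged_division_ofD(2,3)[OF assms] by auto
  ultimately show thesis using that[of u v] by auto
qed

text \<open>Balls of constant radius form a gauge, so Cousin's lemma provides a division that is
  fine for both integrals at once.\<close>

lemma has_rs_integral_unique:
  assumes I: "has_rs_integral f g a b I" and J: "has_rs_integral f g a b J"
  shows "I = J"
proof (rule ccontr)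
  let ?S = "\<lambda>p. \<Sum>(\<xi>, K)\<in>p. (g (Sup K) - g (Inf K)) *\<^sub>R f \<xi>"
  define e where "e = norm (I - J) / 2"
  assume "I \<noteq> J"
  then have "0 < e" by (simp add: e_def)
  from I[unfolded has_rs_integral_def, rule_format, OF this] obtain d1 where d1: "0 < d1"
    "\<And>p. p tagged_division_of {a..b} \<Longrightarrow> (\<lambda>\<xi>. ball \<xi> d1) fine p \<Longrightarrow> norm (?S p - I) < e" by blast
  from J[unfolded has_rs_integral_def, rule_format, OF \<open>0 < e\<close>] obtain d2 where d2: "0 < d2"
    "\<And>p. p tagged_division_of {a..b} \<Longrightarrow> (\<lambda>\<xi>. ball \<xi> d2) fine p \<Longrightarrow> norm (?S p - J) < e" by blast
  have "gauge (\<lambda>\<xi>::real. ball \<xi> (min d1 d2))" using d1 d2 by (intro gauge_ball) auto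
  then obtain p where p: "p tagged_division_of {a..b}" "(\<lambda>\<xi>. ball \<xi> (min d1 d2)) fine p"
    using fine_division_exists_real by blast
  have "(\<lambda>\<xi>. ball \<xi> d1) fine p" "(\<lambda>\<xi>. ball \<xi> d2) fine p"
    using p(2) by (auto simp: fine_def subset_iff)
  then have "norm ((?S p - J) - (?S p - I)) < e + e"
    using d1(2)[OF p(1)] d2(2)[OF p(1)] norm_triangle_ineq4[of "?S p - J" "?S p - I"] by linarith
  then show False by (simp add: e_def)
qed

lemma rs_integral_eq: "has_rs_integral f g a b I \<Longrightarrow> rs_integral f g a b = I"
  unfolding rs_integral_def using has_rs_integral_unique by blast

text \<open>The increments of \<open>I\<close> telescope over any division. On a cell of length at
  most 2d the error is (K + C) * length^\<theta>, and one factor of the length is kept for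
  summation, so the total is at most (K + C) (2d)^(\<theta> - 1) (b - a).\<close>

lemma has_rs_integral_of_germ:
  fixes f :: "real \<Rightarrow> 'a::real_normed_vector"
  assumes \<theta>: "1 < \<theta>" and ab: "a \<le> b"
    and germ: "\<And>u v. a \<le> u \<Longrightarrow> u \<le> v \<Longrightarrow> v \<le> b \<Longrightarrow>
      norm (I v - I u - (g v - g u) *\<^sub>R f u) \<le> K * (v - u) powr \<theta>"
    and tag: "\<And>u \<xi> v. a \<le> u \<Longrightarrow> u \<le> \<xi> \<Longrightarrow> \<xi> \<le> v \<Longrightarrow> v \<le> b \<Longrightarrow>
      norm ((g v - g u) *\<^sub>R (f \<xi> - f u)) \<le> C * (v - u) powr \<theta>"
    and KC: "0 \<le> K" "0 \<le> C"
  shows "has_rs_integral f g a b (I b - I a)"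
  unfolding has_rs_integral_def
proof (intro allI impI)
  fix e :: real assume e: "0 < e"
  \<comment> \<open>\<open>d\<close> is chosen so that (2d)^(\<theta> - 1) = e / D. The ones in
    \<open>D\<close> keep it positive for K = C = 0 or a = b and make the final inequality
    strict.\<close>
  define D where "D = (K + C + 1) * (b - a + 1)"
  have D: "0 < D" using KC ab by (simp add: D_def)
  define d where "d = (e / D) powr (1 / (\<theta> - 1)) / 2"
  have d: "0 < d" using e D by (simp add: d_def)
  have dD: "(2 * d) powr (\<theta> - 1) = e / D"
    using e D \<theta> by (simp add: d_def powr_powr)
  show "\<exists>d>0. \<forall>p. p tagged_division_of {a..b} \<and> (\<lambda>\<xi>. ball \<xi> d) fine p \<longrightarrow>
    norm ((\<Sum>(\<xi>, K)\<in>p. (g (Sup K) - g (Inf K)) *\<^sub>R f \<xi>) - (I b - I a)) < e"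
  proof (intro exI conjI allI impI, rule d, elim conjE)
    fix p assume p: "p tagged_division_of {a..b}" and fine: "(\<lambda>\<xi>. ball \<xi> d) fine p"
    have "(\<Sum>(\<xi>, K)\<in>p. (g (Sup K) - g (Inf K)) *\<^sub>R f \<xi>) - (I b - I a)
        = (\<Sum>(\<xi>, K)\<in>p. (g (Sup K) - g (Inf K)) *\<^sub>R f \<xi> - (I (Sup K) - I (Inf K)))"
      by (simp add: additive_tagged_division_1[OF ab p, of I, symmetric] sum_subtractf split_beta)
    also have "norm \<dots> \<le> (\<Sum>(\<xi>, K')\<in>p. (K + C) * (2 * d) powr (\<theta> - 1) * (Sup K' - Inf K'))"
    proof (rule sum_norm_le, clarify)
      fix \<xi> K' assume xK: "(\<xi>, K') \<in> p"
      then obtain u v where uv: "K' = {u..v}" "u \<le> \<xi>" "\<xi> \<le> v" "a \<le> u" "v \<le> b" "Inf K' = u" "Sup K' = v"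
        using tagged_division_of_atLeastAtMostE[OF p] by metis
      have "K' \<subseteq> ball \<xi> d" using fine xK by (auto simp: fine_def)
      moreover have "u \<in> K'" "v \<in> K'" using uv by auto
      ultimately have "u \<in> ball \<xi> d" "v \<in> ball \<xi> d" by blast+
      then have vu: "v - u \<le> 2 * d" by (auto simp: dist_real_def)
      have "norm ((g v - g u) *\<^sub>R f \<xi> - (I v - I u))
          = norm ((g v - g u) *\<^sub>R (f \<xi> - f u) - (I v - I u - (g v - g u) *\<^sub>R f u))"
        by (simp add: algebra_simps)
      also have "\<dots> \<le> C * (v - u) powr \<theta> + K * (v - u) powr \<theta>"
        by (intro order_trans[OF norm_triangle_ineq4] add_mono germ tag) (use uv in auto)
      also have "\<dots> = (K + C) * ((v - u) powr (\<theta> - 1) * (v - u))"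
        using uv by (cases "u = v") (auto simp: powr_diff distrib_right add.commute)
      also have "\<dots> \<le> (K + C) * ((2 * d) powr (\<theta> - 1) * (v - u))"
        using KC vu uv \<theta> by (intro mult_left_mono mult_right_mono powr_mono2) auto
      finally show "norm ((g (Sup K') - g (Inf K')) *\<^sub>R f \<xi> - (I (Sup K') - I (Inf K')))
          \<le> (K + C) * (2 * d) powr (\<theta> - 1) * (Sup K' - Inf K')"
        unfolding uv(6,7) by (simp add: mult.assoc)
    qed
    also have "\<dots> = (K + C) * (2 * d) powr (\<theta> - 1) * (b - a)"
      using additive_tagged_division_1[OF ab p, of "\<lambda>x. x"]
      by (simp add: split_beta flip: sum_distrib_left)
    also have "\<dots> = (K + C) * (b - a) * (e / D)"
      by (simp add: dD)
    also have "\<dots> < D * (e / D)"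
    proof (rule mult_strict_right_mono)
      have "(K + C) * (b - a) \<le> (K + C + 1) * (b - a)" using KC ab by (intro mult_right_mono) auto
      also have "\<dots> < D" unfolding D_def using KC by (intro mult_strict_left_mono) auto
      finally show "(K + C) * (b - a) < D" .
    qed (use e D in auto)
    also have "\<dots> = e" using D by simp
    finally show "norm ((\<Sum>(\<xi>, K)\<in>p. (g (Sup K) - g (Inf K)) *\<^sub>R f \<xi>) - (I b - I a)) < e" .
  qed
qed

text \<open>\<open>sewing\<close> controls left-point sums. Moving a tag inside its cell costs a
  further P * Q * length^(\<gamma> + \<delta>), so the sums with arbitrary tags have the same
  limit.\<close>

lemma young_integral_exists:
  fixes f :: "real \<Rightarrow> 'a::banach" and g :: "real \<Rightarrow> real"
  assumes f: "holder \<gamma> P a b f" and g: "holder \<delta> Q a b g"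
    and pos: "0 \<le> P" "0 \<le> Q" "0 < \<gamma>" "0 < \<delta>" and \<theta>: "1 < \<gamma> + \<delta>"
  obtains I where "I a = 0"
    and "\<And>u v. a \<le> u \<Longrightarrow> u \<le> v \<Longrightarrow> v \<le> b \<Longrightarrow>
      norm (I v - I u - (g v - g u) *\<^sub>R f u) \<le> young_const (\<gamma> + \<delta>) * (P * Q) * (v - u) powr (\<gamma> + \<delta>)"
    and "\<And>u v. a \<le> u \<Longrightarrow> u \<le> v \<Longrightarrow> v \<le> b \<Longrightarrow> has_rs_integral f g u v (I v - I u)"
proof -
  obtain J where J: "\<And>u v. a \<le> u \<Longrightarrow> u \<le> v \<Longrightarrow> v \<le> b \<Longrightarrow>
      norm (J v - J u - (g v - g u) *\<^sub>R f u) \<le> young_const (\<gamma> + \<delta>) * (P * Q) * (v - u) powr (\<gamma> + \<delta>)"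
    using sewing[OF assms] by blast
  have "norm ((g v - g u) *\<^sub>R (f \<xi> - f u)) \<le> (P * Q) * (v - u) powr (\<gamma> + \<delta>)"
    if "a \<le> u" "u \<le> \<xi>" "\<xi> \<le> v" "v \<le> b" for u \<xi> v
  proof -
    have "norm ((g v - g u) *\<^sub>R (f \<xi> - f u)) = \<bar>g v - g u\<bar> * norm (f \<xi> - f u)"
      by simp
    also have "\<dots> \<le> (Q * (v - u) powr \<delta>) * (P * (\<xi> - u) powr \<gamma>)"
      using holderD[OF f, of u \<xi>] holderD[OF g, of u v] that pos by (intro mult_mono) auto
    also have "\<dots> \<le> (Q * (v - u) powr \<delta>) * (P * (v - u) powr \<gamma>)"
      using that pos by (intro mult_mono powr_mono2 mult_nonneg_nonneg) auto
    also have "\<dots> = (P * Q) * (v - u) powr (\<gamma> + \<delta>)"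
      by (simp add: powr_add)
    finally show ?thesis .
  qed
  then have "has_rs_integral f g u v (J v - J u)" if "a \<le> u" "u \<le> v" "v \<le> b" for u v
    using that pos young_const_pos[OF \<theta>]
    by (intro has_rs_integral_of_germ[OF \<theta>, where K = "young_const (\<gamma> + \<delta>) * (P * Q)" and C = "P * Q"] J) auto
  then show thesis using that[of "\<lambda>t. J t - J a"] J by simp
qed

section \<open>Continuous integrands against Lipschitz integrators\<close>

lemma rs_sum_lipschitz_bound:
  fixes h :: "real \<Rightarrow> 'a::real_normed_vector"
  assumes ab: "a \<le> b" and g: "holder 1 L a b g" and "0 \<le> B"
    and h: "\<And>s. a \<le> s \<Longrightarrow> s \<le> b \<Longrightarrow> norm (h s) \<le> B" and p: "p tagged_division_of {a..b}"
  shows "norm (\<Sum>(\<xi>, K)\<in>p. (g (Sup K) - g (Inf K)) *\<^sub>R h \<xi>) \<le> B * L * (b - a)"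
proof -
  have "norm (\<Sum>(\<xi>, K)\<in>p. (g (Sup K) - g (Inf K)) *\<^sub>R h \<xi>) \<le> (\<Sum>(\<xi>, K)\<in>p. B * L * (Sup K - Inf K))"
  proof (rule sum_norm_le, clarify)
    fix \<xi> K assume "(\<xi>, K) \<in> p"
    then obtain u v where uv: "K = {u..v}" "u \<le> \<xi>" "\<xi> \<le> v" "a \<le> u" "v \<le> b" "Inf K = u" "Sup K = v"
      using tagged_division_of_atLeastAtMostE[OF p] by metis
    have "norm ((g v - g u) *\<^sub>R h \<xi>) \<le> (L * (v - u)) * B"
      using holderD[OF g, of u v] h[of \<xi>] uv \<open>0 \<le> B\<close> by (auto intro!: mult_mono)
    then show "norm ((g (Sup K) - g (Inf K)) *\<^sub>R h \<xi>) \<le> B * L * (Sup K - Inf K)"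
      unfolding uv(6,7) by (simp add: mult.commute mult.left_commute)
  qed
  also have "\<dots> = B * L * (b - a)"
    using additive_tagged_division_1[OF ab p, of "\<lambda>x. x"]
    by (simp add: split_beta flip: sum_distrib_left)
  finally show ?thesis .
qed

lemma has_rs_integral_lipschitz_bound:
  fixes f :: "real \<Rightarrow> 'a::real_normed_vector"
  assumes I: "has_rs_integral f g a b I" and ab: "a \<le> b" and g: "holder 1 L a b g" and "0 \<le> B"
    and f: "\<And>s. a \<le> s \<Longrightarrow> s \<le> b \<Longrightarrow> norm (f s) \<le> B"
  shows "norm I \<le> B * L * (b - a)"
proof (rule field_le_epsilon)
  let ?S = "\<lambda>p. \<Sum>(\<xi>, K)\<in>p. (g (Sup K) - g (Inf K)) *\<^sub>R f \<xi>"
  fix e :: real assume "0 < e"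
  from I[unfolded has_rs_integral_def, rule_format, OF this] obtain d where d: "0 < d"
    "\<And>p. p tagged_division_of {a..b} \<Longrightarrow> (\<lambda>\<xi>. ball \<xi> d) fine p \<Longrightarrow> norm (?S p - I) < e" by blast
  have "gauge (\<lambda>\<xi>::real. ball \<xi> d)" using d by (intro gauge_ball) auto
  then obtain p where p: "p tagged_division_of {a..b}" "(\<lambda>\<xi>. ball \<xi> d) fine p"
    using fine_division_exists_real by blast
  have "norm (?S p) \<le> B * L * (b - a)"
    using ab g \<open>0 \<le> B\<close> f p(1) by (rule rs_sum_lipschitz_bound)
  with d(2)[OF p] norm_triangle_ineq4[of "?S p" "?S p - I"]
  show "norm I \<le> B * L * (b - a) + e" by simp
qed

lemma has_rs_integral_cong:
  assumes "\<And>s. a \<le> s \<Longrightarrow> s \<le> b \<Longrightarrow> f s = f' s"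
  shows "has_rs_integral f g a b I \<longleftrightarrow> has_rs_integral f' g a b I"
proof -
  have "(\<Sum>(\<xi>, K)\<in>p. (g (Sup K) - g (Inf K)) *\<^sub>R f \<xi>) = (\<Sum>(\<xi>, K)\<in>p. (g (Sup K) - g (Inf K)) *\<^sub>R f' \<xi>)"
    if "p tagged_division_of {a..b}" for p
  proof (intro sum.cong refl, clarify)
    fix \<xi> K assume "(\<xi>, K) \<in> p"
    then have "a \<le> \<xi>" "\<xi> \<le> b" using tagged_division_of_atLeastAtMostE[OF that] order_trans by metis+
    then show "(g (Sup K) - g (Inf K)) *\<^sub>R f \<xi> = (g (Sup K) - g (Inf K)) *\<^sub>R f' \<xi>"
      by (simp add: assms)
  qed
  then show ?thesis
    unfolding has_rs_integral_def by (intro all_cong1 ex_cong1 conj_cong imp_cong refl) simp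
qed

lemma has_rs_integral_diff:
  assumes I: "has_rs_integral f g a b I" and J: "has_rs_integral f' g a b J"
  shows "has_rs_integral (\<lambda>s. f s - f' s) g a b (I - J)"
  unfolding has_rs_integral_def
proof (intro allI impI)
  let ?S = "\<lambda>f p. \<Sum>(\<xi>, K)\<in>p. (g (Sup K) - g (Inf K)) *\<^sub>R f \<xi>"
  fix e :: real assume "0 < e"
  then have e: "0 < e / 2" by simp
  from I[unfolded has_rs_integral_def, rule_format, OF e] obtain d1 where d1: "0 < d1"
    "\<And>p. p tagged_division_of {a..b} \<Longrightarrow> (\<lambda>\<xi>. ball \<xi> d1) fine p \<Longrightarrow> norm (?S f p - I) < e / 2" by blast
  from J[unfolded has_rs_integral_def, rule_format, OF e] obtain d2 where d2: "0 < d2"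
    "\<And>p. p tagged_division_of {a..b} \<Longrightarrow> (\<lambda>\<xi>. ball \<xi> d2) fine p \<Longrightarrow> norm (?S f' p - J) < e / 2" by blast
  show "\<exists>d>0. \<forall>p. p tagged_division_of {a..b} \<and> (\<lambda>\<xi>. ball \<xi> d) fine p \<longrightarrow>
      norm (?S (\<lambda>s. f s - f' s) p - (I - J)) < e"
  proof (intro exI[of _ "min d1 d2"] conjI allI impI; (elim conjE)?)
    fix p assume p: "p tagged_division_of {a..b}" "(\<lambda>\<xi>. ball \<xi> (min d1 d2)) fine p"
    have "(\<lambda>\<xi>. ball \<xi> d1) fine p" "(\<lambda>\<xi>. ball \<xi> d2) fine p"
      using p(2) by (auto simp: fine_def subset_iff)
    with d1 d2 p have "norm (?S f p - I) < e / 2" "norm (?S f' p - J) < e / 2" by auto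
    moreover have eq: "?S (\<lambda>s. f s - f' s) p = ?S f p - ?S f' p"
      by (simp add: split_beta scaleR_right_diff_distrib sum_subtractf)
    moreover have "norm ((x - y) - (I - J)) \<le> norm (x - I) + norm (y - J)" for x y
      using norm_triangle_ineq4[of "x - I" "y - J"] by (simp add: algebra_simps)
    from this[of "?S f p" "?S f' p"] calculation
    show "norm (?S (\<lambda>s. f s - f' s) p - (I - J)) < e" unfolding eq by linarith
  qed (use d1 d2 in auto)
qed

text \<open>For a Lipschitz integrator all Stieltjes sums are Lipschitz in the sup norm of the
  integrand, with the constant \<open>L * (b - a)\<close> whatever the division; this permits the
  exchange of the two limits.\<close>

lemma has_rs_integral_uniform_limit:
  fixes f :: "real \<Rightarrow> 'a::banach"
  assumes P: "\<And>n. has_rs_integral (P n) g a b (J n)" and ab: "a \<le> b"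
    and g: "holder 1 L a b g"
    and e: "\<And>n s. a \<le> s \<Longrightarrow> s \<le> b \<Longrightarrow> norm (P n s - f s) \<le> e n" "\<And>n. 0 \<le> e n" "e \<longlonglongrightarrow> 0"
  shows "\<exists>I. J \<longlonglongrightarrow> I \<and> has_rs_integral f g a b I"
proof -
  let ?S = "\<lambda>f p. \<Sum>(\<xi>, K)\<in>p. (g (Sup K) - g (Inf K)) *\<^sub>R f \<xi>"
  define D where "D = L * (b - a)"
  have D: "0 \<le> D"
    using order_trans[OF norm_ge_zero holderD[OF g order_refl ab order_refl]] ab by (simp add: D_def)
  have JJ: "norm (J m - J n) \<le> (e m + e n) * D" for m n
  proof -
    have "norm (P m s - P n s) \<le> e m + e n" if "a \<le> s" "s \<le> b" for s
      using norm_triangle_ineq4[of "P m s - f s" "P n s - f s"] e(1)[OF that, of m] e(1)[OF that, of n] by simp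
    then show ?thesis
      using has_rs_integral_lipschitz_bound[OF has_rs_integral_diff[OF P P] ab g, of "e m + e n" m n] e(2)
      by (simp add: D_def mult.assoc)
  qed
  have "Cauchy J"
  proof (rule CauchyI)
    fix \<epsilon> :: real assume "0 < \<epsilon>"
    then have "\<forall>\<^sub>F n in sequentially. e n < \<epsilon> / (2 * (D + 1))"
      using D by (intro order_tendstoD(2)[OF e(3)]) auto
    then obtain N where N: "\<And>n. N \<le> n \<Longrightarrow> e n < \<epsilon> / (2 * (D + 1))"
      by (auto simp: eventually_sequentially)
    have "norm (J m - J n) < \<epsilon>" if "N \<le> m" "N \<le> n" for m n
    proof -
      have "e m + e n \<le> \<epsilon> / (2 * (D + 1)) + \<epsilon> / (2 * (D + 1))"
        using N[OF that(1)] N[OF that(2)] by linarith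
      also have "\<dots> = \<epsilon> / (D + 1)" using field_sum_of_halves[of "\<epsilon> / (D + 1)"] by (simp only: divide_divide_eq_left mult.commute)
      finally have "norm (J m - J n) \<le> \<epsilon> / (D + 1) * D"
        by (rule order_trans[OF JJ mult_right_mono[OF _ D]])
      also have "\<dots> = \<epsilon> * D / (D + 1)" by simp
      also have "\<dots> < \<epsilon>" using D \<open>0 < \<epsilon>\<close> by (simp add: pos_divide_less_eq)
      finally show ?thesis .
    qed
    then show "\<exists>M. \<forall>m\<ge>M. \<forall>n\<ge>M. norm (J m - J n) < \<epsilon>" by blast
  qed
  then obtain I where I: "J \<longlonglongrightarrow> I" by (auto simp: Cauchy_convergent_iff convergent_def)
  have "has_rs_integral f g a b I"
    unfolding has_rs_integral_def
  proof (intro allI impI)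
    fix \<epsilon> :: real assume "0 < \<epsilon>"
    then have \<epsilon>: "0 < \<epsilon> / 3" by simp
    have "\<forall>\<^sub>F n in sequentially. e n * D < \<epsilon> / 3 \<and> norm (J n - I) < \<epsilon> / 3"
      using order_tendstoD(2)[OF tendsto_mult_left_zero[OF e(3), of D] \<epsilon>] tendstoD[OF I \<epsilon>]
      by eventually_elim (simp add: dist_norm)
    then obtain n where n: "e n * D < \<epsilon> / 3" "norm (J n - I) < \<epsilon> / 3"
      by (auto simp: eventually_sequentially)
    from P[of n, unfolded has_rs_integral_def, rule_format, OF \<epsilon>] obtain d where d: "0 < d"
      "\<And>p. p tagged_division_of {a..b} \<Longrightarrow> (\<lambda>\<xi>. ball \<xi> d) fine p \<Longrightarrow> norm (?S (P n) p - J n) < \<epsilon> / 3" by blast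
    show "\<exists>d>0. \<forall>p. p tagged_division_of {a..b} \<and> (\<lambda>\<xi>. ball \<xi> d) fine p \<longrightarrow> norm (?S f p - I) < \<epsilon>"
    proof (intro exI[of _ d] conjI allI impI; (elim conjE)?)
      fix p assume p: "p tagged_division_of {a..b}" "(\<lambda>\<xi>. ball \<xi> d) fine p"
      have "norm (?S (\<lambda>s. P n s - f s) p) \<le> e n * L * (b - a)"
        using ab g e(2)[of n] e(1)[of _ n] p(1) by (rule rs_sum_lipschitz_bound)
      moreover have "?S (\<lambda>s. P n s - f s) p = ?S (P n) p - ?S f p"
        by (simp add: split_beta scaleR_right_diff_distrib sum_subtractf)
      ultimately have 1: "norm (?S (P n) p - ?S f p) < \<epsilon> / 3"
        using n(1) unfolding D_def mult.assoc by (simp only:)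
      have "norm (x - I) \<le> norm (y - J n) + norm (J n - I) + norm (y - x)" for x y
        using norm_triangle_ineq4[of "y - J n + (J n - I)" "y - x"] norm_triangle_ineq[of "y - J n" "J n - I"]
        by simp
      from this[of "?S f p" "?S (P n) p"] d(2)[OF p] n(2) 1 show "norm (?S f p - I) < \<epsilon>" by linarith
    qed (rule d)
  qed
  with I show ?thesis by blast
qed

lemma polynomial_function_holder_1:
  fixes P :: "real \<Rightarrow> 'a::euclidean_space"
  assumes "polynomial_function P"
  obtains B where "0 \<le> B" "holder 1 B a b P"
proof -
  obtain P' where P': "polynomial_function P'" "\<And>x. (P has_vector_derivative P' x) (at x)"
    using has_vector_derivative_polynomial_function[OF assms] by blast
  have "compact (P' ` {a..b})"
    by (intro compact_continuous_image continuous_on_polymonial_function P' compact_Icc)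
  then obtain B where B: "0 < B" "\<And>x. x \<in> {a..b} \<Longrightarrow> norm (P' x) \<le> B"
    by (auto simp: bounded_pos dest!: compact_imp_bounded)
  have "norm (P t - P s) \<le> B * (t - s) powr 1" if "a \<le> s" "s \<le> t" "t \<le> b" for s t
  proof -
    have "norm (P t - P s) \<le> B * norm (t - s)"
    proof (rule differentiable_bound[of "{a..b}" P "\<lambda>x h. h *\<^sub>R P' x"])
      show "(P has_derivative (\<lambda>h. h *\<^sub>R P' x)) (at x within {a..b})" for x
        using has_vector_derivative_at_within[OF P'(2)] by (simp add: has_vector_derivative_def)
      show "onorm (\<lambda>h. h *\<^sub>R P' x) \<le> B" if "x \<in> {a..b}" for x
        using mult_right_mono[OF B(2)[OF that] abs_ge_zero] by (intro onorm_le) (simp add: mult.commute)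
    qed (use that in auto)
    then show ?thesis using that by simp
  qed
  with B(1) show thesis by (intro that[of B] holderI) auto
qed

text \<open>A continuous function may have no Hoelder exponent, so the Young integral is out of
  reach. Polynomials are Lipschitz, which gives exponents 1 + 1 > 1, and the Weierstrass theorem
  with the uniform limit does the rest.\<close>

lemma continuous_lipschitz_integral_exists:
  fixes f :: "real \<Rightarrow> 'a::euclidean_space" and g :: "real \<Rightarrow> real"
  assumes f: "continuous_on {a..b} f" and g: "holder 1 L a b g" and "0 \<le> L"
  obtains I where "\<And>u v. a \<le> u \<Longrightarrow> u \<le> v \<Longrightarrow> v \<le> b \<Longrightarrow> has_rs_integral f g u v (I v - I u)"
proof -
  have "\<exists>P. polynomial_function P \<and> (\<forall>x\<in>{a..b}. norm (f x - P x) < 1 / real (Suc n))" for n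
    using Stone_Weierstrass_polynomial_function[OF compact_Icc f, of "1 / real (Suc n)"] by auto
  then obtain P where P: "\<And>n. polynomial_function (P n)"
    "\<And>n x. x \<in> {a..b} \<Longrightarrow> norm (f x - P n x) < 1 / real (Suc n)"
    by metis
  have "\<exists>I. I a = 0 \<and> (\<forall>u v. a \<le> u \<longrightarrow> u \<le> v \<longrightarrow> v \<le> b \<longrightarrow> has_rs_integral (P n) g u v (I v - I u))" for n
  proof -
    obtain B where "0 \<le> B" "holder 1 B a b (P n)" using polynomial_function_holder_1[OF P(1)] by blast
    then show ?thesis
      by (rule_tac young_integral_exists[of 1 B a b "P n" 1 L g]) (use g \<open>0 \<le> L\<close> in auto)
  qed
  then obtain I where I: "\<And>n. I n a = 0"
    "\<And>n u v. a \<le> u \<Longrightarrow> u \<le> v \<Longrightarrow> v \<le> b \<Longrightarrow> has_rs_integral (P n) g u v (I n v - I n u)"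
    by metis
  have lim: "\<exists>J. (\<lambda>n. I n v - I n u) \<longlonglongrightarrow> J \<and> has_rs_integral f g u v J" if "a \<le> u" "u \<le> v" "v \<le> b" for u v
  proof (rule has_rs_integral_uniform_limit[OF I(2)[OF that] that(2)])
    show "holder 1 L u v g" using holder_subinterval[OF g that(1,3)] .
    show "norm (P n s - f s) \<le> 1 / real (Suc n)" if "u \<le> s" "s \<le> v" for n s
      using P(2)[of s n] that \<open>a \<le> u\<close> \<open>v \<le> b\<close> by (simp add: norm_minus_commute)
    show "(\<lambda>n. 1 / real (Suc n)) \<longlonglongrightarrow> 0" using LIMSEQ_inverse_real_of_nat by (simp add: inverse_eq_divide)
  qed auto
  have "\<exists>J. (\<lambda>n. I n v) \<longlonglongrightarrow> J" if "a \<le> v" "v \<le> b" for v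
    using lim[OF order_refl that] I(1) by auto
  then obtain J where J: "\<And>v. a \<le> v \<Longrightarrow> v \<le> b \<Longrightarrow> (\<lambda>n. I n v) \<longlonglongrightarrow> J v"
    by metis
  show thesis
  proof (rule that[of J])
    fix u v assume uv: "a \<le> u" "u \<le> v" "v \<le> b"
    then have "(\<lambda>n. I n v - I n u) \<longlonglongrightarrow> J v - J u" by (intro tendsto_diff J) auto
    with lim[OF uv] show "has_rs_integral f g u v (J v - J u)"
      using LIMSEQ_unique by blast
  qed
qed

section \<open>Coordinates of the signature\<close>

text \<open>Calculus with iterated integrals is done on germs: they are linear and, for \<theta> >
  1, determine the primitive up to a constant. The constant \<open>C\<close> stays existential;
  sharp bounds come from \<open>young_germ_bound\<close>.\<close>

definition has_germ :: "real \<Rightarrow> real \<Rightarrow> real \<Rightarrow> (real \<Rightarrow> real \<Rightarrow> real) \<Rightarrow> (real \<Rightarrow> real) \<Rightarrow> bool" where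
  "has_germ \<theta> a b A I \<longleftrightarrow>
     (\<exists>C. \<forall>u v. a \<le> u \<longrightarrow> u \<le> v \<longrightarrow> v \<le> b \<longrightarrow> \<bar>I v - I u - A u v\<bar> \<le> C * (v - u) powr \<theta>)"

lemma has_germ_subinterval: "has_germ \<theta> a b A I \<Longrightarrow> a \<le> a' \<Longrightarrow> b' \<le> b \<Longrightarrow> has_germ \<theta> a' b' A I"
  unfolding has_germ_def by (meson order_trans)

lemma has_germ_cong:
  assumes "\<And>u v. a \<le> u \<Longrightarrow> u \<le> v \<Longrightarrow> v \<le> b \<Longrightarrow> A u v = A' u v"
    and "\<And>u. a \<le> u \<Longrightarrow> u \<le> b \<Longrightarrow> I u = I' u"
  shows "has_germ \<theta> a b A I \<longleftrightarrow> has_germ \<theta> a b A' I'"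
proof -
  have "I v - I u - A u v = I' v - I' u - A' u v" if "a \<le> u" "u \<le> v" "v \<le> b" for u v
    using assms(1)[OF that] assms(2)[of u] assms(2)[of v] that by simp
  then show ?thesis
    unfolding has_germ_def by (intro ex_cong1 all_cong1 imp_cong refl) simp
qed

lemma has_germ_add:
  assumes "has_germ \<theta> a b A I" "has_germ \<theta> a b B J"
  shows "has_germ \<theta> a b (\<lambda>u v. A u v + B u v) (\<lambda>t. I t + J t)"
proof -
  obtain C D where C: "\<And>u v. a \<le> u \<Longrightarrow> u \<le> v \<Longrightarrow> v \<le> b \<Longrightarrow> \<bar>I v - I u - A u v\<bar> \<le> C * (v - u) powr \<theta>"
    and D: "\<And>u v. a \<le> u \<Longrightarrow> u \<le> v \<Longrightarrow> v \<le> b \<Longrightarrow> \<bar>J v - J u - B u v\<bar> \<le> D * (v - u) powr \<theta>"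
    using assms unfolding has_germ_def by blast
  have "\<bar>I v + J v - (I u + J u) - (A u v + B u v)\<bar> \<le> (C + D) * (v - u) powr \<theta>"
    if "a \<le> u" "u \<le> v" "v \<le> b" for u v
    using C[OF that] D[OF that] unfolding distrib_right by linarith
  then show ?thesis unfolding has_germ_def by blast
qed

lemma has_germ_cmult:
  assumes "has_germ \<theta> a b A I"
  shows "has_germ \<theta> a b (\<lambda>u v. c * A u v) (\<lambda>t. c * I t)"
proof -
  obtain C where C: "\<And>u v. a \<le> u \<Longrightarrow> u \<le> v \<Longrightarrow> v \<le> b \<Longrightarrow> \<bar>I v - I u - A u v\<bar> \<le> C * (v - u) powr \<theta>"
    using assms unfolding has_germ_def by blast
  have "\<bar>c * I v - c * I u - c * A u v\<bar> \<le> \<bar>c\<bar> * C * (v - u) powr \<theta>"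
    if "a \<le> u" "u \<le> v" "v \<le> b" for u v
    using mult_left_mono[OF C[OF that] abs_ge_zero[of c]]
    by (simp add: mult.assoc flip: right_diff_distrib abs_mult)
  then show ?thesis unfolding has_germ_def by blast
qed

lemma has_germ_diff:
  assumes "has_germ \<theta> a b A I" "has_germ \<theta> a b B J"
  shows "has_germ \<theta> a b (\<lambda>u v. A u v - B u v) (\<lambda>t. I t - J t)"
  using has_germ_add[OF assms(1) has_germ_cmult[OF assms(2), of "-1"]] by simp

lemma has_germ_unique:
  assumes "1 < \<theta>" and I: "has_germ \<theta> a b A I" and J: "has_germ \<theta> a b A J"
    and "a \<le> u" "u \<le> v" "v \<le> b"
  shows "I v - I u = J v - J u"
proof -
  obtain C where "\<And>u v. a \<le> u \<Longrightarrow> u \<le> v \<Longrightarrow> v \<le> b \<Longrightarrow> \<bar>I v - J v - (I u - J u)\<bar> \<le> C * (v - u) powr \<theta>"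
    using has_germ_diff[OF I J] unfolding has_germ_def by auto
  then have "holder \<theta> C a b (\<lambda>t. I t - J t)" by (simp add: holder_def)
  from constant_if_superlinear_modulus[OF this assms(1,4-6)] show ?thesis by simp
qed

text \<open>The Young-Loeve estimate. Both |f u - f a| and the sewing error lose one factor (b -
  a)^\<beta>, so the value at the left end point stands alone and \<open>P\<close> carries a factor
  that is small on short intervals. This is the recursion of \<open>holder_coeff\<close>.\<close>

lemma young_germ_bound:
  fixes f Y I :: "real \<Rightarrow> real"
  assumes \<beta>: "1 / 2 < \<beta>" and f: "holder \<beta> P a b f" and Y: "holder \<beta> H a b Y" and pos: "0 \<le> P" "0 \<le> H"
    and I: "has_germ (2 * \<beta>) a b (\<lambda>u v. f u * (Y v - Y u)) I"
  shows "holder \<beta> (H * (\<bar>f a\<bar> + (1 + young_const (2 * \<beta>)) * (b - a) powr \<beta> * P)) a b I"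
proof (rule holderI)
  fix u v assume uv: "a \<le> u" "u \<le> v" "v \<le> b"
  have "1 < \<beta> + \<beta>" using \<beta> by simp
  \<comment> \<open>The germ of \<open>I\<close> carries no explicit constant; the sewn primitive
    \<open>J\<close> does, and uniqueness identifies the increments of the two.\<close>
  with \<beta> obtain J where J: "\<And>u v. a \<le> u \<Longrightarrow> u \<le> v \<Longrightarrow> v \<le> b \<Longrightarrow>
      norm (J v - J u - (Y v - Y u) *\<^sub>R f u) \<le> young_const (\<beta> + \<beta>) * (P * H) * (v - u) powr (\<beta> + \<beta>)"
    by (rule_tac young_integral_exists[OF f Y pos]) auto
  have "has_germ (2 * \<beta>) a b (\<lambda>u v. f u * (Y v - Y u)) J"
    unfolding has_germ_def using J by (auto simp: mult.commute[of "f _"])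
  then have "I v - I u = J v - J u"
    using \<beta> I uv by (intro has_germ_unique[of "2 * \<beta>"]) auto
  moreover have "\<bar>J v - J u\<bar> \<le> \<bar>(Y v - Y u) * f u\<bar> + young_const (2 * \<beta>) * (P * H) * (v - u) powr (2 * \<beta>)"
    using J[OF uv] by simp
  moreover have "\<bar>(Y v - Y u) * f u\<bar> \<le> (H * (v - u) powr \<beta>) * (\<bar>f a\<bar> + (b - a) powr \<beta> * P)"
  proof -
    have "\<bar>f u - f a\<bar> \<le> P * (u - a) powr \<beta>" using holderD[OF f, of a u] uv by simp
    also have "\<dots> \<le> P * (b - a) powr \<beta>" using uv pos \<beta> by (intro mult_left_mono powr_mono2) auto
    finally have "\<bar>f u\<bar> \<le> \<bar>f a\<bar> + (b - a) powr \<beta> * P" by (simp add: mult.commute)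
    moreover have "\<bar>Y v - Y u\<bar> \<le> H * (v - u) powr \<beta>" using holderD[OF Y uv] by simp
    ultimately show ?thesis unfolding abs_mult using pos by (intro mult_mono) auto
  qed
  moreover have "young_const (2 * \<beta>) * (P * H) * (v - u) powr (2 * \<beta>)
      \<le> young_const (2 * \<beta>) * (P * H) * ((b - a) powr \<beta> * (v - u) powr \<beta>)"
  proof -
    have "(v - u) powr (2 * \<beta>) = (v - u) powr \<beta> * (v - u) powr \<beta>" by (simp only: mult_2 powr_add)
    also have "\<dots> \<le> (b - a) powr \<beta> * (v - u) powr \<beta>"
      using uv \<beta> by (intro mult_right_mono powr_mono2) auto
    finally show ?thesis
      using pos young_const_pos[of "2 * \<beta>"] \<beta> by (intro mult_left_mono) auto
  qed
  ultimately show "norm (I v - I u) \<le> H * (\<bar>f a\<bar> + (1 + young_const (2 * \<beta>)) * (b - a) powr \<beta> * P) * (v - u) powr \<beta>"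
    by (simp add: algebra_simps)
qed

text \<open>\<open>rs_integral\<close> is a definite description, so even its value on the
  degenerate interval needs an argument: all cells of a division of {0} are points and contribute
  nothing.\<close>

lemma signature_rev_Cons_0 [simp]: "signature_rev y (i # u) 0 = 0"
proof -
  have "has_rs_integral (signature_rev y u) (\<lambda>s. y s $ i) 0 0 0"
    unfolding has_rs_integral_def
  proof (intro allI impI exI[of _ 1] conjI; (elim conjE)?)
    fix e :: real and p assume "0 < e" and p: "p tagged_division_of {0..0::real}"
    have "(\<Sum>(\<xi>, K)\<in>p. (y (Sup K) $ i - y (Inf K) $ i) *\<^sub>R signature_rev y u \<xi>) = 0"
    proof (rule sum.neutral, clarify)
      fix \<xi> K assume "(\<xi>, K) \<in> p"
      then obtain s t where "0 \<le> s" "t \<le> 0" "s \<le> \<xi>" "\<xi> \<le> t" "Inf K = s" "Sup K = t"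
        using tagged_division_of_atLeastAtMostE[OF p] by metis
      then have "Sup K = Inf K" by linarith
      then show "(y (Sup K) $ i - y (Inf K) $ i) *\<^sub>R signature_rev y u \<xi> = 0" by simp
    qed
    with \<open>0 < e\<close> show "norm ((\<Sum>(\<xi>, K)\<in>p. (y (Sup K) $ i - y (Inf K) $ i) *\<^sub>R signature_rev y u \<xi>) - 0) < e"
      by simp
  qed auto
  then show ?thesis by (simp add: rs_integral_eq)
qed

lemma signature_rev_Cons_germ:
  assumes \<beta>: "1 / 2 < \<beta>" and y: "holder \<beta> H 0 T y" and "0 \<le> H"
    and u: "holder \<beta> P 0 T (signature_rev y u)" and "0 \<le> P"
  shows "has_germ (2 * \<beta>) 0 T (\<lambda>s t. signature_rev y u s * (y t $ i - y s $ i)) (signature_rev y (i # u))"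
proof -
  have "1 < \<beta> + \<beta>" using \<beta> by simp
  with \<beta> obtain I where I: "I 0 = 0" "\<And>s t. 0 \<le> s \<Longrightarrow> s \<le> t \<Longrightarrow> t \<le> T \<Longrightarrow>
      norm (I t - I s - (y t $ i - y s $ i) *\<^sub>R signature_rev y u s)
        \<le> young_const (\<beta> + \<beta>) * (P * H) * (t - s) powr (\<beta> + \<beta>)"
    "\<And>s t. 0 \<le> s \<Longrightarrow> s \<le> t \<Longrightarrow> t \<le> T \<Longrightarrow> has_rs_integral (signature_rev y u) (\<lambda>s. y s $ i) s t (I t - I s)"
    by (rule_tac young_integral_exists[OF u holder_component[OF y, of i] \<open>0 \<le> P\<close> \<open>0 \<le> H\<close>]) auto
  have "has_germ (2 * \<beta>) 0 T (\<lambda>s t. signature_rev y u s * (y t $ i - y s $ i)) I"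
    unfolding has_germ_def using I(2) by (auto simp: mult.commute[of "signature_rev _ _ _"])
  moreover have "signature_rev y (i # u) t = I t" if "0 \<le> t" "t \<le> T" for t
    using rs_integral_eq[OF I(3)[OF order_refl that]] I(1) by simp
  ultimately show ?thesis
    using has_germ_cong[of 0 T "\<lambda>s t. signature_rev y u s * (y t $ i - y s $ i)" _ I "signature_rev y (i # u)"] by simp
qed

text \<open>Existence of all iterated integrals: a Hoelder coordinate can be integrated once more,
  and by \<open>young_germ_bound\<close> the result is Hoelder again with the same exponent.\<close>

lemma signature_rev_holder:
  assumes \<beta>: "1 / 2 < \<beta>" and y: "holder \<beta> H 0 T y" and "0 \<le> H"
  shows "\<exists>P\<ge>0. holder \<beta> P 0 T (signature_rev y u)"
proof (induction u)
  case Nil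
  show ?case by (intro exI[of _ 0]) (simp add: holder_const)
next
  case (Cons i u)
  then obtain P where P: "0 \<le> P" "holder \<beta> P 0 T (signature_rev y u)" by blast
  define Q where "Q = H * (\<bar>signature_rev y u 0\<bar> + (1 + young_const (2 * \<beta>)) * (T - 0) powr \<beta> * P)"
  have "0 \<le> Q"
    unfolding Q_def using young_const_pos[of "2 * \<beta>"] \<beta> P(1) \<open>0 \<le> H\<close> by simp
  moreover have "holder \<beta> Q 0 T (signature_rev y (i # u))"
    unfolding Q_def
    by (rule young_germ_bound[OF \<beta> P(2) holder_component[OF y] P(1) \<open>0 \<le> H\<close>
          signature_rev_Cons_germ[OF \<beta> y \<open>0 \<le> H\<close> P(2,1)]])
  ultimately show ?case by blast
qed

lemma signature_rev_germ:
  assumes "1 / 2 < \<beta>" and "holder \<beta> H 0 T y" and "0 \<le> H"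
  shows "has_germ (2 * \<beta>) 0 T (\<lambda>s t. signature_rev y u s * (y t $ i - y s $ i)) (signature_rev y (i # u))"
  using signature_rev_holder[OF assms, of u] signature_rev_Cons_germ[OF assms] by blast

text \<open>Both sides have the same germ and the same value at 0. The shift \<open>d\<close> drops
  out since only increments of the path enter.\<close>

lemma signature_rev_scale:
  assumes "1 / 2 < \<beta>" and y: "holder \<beta> H 0 T y" and "0 \<le> H"
    and yz: "\<And>t. 0 \<le> t \<Longrightarrow> t \<le> T \<Longrightarrow> z t = c *\<^sub>R (y t - d)" and "0 \<le> t" "t \<le> T"
  shows "signature_rev z u t = c ^ length u * signature_rev y u t"
  using \<open>0 \<le> t\<close> \<open>t \<le> T\<close>
proof (induction u arbitrary: t)
  case Nil
  show ?case by simp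
next
  case (Cons i u)
  have z: "holder \<beta> (\<bar>c\<bar> * H) 0 T z"
    using holder_scaleR[OF holder_diff[OF y holder_const[OF order_refl, of _ _ _ d]], of c] yz
      holder_cong[of 0 T z "\<lambda>t. c *\<^sub>R (y t - d)"] by simp
  have 1: "has_germ (2 * \<beta>) 0 T (\<lambda>s t. signature_rev z u s * (z t $ i - z s $ i)) (signature_rev z (i # u))"
    using signature_rev_germ[OF assms(1) z] \<open>0 \<le> H\<close> by simp
  have 2: "has_germ (2 * \<beta>) 0 T (\<lambda>s t. c ^ length (i # u) * (signature_rev y u s * (y t $ i - y s $ i)))
      (\<lambda>t. c ^ length (i # u) * signature_rev y (i # u) t)"
    by (rule has_germ_cmult[OF signature_rev_germ[OF assms(1-3)]])
  have "signature_rev z u s * (z t $ i - z s $ i) = c ^ length (i # u) * (signature_rev y u s * (y t $ i - y s $ i))"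
    if "0 \<le> s" "s \<le> t" "t \<le> T" for s t
    using that by (simp add: Cons.IH yz algebra_simps)
  then have "has_germ (2 * \<beta>) 0 T (\<lambda>s t. signature_rev z u s * (z t $ i - z s $ i))
      (\<lambda>t. c ^ length (i # u) * signature_rev y (i # u) t)"
    by (subst has_germ_cong[OF _ refl]) (use 2 in auto)
  from has_germ_unique[OF _ 1 this, of 0 t] assms(1) Cons.prems
  show ?case by (simp del: signature_rev.simps(2) power_Suc)
qed

lemma signature_scale:
  assumes "1 / 2 < \<beta>" and "holder \<beta> H 0 T y" and "0 \<le> H"
    and "\<And>t. 0 \<le> t \<Longrightarrow> t \<le> T \<Longrightarrow> z t = c *\<^sub>R (y t - d)" and "0 \<le> t" "t \<le> T"
  shows "signature z t = dilation c (signature y t)"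
  using signature_rev_scale[OF assms] by (simp add: signature_def dilation_def fun_eq_iff)

lemma signature_cong:
  assumes "1 / 2 < \<beta>" and "holder \<beta> H 0 T y" and "0 \<le> H"
    and "\<And>t. 0 \<le> t \<Longrightarrow> t \<le> T \<Longrightarrow> z t = y t" and "0 \<le> t" "t \<le> T"
  shows "signature z t = signature y t"
  using signature_scale[OF assms(1-3), of z 1 0 t] assms(4-) by (simp add: dilation_def)

section \<open>Stopped paths\<close>

lemma holder_stopped:
  assumes y: "holder \<beta> H 0 s y" and "0 \<le> s" "0 \<le> H" "0 \<le> \<beta>"
  shows "holder \<beta> H 0 T (\<lambda>t. y (min t s))"
proof (rule holderI)
  fix u v assume "0 \<le> u" "u \<le> v" "v \<le> T"
  then have "norm (y (min v s) - y (min u s)) \<le> H * (min v s - min u s) powr \<beta>"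
    using assms by (intro holderD[OF y]) auto
  also have "\<dots> \<le> H * (v - u) powr \<beta>"
    using assms \<open>u \<le> v\<close> by (intro mult_left_mono powr_mono2) auto
  finally show "norm (y (min v s) - y (min u s)) \<le> H * (v - u) powr \<beta>" .
qed

text \<open>After \<open>s\<close> the stopped path has zero increments, so every coordinate has the
  zero germ on [s, t] and stays constant. Signatures at different times thereby become signatures at
  one time of different paths.\<close>

lemma signature_stopped:
  assumes \<beta>: "1 / 2 < \<beta>" and y: "holder \<beta> H 0 s y" and H: "0 \<le> H" and st: "0 \<le> s" "s \<le> t"
  shows "signature (\<lambda>t. y (min t s)) t = signature y s"
proof -
  let ?z = "\<lambda>t. y (min t s)"
  have z: "holder \<beta> H 0 t ?z" using holder_stopped[OF y] \<beta> H st by simp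
  have "signature_rev ?z u t = signature_rev ?z u s" for u
  proof (cases u)
    case (Cons i v)
    have "has_germ (2 * \<beta>) s t (\<lambda>a b. signature_rev ?z v a * (?z b $ i - ?z a $ i)) (signature_rev ?z (i # v))"
      using has_germ_subinterval[OF signature_rev_germ[OF \<beta> z H] st(1) order_refl] .
    then have "has_germ (2 * \<beta>) s t (\<lambda>a b. 0) (signature_rev ?z (i # v))"
      by (subst has_germ_cong[OF _ refl]) (auto simp del: signature_rev.simps)
    from has_germ_unique[OF _ this, of "\<lambda>_. 0" s t] \<beta> st
    have "signature_rev ?z (i # v) t - signature_rev ?z (i # v) s = 0"
      by (simp add: has_germ_def exI[of _ 0])
    then show ?thesis by (simp add: Cons)
  qed simp
  then have "signature ?z t = signature ?z s" by (simp add: signature_def)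
  also have "\<dots> = signature y s"
    using st by (intro signature_cong[OF \<beta> y H]) auto
  finally show ?thesis .
qed

section \<open>Growth of the signature in the weighted norm\<close>

lemma finite_words_length_le: "finite {u :: 'm::finite list. length u \<le> N}"
  using finite_lists_length_le[of "UNIV :: 'm set" N] by simp

text \<open>A truncated weighted \<ell>^1 norm over words. In contrast to Euclidean norms of levels
  it follows the recursion on letters exactly, and the truncation makes all sums finite, so bounds
  uniform in \<open>N\<close> can be proved by induction.\<close>

definition word_sum :: "real \<Rightarrow> nat \<Rightarrow> ('m::finite list \<Rightarrow> real) \<Rightarrow> real" where
  "word_sum l N c = (\<Sum>u | length u \<le> N. l ^ length u * c u)"

lemma word_sum_0 [simp]: "word_sum l 0 c = c []"
  by (simp add: word_sum_def)

lemma word_sum_Suc: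
  "word_sum l (Suc N) (c :: 'm::finite list \<Rightarrow> real) = c [] + l * (\<Sum>i\<in>UNIV. word_sum l N (\<lambda>u. c (i # u)))"
proof -
  let ?W = "{u :: 'm list. length u \<le> N}"
  have W: "{u :: 'm list. length u \<le> Suc N} = insert [] ((\<lambda>(i, u). i # u) ` (UNIV \<times> ?W))"
  proof (intro set_eqI iffI)
    fix u :: "'m list" assume "u \<in> {u. length u \<le> Suc N}"
    then show "u \<in> insert [] ((\<lambda>(i, u). i # u) ` (UNIV \<times> ?W))" by (cases u) (auto intro!: rev_image_eqI)
  qed auto
  have inj: "inj_on (\<lambda>(i, u). i # u) (UNIV \<times> ?W)" by (auto simp: inj_on_def)
  have "word_sum l (Suc N) c = c [] + (\<Sum>u\<in>(\<lambda>(i, u). i # u) ` (UNIV \<times> ?W). l ^ length u * c u)"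
    unfolding word_sum_def W by (subst sum.insert) (auto simp: finite_words_length_le)
  also have "(\<Sum>u\<in>(\<lambda>(i, u). i # u) ` (UNIV \<times> ?W). l ^ length u * c u)
      = (\<Sum>i\<in>UNIV. \<Sum>u\<in>?W. l * (l ^ length u * c (i # u)))"
    unfolding sum.reindex[OF inj] sum.cartesian_product by (intro sum.cong refl) (auto simp: mult.assoc)
  finally show ?thesis by (simp add: word_sum_def sum_distrib_left)
qed

lemma word_sum_mono:
  assumes "0 \<le> l" "\<And>u. c u \<le> d u"
  shows "word_sum l N c \<le> word_sum l N d"
  unfolding word_sum_def using assms by (intro sum_mono mult_left_mono) auto

lemma word_sum_nonneg:
  assumes "0 \<le> l" "\<And>u. 0 \<le> c u"
  shows "0 \<le> word_sum l N c"
  unfolding word_sum_def using assms by (intro sum_nonneg mult_nonneg_nonneg) auto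

lemma word_sum_le_Suc:
  assumes "0 \<le> l" "\<And>u. 0 \<le> c u"
  shows "word_sum l N c \<le> word_sum l (Suc N) c"
  unfolding word_sum_def using assms finite_words_length_le
  by (intro sum_mono2 mult_nonneg_nonneg) auto

lemma word_sum_add: "word_sum l N (\<lambda>u. c u + d u) = word_sum l N c + word_sum l N d"
  by (simp add: word_sum_def distrib_left sum.distrib)

lemma word_sum_zero [simp]: "word_sum l N (\<lambda>_. 0) = 0"
  by (simp add: word_sum_def)

lemma word_sum_cmult: "word_sum l N (\<lambda>u. k * c u) = k * word_sum l N c"
  by (simp add: word_sum_def sum_distrib_left mult.left_commute)

text \<open>Hoelder constants of the coordinates of a signature on a short interval, for a path of Hoelder
  constant \<open>H\<close>: \<open>c u\<close> is the absolute value at the left end point, \<open>q\<close> carries the Young--Loeve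
  constant and the length of the interval, and \<open>r\<close> is a source term, needed for the difference of
  two signatures.\<close>

primrec holder_coeff :: "real \<Rightarrow> real \<Rightarrow> ('m list \<Rightarrow> real) \<Rightarrow> ('m list \<Rightarrow> real) \<Rightarrow> 'm list \<Rightarrow> real" where
  "holder_coeff H q c r [] = 0"
| "holder_coeff H q c r (i # u) = H * (c u + q * holder_coeff H q c r u) + r u"

lemma holder_coeff_nonneg:
  assumes "0 \<le> H" "0 \<le> q" "\<And>u. 0 \<le> c u" "\<And>u. 0 \<le> r u"
  shows "0 \<le> holder_coeff H q c r u"
  using assms by (induction u) auto

text \<open>Splitting off a letter gives X(N+1) = m l B(N) + m l H q X(N), where \<open>m\<close> is
  the number of letters. The smallness condition makes the last factor at most 1 / 2, so the bound 2
  m l B reproduces itself, starting from X(0) = 0.\<close>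

lemma word_sum_holder_coeff:
  fixes c r :: "'m::finite list \<Rightarrow> real"
  assumes nonneg: "0 \<le> l" "0 \<le> H" "0 \<le> q" "\<And>u. 0 \<le> c u" "\<And>u. 0 \<le> r u"
    and small: "real CARD('m) * l * H * q \<le> 1 / 2"
  shows "word_sum l N (holder_coeff H q c r)
    \<le> 2 * real CARD('m) * l * (H * word_sum l N c + word_sum l N r)"
proof (induction N)
  case 0
  show ?case using nonneg by simp
next
  case (Suc N)
  let ?m = "real CARD('m)" and ?X = "word_sum l N (holder_coeff H q c r)"
  let ?B = "\<lambda>N. H * word_sum l N c + word_sum l N r"
  have "word_sum l (Suc N) (holder_coeff H q c r) = l * (?m * (H * (word_sum l N c + q * ?X) + word_sum l N r))"
    by (simp add: word_sum_Suc word_sum_add word_sum_cmult)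
  also have "\<dots> = ?m * l * ?B N + ?m * l * H * q * ?X"
    by (simp add: algebra_simps)
  also have "\<dots> \<le> ?m * l * ?B N + 1 / 2 * ?X"
    using nonneg by (intro add_left_mono mult_right_mono small word_sum_nonneg holder_coeff_nonneg)
  also have "\<dots> \<le> 2 * ?m * l * ?B N"
    using Suc.IH by linarith
  also have "\<dots> \<le> 2 * ?m * l * ?B (Suc N)"
    using nonneg by (intro mult_left_mono add_mono word_sum_le_Suc) auto
  finally show ?case .
qed

lemma signature_rev_holder_coeff:
  fixes y :: "real \<Rightarrow> real ^ 'm::finite"
  assumes \<beta>: "1 / 2 < \<beta>" and y: "holder \<beta> H 0 T y" and H: "0 \<le> H" and ab: "0 \<le> a" "a \<le> b" "b \<le> T"
    and q: "q = (1 + young_const (2 * \<beta>)) * (b - a) powr \<beta>"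
  shows "holder \<beta> (holder_coeff H q (\<lambda>u. \<bar>signature_rev y u a\<bar>) (\<lambda>_. 0) u) a b (signature_rev y u)"
proof (induction u)
  case (Cons i u)
  have "0 \<le> q" using young_const_pos[of "2 * \<beta>"] \<beta> by (simp add: q)
  then have "0 \<le> holder_coeff H q (\<lambda>u. \<bar>signature_rev y u a\<bar>) (\<lambda>_. 0) u"
    using H by (intro holder_coeff_nonneg) auto
  from young_germ_bound[OF \<beta> Cons holder_subinterval[OF holder_component[OF y] ab(1,3)] this H
      has_germ_subinterval[OF signature_rev_germ[OF \<beta> y H] ab(1,3)]]
  show ?case by (simp add: q del: signature_rev.simps)
qed (simp add: holder_const)

text \<open>Discrete product rule: f dY - g dZ = (f - g) dY + g d(Y - Z). The first term repeats the
  recursion of a single signature, the second is the source term, proportional to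
  \<open>e\<close>.\<close>

lemma signature_rev_diff_holder_coeff:
  fixes y z :: "real \<Rightarrow> real ^ 'm::finite"
  assumes \<beta>: "1 / 2 < \<beta>" and y: "holder \<beta> H 0 T y" and z: "holder \<beta> H 0 T z" and H: "0 \<le> H"
    and yz: "holder \<beta> e 0 T (\<lambda>t. y t - z t)" and e: "0 \<le> e" and ab: "0 \<le> a" "a \<le> b" "b \<le> T"
    and q: "q = (1 + young_const (2 * \<beta>)) * (b - a) powr \<beta>"
  shows "holder \<beta> (holder_coeff H q (\<lambda>u. \<bar>signature_rev y u a - signature_rev z u a\<bar>)
      (\<lambda>u. e * (\<bar>signature_rev z u a\<bar> + q * holder_coeff H q (\<lambda>u. \<bar>signature_rev z u a\<bar>) (\<lambda>_. 0) u)) u)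
      a b (\<lambda>t. signature_rev y u t - signature_rev z u t)"
    (is "holder \<beta> (holder_coeff H q ?c ?r u) a b _")
proof (induction u)
  case (Cons i u)
  let ?f = "\<lambda>t. signature_rev y u t - signature_rev z u t" and ?g = "signature_rev z u"
  let ?Y = "\<lambda>t. y t $ i" and ?Z = "\<lambda>t. y t $ i - z t $ i"
  let ?b = "holder_coeff H q (\<lambda>u. \<bar>signature_rev z u a\<bar>) (\<lambda>_. 0) u"
  have q0: "0 \<le> q" using young_const_pos[of "2 * \<beta>"] \<beta> by (simp add: q)
  have b: "0 \<le> ?b" using q0 H by (intro holder_coeff_nonneg) auto
  have P: "0 \<le> holder_coeff H q ?c ?r u"
    using q0 H e by (intro holder_coeff_nonneg mult_nonneg_nonneg add_nonneg_nonneg) auto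
  have Y: "holder \<beta> H a b ?Y" using holder_subinterval[OF holder_component[OF y] ab(1,3)] .
  have Z: "holder \<beta> e a b ?Z"
    using holder_subinterval[OF holder_component[OF yz, of i] ab(1,3)] by simp
  have g: "holder \<beta> ?b a b ?g" using signature_rev_holder_coeff[OF \<beta> z H ab q] .
  have \<beta>2: "1 < \<beta> + \<beta>" using \<beta> by simp
  have germ_exists: "\<exists>J. has_germ (2 * \<beta>) a b (\<lambda>s t. h s * (X t - X s)) J"
    if X: "holder \<beta> A a b h" "holder \<beta> B a b X" "0 \<le> A" "0 \<le> B" for A B h X
  proof -
    obtain J where J: "\<And>u v. a \<le> u \<Longrightarrow> u \<le> v \<Longrightarrow> v \<le> b \<Longrightarrow>
        norm (J v - J u - (X v - X u) *\<^sub>R h u) \<le> young_const (\<beta> + \<beta>) * (A * B) * (v - u) powr (\<beta> + \<beta>)"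
      using \<beta> \<beta>2 by (rule_tac young_integral_exists[OF X]) auto
    then show ?thesis
      unfolding has_germ_def by (intro exI[of _ J]) (auto simp: mult.commute[of "h _"])
  qed
  obtain J1 where J1: "has_germ (2 * \<beta>) a b (\<lambda>s t. ?f s * (?Y t - ?Y s)) J1"
    using germ_exists[OF Cons Y P H] by blast
  obtain J2 where J2: "has_germ (2 * \<beta>) a b (\<lambda>s t. ?g s * (?Z t - ?Z s)) J2"
    using germ_exists[OF g Z b e] by blast
  have J: "holder \<beta> (H * (?c u + q * holder_coeff H q ?c ?r u) + e * (\<bar>?g a\<bar> + q * ?b)) a b (\<lambda>t. J1 t + J2 t)"
    unfolding q using holder_add[OF young_germ_bound[OF \<beta> Cons Y P H J1] young_germ_bound[OF \<beta> g Z b e J2]]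
    by (simp add: q)
  have "has_germ (2 * \<beta>) 0 T (\<lambda>s t. signature_rev y u s * (?Y t - ?Y s) - ?g s * (z t $ i - z s $ i))
      (\<lambda>t. signature_rev y (i # u) t - signature_rev z (i # u) t)"
    by (rule has_germ_diff[OF signature_rev_germ[OF \<beta> y H] signature_rev_germ[OF \<beta> z H]])
  then have D: "has_germ (2 * \<beta>) a b (\<lambda>s t. signature_rev y u s * (?Y t - ?Y s) - ?g s * (z t $ i - z s $ i))
      (\<lambda>t. signature_rev y (i # u) t - signature_rev z (i # u) t)"
    using ab by (rule_tac has_germ_subinterval)
  \<comment> \<open>The product rule at the level of germs; uniqueness then carries the Hoelder
    bound of \<open>J1\<close> + \<open>J2\<close> over to the difference of the
    coordinates.\<close>
  have eq: "(\<lambda>s t. ?f s * (?Y t - ?Y s) + ?g s * (?Z t - ?Z s))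
      = (\<lambda>s t. signature_rev y u s * (?Y t - ?Y s) - ?g s * (z t $ i - z s $ i))"
    by (simp add: fun_eq_iff algebra_simps)
  have J12: "has_germ (2 * \<beta>) a b (\<lambda>s t. signature_rev y u s * (?Y t - ?Y s) - ?g s * (z t $ i - z s $ i))
      (\<lambda>t. J1 t + J2 t)"
    using has_germ_add[OF J1 J2] unfolding eq .
  have inc: "signature_rev y (i # u) t - signature_rev z (i # u) t - (signature_rev y (i # u) s - signature_rev z (i # u) s)
      = J1 t + J2 t - (J1 s + J2 s)" if "a \<le> s" "s \<le> t" "t \<le> b" for s t
    using has_germ_unique[OF _ D J12 that] \<beta> by simp
  show ?case
    by (rule holderI) (use inc holderD[OF J] in \<open>simp del: signature_rev.simps\<close>)
qed (simp add: holder_const)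

text \<open>Over the interval a coordinate grows by at most \<open>h\<close> times its Hoelder
  constant. The sum of these constants is at most 2 m l H times the sum at the left end, and h * 2 m
  l H \<le> 1, hence the factor 2.\<close>

lemma word_sum_signature_step:
  fixes y z :: "real \<Rightarrow> real ^ 'm::finite"
  assumes \<beta>: "1 / 2 < \<beta>" and y: "holder \<beta> H 0 T y" and z: "holder \<beta> H 0 T z" and H: "1 \<le> H"
    and yz: "holder \<beta> e 0 T (\<lambda>t. y t - z t)" and e: "0 \<le> e" and ab: "0 \<le> a" "a \<le> b" "b \<le> T"
    and l: "0 \<le> l" and small: "real CARD('m) * l * H * ((1 + young_const (2 * \<beta>)) * (b - a) powr \<beta>) \<le> 1 / 2"
  shows "word_sum l N (\<lambda>u. \<bar>signature_rev z u b\<bar>) \<le> 2 * word_sum l N (\<lambda>u. \<bar>signature_rev z u a\<bar>)" (is ?th1)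
    and "word_sum l N (\<lambda>u. \<bar>signature_rev y u b - signature_rev z u b\<bar>)
      \<le> 2 * word_sum l N (\<lambda>u. \<bar>signature_rev y u a - signature_rev z u a\<bar>)
        + 2 * e * word_sum l N (\<lambda>u. \<bar>signature_rev z u a\<bar>)" (is ?th2)
proof -
  let ?m = "real CARD('m)"
  define q where "q = (1 + young_const (2 * \<beta>)) * (b - a) powr \<beta>"
  define h where "h = (b - a) powr \<beta>"
  define P where "P = word_sum l N (\<lambda>u. \<bar>signature_rev z u a\<bar>)"
  define E where "E = word_sum l N (\<lambda>u. \<bar>signature_rev y u a - signature_rev z u a\<bar>)"
  have H0: "0 \<le> H" using H by simp
  have h: "0 \<le> h" "h \<le> q"
    using young_const_pos[of "2 * \<beta>"] \<beta> by (auto simp: q_def h_def mult_le_cancel_right1)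
  then have q0: "0 \<le> q" by simp
  have P: "0 \<le> P" and E: "0 \<le> E" unfolding P_def E_def using l by (auto intro!: word_sum_nonneg)
  have small': "?m * l * H * q \<le> 1 / 2" using small by (simp add: q_def)
  \<comment> \<open>The condition \<open>small\<close> speaks of \<open>q\<close>, which dominates
    \<open>h\<close> because 1 + \<open>young_const\<close> is at least 1.\<close>
  have hm: "h * (2 * ?m * l * H) \<le> 1"
  proof -
    have "(2 * ?m * l * H) * h \<le> (2 * ?m * l * H) * q" using l H0 h by (intro mult_left_mono) auto
    with small' show ?thesis by (simp add: mult.commute mult.left_commute)
  qed
  let ?bz = "holder_coeff H q (\<lambda>u. \<bar>signature_rev z u a\<bar>) (\<lambda>_. 0)"
  let ?r = "\<lambda>u. e * (\<bar>signature_rev z u a\<bar> + q * ?bz u)"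
  let ?d = "holder_coeff H q (\<lambda>u. \<bar>signature_rev y u a - signature_rev z u a\<bar>) ?r"
  have bz0: "0 \<le> ?bz u" for u using q0 H0 by (intro holder_coeff_nonneg) auto
  have bz: "word_sum l N ?bz \<le> 2 * ?m * l * H * P"
    using word_sum_holder_coeff[OF l H0 q0 _ _ small', of "\<lambda>u. \<bar>signature_rev z u a\<bar>" "\<lambda>_. 0" N]
    by (simp add: P_def mult.assoc)
  have r: "word_sum l N ?r \<le> e * (2 * P)"
  proof -
    have "q * word_sum l N ?bz \<le> q * (2 * ?m * l * H * P)" using q0 bz by (rule mult_left_mono[rotated])
    also have "\<dots> = (2 * (?m * l * H * q)) * P" by simp
    also have "\<dots> \<le> 1 * P" using small' P by (intro mult_right_mono) auto
    finally show ?thesis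
      unfolding word_sum_cmult word_sum_add P_def[symmetric] using e by (intro mult_left_mono) auto
  qed
  have d: "word_sum l N ?d \<le> 2 * ?m * l * (H * E + e * (2 * P))"
  proof -
    have "word_sum l N ?d \<le> 2 * ?m * l * (H * E + word_sum l N ?r)"
      unfolding E_def using e q0 bz0
      by (intro word_sum_holder_coeff[OF l H0 q0 _ _ small'] mult_nonneg_nonneg add_nonneg_nonneg) auto
    also have "\<dots> \<le> 2 * ?m * l * (H * E + e * (2 * P))" using l r by (intro mult_left_mono) auto
    finally show ?thesis .
  qed
  have end_le: "\<bar>g b\<bar> \<le> \<bar>g a\<bar> + h * k" if "holder \<beta> k a b g" for g :: "real \<Rightarrow> real" and k
    using holderD[OF that order_refl ab(2) order_refl] by (simp add: h_def mult.commute)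
  have "word_sum l N (\<lambda>u. \<bar>signature_rev z u b\<bar>) \<le> word_sum l N (\<lambda>u. \<bar>signature_rev z u a\<bar> + h * ?bz u)"
    using l by (intro word_sum_mono end_le signature_rev_holder_coeff[OF \<beta> z H0 ab q_def])
  also have "\<dots> = P + h * word_sum l N ?bz" by (simp add: word_sum_add word_sum_cmult P_def)
  also have "\<dots> \<le> P + h * (2 * ?m * l * H * P)" using h bz by (intro add_left_mono mult_left_mono)
  also have "\<dots> = P + (h * (2 * ?m * l * H)) * P" by simp
  also have "\<dots> \<le> P + 1 * P" using hm P by (intro add_left_mono mult_right_mono)
  finally show ?th1 by (simp add: P_def)
  have "word_sum l N (\<lambda>u. \<bar>signature_rev y u b - signature_rev z u b\<bar>)
      \<le> word_sum l N (\<lambda>u. \<bar>signature_rev y u a - signature_rev z u a\<bar> + h * ?d u)"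
    using l by (intro word_sum_mono end_le signature_rev_diff_holder_coeff[OF \<beta> y z H0 yz e ab q_def])
  also have "\<dots> = E + h * word_sum l N ?d" by (simp add: word_sum_add word_sum_cmult E_def)
  also have "\<dots> \<le> E + h * (2 * ?m * l * (H * E + e * (2 * P)))"
    using h d by (intro add_left_mono mult_left_mono)
  also have "\<dots> = E + (h * (2 * ?m * l * H)) * E + (h * (2 * ?m * l)) * (e * (2 * P))"
    by (simp add: algebra_simps)
  also have "\<dots> \<le> E + 1 * E + 1 * (e * (2 * P))"
  proof (intro add_mono mult_right_mono order_refl hm)
    \<comment> \<open>The source term comes without the factor \<open>H\<close>; the hypothesis 1
      \<le> H lets \<open>hm\<close> cover it as well.\<close>
    have "h * (2 * ?m * l) * 1 \<le> h * (2 * ?m * l) * H" using h l H by (intro mult_left_mono) auto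
    also have "\<dots> = h * (2 * ?m * l * H)" by (simp only: mult.assoc)
    finally show "h * (2 * ?m * l) \<le> 1" using hm by linarith
  qed (use E P e in auto)
  finally show ?th2 by (simp add: E_def P_def)
qed

text \<open>Over J equal steps the recursions P' \<le> 2 P and E' \<le> 2 E + 2 e P, started at P =
  1 and E = 0, give P \<le> 2^j and E \<le> e j 2^j. The factor j \<le> 2^j is absorbed by passing
  to 4^J.\<close>

lemma word_sum_signature_bound:
  fixes y z :: "real \<Rightarrow> real ^ 'm::finite"
  assumes \<beta>: "1 / 2 < \<beta>" and y: "holder \<beta> H 0 t y" and z: "holder \<beta> H 0 t z" and H: "1 \<le> H"
    and yz: "holder \<beta> e 0 t (\<lambda>t. y t - z t)" and e: "0 \<le> e" and t: "0 \<le> t" and l: "0 \<le> l" and J: "0 < J"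
    and small: "real CARD('m) * l * H * ((1 + young_const (2 * \<beta>)) * (t / real J) powr \<beta>) \<le> 1 / 2"
  shows "word_sum l N (\<lambda>u. \<bar>signature_rev z u t\<bar>) \<le> 4 ^ J"
    and "word_sum l N (\<lambda>u. \<bar>signature_rev y u t - signature_rev z u t\<bar>) \<le> e * 4 ^ J"
proof -
  define \<tau> where "\<tau> j = real j * t / real J" for j
  define P where "P s = word_sum l N (\<lambda>u. \<bar>signature_rev z u s\<bar>)" for s
  define E where "E s = word_sum l N (\<lambda>u. \<bar>signature_rev y u s - signature_rev z u s\<bar>)" for s
  have P0: "P 0 = 1"
    by (cases N) (simp_all add: P_def word_sum_Suc del: signature_rev.simps(2))
  have E0: "E 0 = 0"
  proof -
    have "\<bar>signature_rev y u 0 - signature_rev z u 0\<bar> = 0" for u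
      by (cases u) (simp_all del: signature_rev.simps(2))
    then show ?thesis by (simp add: E_def word_sum_def)
  qed
  have "P (\<tau> j) \<le> 2 ^ j \<and> E (\<tau> j) \<le> e * real j * 2 ^ j" if "j \<le> J" for j
    using that
  proof (induction j)
    case 0
    show ?case by (simp add: \<tau>_def P0 E0)
  next
    case (Suc j)
    have IH: "P (\<tau> j) \<le> 2 ^ j" "E (\<tau> j) \<le> e * real j * 2 ^ j" using Suc by auto
    have ab: "0 \<le> \<tau> j" "\<tau> j \<le> \<tau> (Suc j)" "\<tau> (Suc j) \<le> t"
      using t J Suc.prems mult_right_mono[of "real (Suc j)" "real J" t] mult_left_mono[of "real j" "1 + real j" t]
      by (auto simp: \<tau>_def divide_simps mult.commute intro!: divide_right_mono mult_right_mono)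
    have "\<tau> (Suc j) - \<tau> j = t / real J"
      by (simp add: \<tau>_def diff_divide_distrib[symmetric] algebra_simps)
    then have small': "real CARD('m) * l * H * ((1 + young_const (2 * \<beta>)) * (\<tau> (Suc j) - \<tau> j) powr \<beta>) \<le> 1 / 2"
      using small by simp
    note step = word_sum_signature_step[OF \<beta> y z H yz e ab l small', of N, folded P_def E_def]
    have "P (\<tau> (Suc j)) \<le> 2 ^ Suc j" using step(1) IH(1) by simp
    moreover have "E (\<tau> (Suc j)) \<le> 2 * (e * real j * 2 ^ j) + 2 * e * 2 ^ j"
      using e by (intro order_trans[OF step(2)] add_mono mult_left_mono IH) auto
    ultimately show ?case by (simp add: algebra_simps)
  qed
  from this[of J] have PE: "P t \<le> 2 ^ J" "E t \<le> e * (real J * 2 ^ J)"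
    using J by (auto simp: \<tau>_def mult.assoc)
  have "(2::real) ^ J \<le> 4 ^ J" by (intro power_mono) auto
  with PE show "word_sum l N (\<lambda>u. \<bar>signature_rev z u t\<bar>) \<le> 4 ^ J" by (simp add: P_def)
  have "real J * 2 ^ J \<le> 2 ^ J * 2 ^ J" by (intro mult_right_mono of_nat_less_two_power[THEN less_imp_le]) auto
  also have "\<dots> = (4::real) ^ J" by (simp flip: power_mult_distrib)
  finally show "word_sum l N (\<lambda>u. \<bar>signature_rev y u t - signature_rev z u t\<bar>) \<le> e * 4 ^ J"
    using PE(2) mult_left_mono[OF _ e] order_trans unfolding E_def by blast
qed

section \<open>From sums over words to the weighted norm\<close>

lemma word_sum_rev: "word_sum l N (\<lambda>u. c (rev u)) = word_sum l N c"
  unfolding word_sum_def by (rule sum.reindex_bij_witness[of _ rev rev]) auto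

lemma norm1_le_word_sum:
  fixes a :: "'m::finite tensor_series"
  assumes l: "0 \<le> l" and X: "\<And>N. word_sum l N (\<lambda>u. \<bar>a u\<bar>) \<le> X"
  shows "norm1 l a \<le> ennreal X"
  unfolding norm1_def
proof (rule suminf_le_const[OF summableI])
  fix N
  have "(\<Sum>n<N. l ^ n * level_norm n a) \<le> (\<Sum>n\<le>N. l ^ n * level_norm n a)"
    using l by (intro sum_mono2) (auto simp: level_norm_def L2_set_nonneg)
  also have "\<dots> \<le> (\<Sum>n\<le>N. \<Sum>u | u \<in> {u. length u \<le> N} \<and> length u = n. l ^ length u * \<bar>a u\<bar>)"
  proof (rule sum_mono)
    fix n assume "n \<in> {..N}"
    then have W: "{u. u \<in> {u. length u \<le> N} \<and> length u = n} = {u :: 'm list. length u = n}" by auto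
    have "l ^ n * level_norm n a \<le> l ^ n * (\<Sum>u | length u = n. \<bar>a u\<bar>)"
      unfolding level_norm_def using l by (intro mult_left_mono L2_set_le_sum_abs) auto
    also have "\<dots> = (\<Sum>u | length u = n. l ^ length u * \<bar>a u\<bar>)"
      by (simp add: sum_distrib_left)
    finally show "l ^ n * level_norm n a
        \<le> (\<Sum>u | u \<in> {u. length u \<le> N} \<and> length u = n. l ^ length u * \<bar>a u\<bar>)"
      unfolding W .
  qed
  also have "\<dots> = word_sum l N (\<lambda>u. \<bar>a u\<bar>)"
    unfolding word_sum_def by (rule sum.group) (auto simp: finite_words_length_le)
  also have "\<dots> \<le> X" by (rule X)
  finally have "ennreal (\<Sum>n<N. l ^ n * level_norm n a) \<le> ennreal X" by (rule ennreal_leI)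
  then show "(\<Sum>n<N. ennreal (l ^ n * level_norm n a)) \<le> ennreal X"
    using l by (subst sum_ennreal) (auto simp: level_norm_def L2_set_nonneg)
qed

text \<open>The summand k = 0 of \<open>Z_const\<close> is 1, as \<open>0 powr p\<close> is 0, so
  the division by \<open>Z_const\<close> only decreases the norm.\<close>

lemma weighted_norm_le:
  assumes X: "\<And>k. norm1 (lam k) a \<le> ennreal (X k)" "\<And>k. 0 \<le> X k"
    and sm: "summable (\<lambda>k. exp (- (real k powr p)) * X k)"
  shows "weighted_norm p lam a \<le> ennreal (\<Sum>k. exp (- (real k powr p)) * X k)"
proof -
  let ?e = "\<lambda>k. exp (- (real k powr p))"
  have "(\<Sum>k\<in>{0}. ennreal (?e k)) \<le> Z_const p"
    unfolding Z_const_def by (rule sum_le_suminf) auto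
  then have Z: "1 \<le> Z_const p" by simp
  have "weighted_norm p lam a \<le> (\<Sum>k. ennreal (?e k) * norm1 (lam k) a)"
    unfolding weighted_norm_def
  proof (rule divide_le_posI_ennreal)
    show "0 < Z_const p" using Z by (rule less_le_trans[OF zero_less_one])
    show "(\<Sum>k. ennreal (?e k) * norm1 (lam k) a) \<le> Z_const p * (\<Sum>k. ennreal (?e k) * norm1 (lam k) a)"
      using mult_right_mono[OF Z zero_le] by simp
  qed
  also have "\<dots> \<le> (\<Sum>k. ennreal (?e k * X k))"
    by (intro suminf_le summableI) (simp add: ennreal_mult X mult_left_mono)
  also have "\<dots> = ennreal (\<Sum>k. ?e k * X k)"
    using X(2) by (intro suminf_ennreal2 sm) auto
  finally show ?thesis .
qed

text \<open>The number of steps of the subdivision grows like \<open>\<lambda>\<^sub>k\<^bsup>1/\<beta>\<^esup> = o(k\<^sup>p)\<close>, so doubling at every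
  step is compensated by the weights \<open>exp (- k\<^sup>p)\<close>.\<close>

lemma step_numbers_exist:
  assumes \<beta>: "0 < \<beta>" and p: "1 < p" and lam: "\<And>k. 0 < lam k"
    and lim: "(\<lambda>k. lam k powr (1 / \<beta>) / real k powr p) \<longlonglongrightarrow> 0" and c: "0 < c" and T: "0 \<le> T"
  obtains J :: "nat \<Rightarrow> nat" where "\<And>k. 0 < J k" "\<And>k. c * lam k * (T / real (J k)) powr \<beta> \<le> 1 / 2"
    "summable (\<lambda>k. exp (- (real k powr p)) * 4 ^ J k)"
proof -
  \<comment> \<open>J \<ge> x k is equivalent to T / J \<le> (2 c lam k)^(-1/\<beta>), which is the
    required smallness. The summand 1 in \<open>J\<close> below keeps it positive even when
    \<open>x k\<close> is 0.\<close>
  define x where "x k = T * (2 * c * lam k) powr (1 / \<beta>)" for k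
  define J where "J k = nat \<lceil>x k\<rceil> + 1" for k
  \<comment> \<open>With this \<open>D\<close>, 4^(x k) = exp (D * lam k powr (1 /
    \<beta>)).\<close>
  define D where "D = ln 4 * T * (2 * c) powr (1 / \<beta>)"
  have x0: "0 \<le> x k" for k using T by (simp add: x_def)
  have J1: "x k \<le> real (J k)" and J2: "real (J k) \<le> x k + 2" for k
    using x0[of k] unfolding J_def by (auto, linarith+)
  have D0: "0 \<le> D" using T by (simp add: D_def)
  have Dx: "ln 4 * x k = D * lam k powr (1 / \<beta>)" for k
    using c lam[of k] by (simp add: x_def D_def powr_mult)
  have "c * lam k * (T / real (J k)) powr \<beta> \<le> 1 / 2" for k
  proof -
    have J0: "0 < real (J k)" by (simp add: J_def)
    have y: "0 < 2 * c * lam k" using c lam by simp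
    define w where "w = (2 * c * lam k) powr (1 / \<beta>)"
    have w: "0 < w" using c lam[of k] by (simp add: w_def)
    have "T / real (J k) \<le> 1 / w"
      using J1[of k] J0 w by (simp add: x_def w_def[symmetric] pos_le_divide_eq pos_divide_le_eq)
    also have "1 / w = (1 / (2 * c * lam k)) powr (1 / \<beta>)"
      using y by (simp add: w_def powr_divide)
    finally have "T / real (J k) \<le> (1 / (2 * c * lam k)) powr (1 / \<beta>)" .
    then have "(T / real (J k)) powr \<beta> \<le> ((1 / (2 * c * lam k)) powr (1 / \<beta>)) powr \<beta>"
      using T J0 \<beta> by (intro powr_mono2) auto
    also have "\<dots> = 1 / (2 * c * lam k)" using \<beta> y by (simp add: powr_powr)
    finally have "c * lam k * (T / real (J k)) powr \<beta> \<le> c * lam k * (1 / (2 * c * lam k))"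
      using y by (intro mult_left_mono) auto
    also have "\<dots> = 1 / 2" using c lam[of k] by simp
    finally show ?thesis .
  qed
  moreover have "summable (\<lambda>k. exp (- (real k powr p)) * 4 ^ J k)"
  proof (rule summable_comparison_test_ev)
    \<comment> \<open>From some \<open>k\<close> on, the growth exponent uses up at most half of
      k^p, and the other half is at least k / 2. The factor 16 = 4^2 comes from J k \<le> x k +
      2.\<close>
    have "\<forall>\<^sub>F k in sequentially. lam k powr (1 / \<beta>) / real k powr p < 1 / (2 * (D + 1))"
      using D0 by (intro order_tendstoD(2)[OF lim]) simp
    then show "\<forall>\<^sub>F k in sequentially. norm (exp (- (real k powr p)) * 4 ^ J k) \<le> 16 * exp (- 1 / 2) ^ k"
      using eventually_ge_at_top[of 1]
    proof eventually_elim
      case (elim k)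
      have k: "1 \<le> real k" using elim by simp
      have kp: "real k \<le> real k powr p" using powr_mono[of 1 p "real k"] p k by simp
      have "D * lam k powr (1 / \<beta>) \<le> (D + 1) * (1 / (2 * (D + 1)) * real k powr p)"
        using elim(1) k D0 by (intro mult_mono) (auto simp: pos_divide_less_eq)
      also have "\<dots> = real k powr p / 2" using D0 by (simp add: field_simps)
      finally have "ln 4 * x k \<le> real k powr p / 2" unfolding Dx .
      then have 1: "ln 4 * x k - real k powr p \<le> - 1 / 2 * real k" using kp by linarith
      have "4 ^ J k = (4::real) powr real (J k)" by (simp add: powr_realpow)
      also have "\<dots> \<le> 4 powr (x k + 2)" by (intro powr_mono J2) auto
      also have "\<dots> = 16 * exp (ln 4 * x k)" by (simp add: powr_add) (simp add: powr_def mult.commute)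
      finally have "exp (- (real k powr p)) * 4 ^ J k \<le> exp (- (real k powr p)) * (16 * exp (ln 4 * x k))"
        by (rule mult_left_mono) simp
      also have "\<dots> = 16 * exp (ln 4 * x k - real k powr p)" by (simp add: exp_diff exp_minus field_simps)
      also have "\<dots> \<le> 16 * exp (- 1 / 2 * real k)" using 1 by simp
      also have "\<dots> = 16 * exp (- 1 / 2) ^ k" unfolding exp_of_nat2_mult ..
      finally show ?case by simp
    qed
    show "summable (\<lambda>k. 16 * exp (- 1 / 2 :: real) ^ k)"
      by (intro summable_mult summable_geometric) simp
  qed
  ultimately show thesis by (intro that[of J]) (auto simp: J_def)
qed

text \<open>Step numbers chosen for the full length \<open>T\<close> serve every t \<le> T, and they
  depend on the paths only through \<open>H\<close>. This makes \<open>K\<close> uniform over times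
  and over all paths with constant \<open>H\<close>.\<close>

lemma signature_weighted_norm_bounds:
  assumes \<beta>: "1 / 2 < \<beta>" and p: "1 < p" and lam: "\<And>k. 0 < lam k"
    and lim: "(\<lambda>k. lam k powr (1 / \<beta>) / real k powr p) \<longlonglongrightarrow> 0" and H: "1 \<le> H" and T: "0 \<le> T"
  obtains K where "0 \<le> K"
    "\<And>t (z :: real \<Rightarrow> real ^ 'm::finite). 0 \<le> t \<Longrightarrow> t \<le> T \<Longrightarrow> holder \<beta> H 0 t z \<Longrightarrow>
       weighted_norm p lam (signature z t) \<le> ennreal K"
    "\<And>t e (y :: real \<Rightarrow> real ^ 'm) z. 0 \<le> t \<Longrightarrow> t \<le> T \<Longrightarrow> holder \<beta> H 0 t y \<Longrightarrow> holder \<beta> H 0 t z \<Longrightarrow>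
       0 \<le> e \<Longrightarrow> holder \<beta> e 0 t (\<lambda>s. y s - z s) \<Longrightarrow>
       weighted_norm p lam (signature y t - signature z t) \<le> ennreal (K * e)"
proof -
  define c where "c = real CARD('m) * H * (1 + young_const (2 * \<beta>))"
  have c: "0 < c" using H young_const_pos[of "2 * \<beta>"] \<beta> by (simp add: c_def)
  obtain J :: "nat \<Rightarrow> nat" where J: "\<And>k. 0 < J k" "\<And>k. c * lam k * (T / real (J k)) powr \<beta> \<le> 1 / 2"
    "summable (\<lambda>k. exp (- (real k powr p)) * 4 ^ J k)"
    using step_numbers_exist[OF _ p lam lim c T] \<beta> by auto
  define K where "K = (\<Sum>k. exp (- (real k powr p)) * 4 ^ J k)"
  have small: "real CARD('m) * lam k * H * ((1 + young_const (2 * \<beta>)) * (t / real (J k)) powr \<beta>) \<le> 1 / 2"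
    if "0 \<le> t" "t \<le> T" for t k
  proof -
    have "(t / real (J k)) powr \<beta> \<le> (T / real (J k)) powr \<beta>"
      using that \<beta> by (intro powr_mono2 divide_right_mono) auto
    then have "c * lam k * (t / real (J k)) powr \<beta> \<le> c * lam k * (T / real (J k)) powr \<beta>"
      using c lam[of k] by (intro mult_left_mono) auto
    with J(2)[of k] show ?thesis by (simp add: c_def mult_ac)
  qed
  have 1: "weighted_norm p lam (signature y t - signature z t) \<le> ennreal (K * e)"
    if "0 \<le> t" "t \<le> T" "holder \<beta> H 0 t y" "holder \<beta> H 0 t z" "0 \<le> e" "holder \<beta> e 0 t (\<lambda>s. y s - z s)"
    for t e and y z :: "real \<Rightarrow> real ^ 'm"
  proof -
    have "norm1 (lam k) (signature y t - signature z t) \<le> ennreal (4 ^ J k * e)" for k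
      using word_sum_signature_bound(2)[OF \<beta> that(3,4) H that(6,5,1) less_imp_le[OF lam] J(1) small[OF that(1,2)]]
        word_sum_rev[of "lam k" _ "\<lambda>u. \<bar>signature_rev y u t - signature_rev z u t\<bar>"] lam[of k]
      by (intro norm1_le_word_sum) (auto simp: signature_def mult.commute)
    from weighted_norm_le[OF this, where p = p] that(5) summable_mult2[OF J(3), of e]
    show ?thesis by (simp add: K_def suminf_mult2[OF J(3)] mult.assoc)
  qed
  have 2: "weighted_norm p lam (signature z t) \<le> ennreal K"
    if "0 \<le> t" "t \<le> T" "holder \<beta> H 0 t z" for t and z :: "real \<Rightarrow> real ^ 'm"
  proof -
    \<comment> \<open>The estimate is stated for pairs of paths; here \<open>z\<close> is paired
      with itself and e = 0.\<close>
    have "holder \<beta> 0 0 t (\<lambda>s. z s - z s)" by (simp add: holder_const)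
    from word_sum_signature_bound(1)[OF \<beta> that(3,3) H this order_refl that(1) less_imp_le[OF lam] J(1) small[OF that(1,2)]]
    have "norm1 (lam k) (signature z t) \<le> ennreal (4 ^ J k)" for k
      using word_sum_rev[of "lam k" _ "\<lambda>u. \<bar>signature_rev z u t\<bar>"] lam[of k]
      by (intro norm1_le_word_sum) (auto simp: signature_def)
    from weighted_norm_le[OF this _ J(3)] show ?thesis by (simp add: K_def)
  qed
  have "0 \<le> K" unfolding K_def by (intro suminf_nonneg J(3)) auto
  from this 2 1 show thesis by (rule that)
qed

section \<open>Integrals of continuous coefficients against a Lipschitz control\<close>

lemma holder_join:
  assumes A: "holder \<gamma> A a s y" and B: "holder \<gamma> B s b y" and "0 \<le> A" "0 \<le> B" "0 \<le> \<gamma>"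
  shows "holder \<gamma> (A + B) a b y"
proof (rule holderI)
  fix u v assume uv: "a \<le> u" "u \<le> v" "v \<le> b"
  have AB: "A * (v - u) powr \<gamma> \<le> (A + B) * (v - u) powr \<gamma>" "B * (v - u) powr \<gamma> \<le> (A + B) * (v - u) powr \<gamma>"
    using assms by (auto intro!: mult_right_mono)
  consider "v \<le> s" | "s \<le> u" | "u \<le> s" "s \<le> v" by linarith
  then show "norm (y v - y u) \<le> (A + B) * (v - u) powr \<gamma>"
  proof cases
    case 1
    then show ?thesis using holderD[OF A uv(1,2)] AB by linarith
  next
    case 2
    then show ?thesis using holderD[OF B _ uv(2,3)] AB by linarith
  next
    case 3
    have "norm (y v - y u) \<le> norm (y v - y s) + norm (y s - y u)"
      using norm_triangle_ineq[of "y v - y s" "y s - y u"] by simp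
    also have "\<dots> \<le> B * (v - s) powr \<gamma> + A * (s - u) powr \<gamma>"
      using 3 uv by (intro add_mono holderD[OF A] holderD[OF B]) auto
    also have "\<dots> \<le> B * (v - u) powr \<gamma> + A * (v - u) powr \<gamma>"
      using 3 uv assms by (intro add_mono mult_left_mono powr_mono2) auto
    finally show ?thesis by (simp add: distrib_right)
  qed
qed

text \<open>The time before \<open>a\<close> adds nothing, as D r = D (max r a). After it, lowering
  the exponent gains a power of the length. This is the source of smallness both in
  \<open>continuous_along_path\<close> and in \<open>local_contraction\<close>.\<close>

lemma holder_constant_then:
  assumes D: "\<And>u. 0 \<le> u \<Longrightarrow> u \<le> a \<Longrightarrow> D u = D a" and R: "holder \<gamma> R a b D"
    and "0 \<le> \<beta>" "\<beta> \<le> \<gamma>" "a \<le> b" "0 \<le> R"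
  shows "holder \<beta> (R * (b - a) powr (\<gamma> - \<beta>)) 0 b D"
proof (rule holderI)
  fix u v assume uv: "0 \<le> u" "u \<le> v" "v \<le> b"
  have *: "D r = D (max r a)" if "0 \<le> r" for r using D[of r] that by (auto simp: max_def)
  have "norm (D v - D u) = norm (D (max v a) - D (max u a))"
    using *[of u] *[of v] uv by simp
  also have "\<dots> \<le> (R * (b - a) powr (\<gamma> - \<beta>)) * (max v a - max u a) powr \<beta>"
    using uv assms by (intro holderD[OF holder_exponent[OF R]]) auto
  also have "\<dots> \<le> (R * (b - a) powr (\<gamma> - \<beta>)) * (v - u) powr \<beta>"
    using uv assms by (intro mult_left_mono powr_mono2) auto
  finally show "norm (D v - D u) \<le> R * (b - a) powr (\<gamma> - \<beta>) * (v - u) powr \<beta>" .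
qed

lemma holder_limit:
  assumes "\<And>n. holder \<gamma> (H n) a b (f n)" and "H \<longlonglongrightarrow> K"
    and "\<And>t. a \<le> t \<Longrightarrow> t \<le> b \<Longrightarrow> (\<lambda>n. f n t) \<longlonglongrightarrow> g t"
  shows "holder \<gamma> K a b g"
proof (rule holderI)
  fix s t assume st: "a \<le> s" "s \<le> t" "t \<le> b"
  have "(\<lambda>n. norm (f n t - f n s)) \<longlonglongrightarrow> norm (g t - g s)"
    using st by (intro tendsto_intros assms) auto
  moreover have "(\<lambda>n. H n * (t - s) powr \<gamma>) \<longlonglongrightarrow> K * (t - s) powr \<gamma>"
    by (intro tendsto_intros assms)
  ultimately show "norm (g t - g s) \<le> K * (t - s) powr \<gamma>"
    using holderD[OF assms(1) st] by (intro LIMSEQ_le) auto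
qed

text \<open>Absorbs the unknown constant of \<open>y\<close> into the left side by iteration: 2 A +
  B / 2^n improves to 2 A + B / 2^(n+1). Some finite \<open>B\<close> must be known
  beforehand.\<close>

lemma holder_absorb:
  assumes B: "holder \<gamma> B a b y" "0 \<le> B" and A: "0 \<le> A"
    and improve: "\<And>B. 0 \<le> B \<Longrightarrow> holder \<gamma> B a b y \<Longrightarrow> holder \<gamma> (A + B / 2) a b y"
  shows "holder \<gamma> (2 * A) a b y"
proof -
  have "holder \<gamma> (2 * A + B * (1 / 2) ^ n) a b y" for n
  proof (induction n)
    case 0
    show ?case using holder_weaken[OF B(1)] A by simp
  next
    case (Suc n)
    have "0 \<le> 2 * A + B * (1 / 2) ^ n" using A B(2) by simp
    from improve[OF this Suc] show ?case by (simp add: add_divide_distrib)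
  qed
  moreover have "(\<lambda>n. 2 * A + B * (1 / 2) ^ n) \<longlonglongrightarrow> 2 * A + B * 0"
    by (intro tendsto_intros LIMSEQ_power_zero) auto
  ultimately show ?thesis
    using holder_limit[of \<gamma> "\<lambda>n. 2 * A + B * (1 / 2) ^ n" a b "\<lambda>_. y" "2 * A" y] by simp
qed

text \<open>Induction along a real interval through the supremum of the times with \<open>P\<close>.
  \<open>P\<close> need not be inherited by earlier times, so \<open>closed\<close> may only rely on
  times arbitrarily close to \<open>s\<close> from the left, possibly \<open>s\<close>
  itself.\<close>

lemma interval_continuation:
  fixes a b :: real
  assumes ab: "a \<le> b" and a: "P a"
    and step: "\<And>s. a \<le> s \<Longrightarrow> s < b \<Longrightarrow> P s \<Longrightarrow> \<exists>h>0. s + h \<le> b \<and> P (s + h)"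
    and closed: "\<And>s. a \<le> s \<Longrightarrow> s \<le> b \<Longrightarrow> (\<And>e. 0 < e \<Longrightarrow> \<exists>t. a \<le> t \<and> t \<le> s \<and> s - e < t \<and> P t) \<Longrightarrow> P s"
  shows "P b"
proof -
  define S where "S = {s. a \<le> s \<and> s \<le> b \<and> P s}"
  have S: "a \<in> S" "bdd_above S" using ab a by (auto simp: S_def intro!: bdd_aboveI[of _ b])
  define \<sigma> where "\<sigma> = Sup S"
  have \<sigma>: "a \<le> \<sigma>" "\<sigma> \<le> b"
    unfolding \<sigma>_def using S by (auto intro: cSup_upper cSup_least simp: S_def)
  have "P \<sigma>"
  proof (rule closed[OF \<sigma>])
    fix e :: real assume "0 < e"
    then obtain t where "t \<in> S" "\<sigma> - e < t"
      using less_cSup_iff[of S "\<sigma> - e"] S by (auto simp: \<sigma>_def)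
    moreover have "t \<le> \<sigma>" unfolding \<sigma>_def using \<open>t \<in> S\<close> S by (intro cSup_upper)
    ultimately show "\<exists>t. a \<le> t \<and> t \<le> \<sigma> \<and> \<sigma> - e < t \<and> P t" by (auto simp: S_def)
  qed
  have "\<sigma> = b"
  proof (rule ccontr)
    assume "\<sigma> \<noteq> b"
    with \<sigma> step[OF \<sigma>(1) _ \<open>P \<sigma>\<close>] obtain h where h: "0 < h" "\<sigma> + h \<le> b" "P (\<sigma> + h)" by auto
    then have "\<sigma> + h \<in> S" using \<sigma> by (simp add: S_def)
    then have "\<sigma> + h \<le> \<sigma>" unfolding \<sigma>_def using S by (intro cSup_upper)
    with h show False by simp
  qed
  with \<open>P \<sigma>\<close> show ?thesis by simp
qed

definition control_integral ::
    "(real \<Rightarrow> real ^ 'd) \<Rightarrow> (real \<Rightarrow> (real ^ 'd) \<Rightarrow>\<^sub>L (real ^ 'm::finite)) \<Rightarrow> real \<Rightarrow> real \<Rightarrow> real ^ 'm" where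
  "control_integral x f a t = (\<Sum>j\<in>UNIV. rs_integral (\<lambda>s. blinfun_apply (f s) (axis j 1)) (\<lambda>s. x s $ j) a t)"

context
  fixes x :: "real \<Rightarrow> real ^ 'd" and L :: real
  assumes L: "0 \<le> L"
begin

lemma column_integral_exists:
  fixes f :: "real \<Rightarrow> (real ^ 'd) \<Rightarrow>\<^sub>L (real ^ 'm::finite)"
  assumes x: "holder 1 L a b x" and f: "continuous_on {a..b} f"
  obtains I where "\<And>u v. a \<le> u \<Longrightarrow> u \<le> v \<Longrightarrow> v \<le> b \<Longrightarrow>
    has_rs_integral (\<lambda>s. blinfun_apply (f s) (axis j 1)) (\<lambda>s. x s $ j) u v (I v - I u)"
proof (rule continuous_lipschitz_integral_exists[OF _ holder_component[OF x, of j] L])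
  show "continuous_on {a..b} (\<lambda>s. blinfun_apply (f s) (axis j 1))"
    by (intro continuous_intros f)
qed (use that in blast)

lemma has_rs_integral_column:
  fixes f :: "real \<Rightarrow> (real ^ 'd) \<Rightarrow>\<^sub>L (real ^ 'm::finite)"
  assumes x: "holder 1 L a b x" and f: "continuous_on {a..b} f" and uv: "a \<le> u" "u \<le> v" "v \<le> b"
  shows "has_rs_integral (\<lambda>s. blinfun_apply (f s) (axis j 1)) (\<lambda>s. x s $ j) u v
    (rs_integral (\<lambda>s. blinfun_apply (f s) (axis j 1)) (\<lambda>s. x s $ j) u v)"
proof -
  obtain I where "has_rs_integral (\<lambda>s. blinfun_apply (f s) (axis j 1)) (\<lambda>s. x s $ j) u v (I v - I u)"
    using column_integral_exists[OF x f] uv by metis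
  with rs_integral_eq[OF this] show ?thesis by simp
qed

lemma control_integral_additive:
  fixes f :: "real \<Rightarrow> (real ^ 'd) \<Rightarrow>\<^sub>L (real ^ 'm::finite)"
  assumes x: "holder 1 L a b x" and f: "continuous_on {a..b} f" and uv: "a \<le> u" "u \<le> v" "v \<le> b"
  shows "control_integral x f a v = control_integral x f a u + control_integral x f u v"
  unfolding control_integral_def sum.distrib[symmetric]
proof (rule sum.cong[OF refl])
  fix j
  obtain I where I: "\<And>u v. a \<le> u \<Longrightarrow> u \<le> v \<Longrightarrow> v \<le> b \<Longrightarrow>
      has_rs_integral (\<lambda>s. blinfun_apply (f s) (axis j 1)) (\<lambda>s. x s $ j) u v (I v - I u)"
    using column_integral_exists[OF x f] by metis
  have "rs_integral (\<lambda>s. blinfun_apply (f s) (axis j 1)) (\<lambda>s. x s $ j) u v = I v - I u"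
    if "a \<le> u" "u \<le> v" "v \<le> b" for u v using rs_integral_eq[OF I[OF that]] .
  then show "rs_integral (\<lambda>s. blinfun_apply (f s) (axis j 1)) (\<lambda>s. x s $ j) a v
      = rs_integral (\<lambda>s. blinfun_apply (f s) (axis j 1)) (\<lambda>s. x s $ j) a u
        + rs_integral (\<lambda>s. blinfun_apply (f s) (axis j 1)) (\<lambda>s. x s $ j) u v"
    using uv by simp
qed

lemma control_integral_diff_bound:
  fixes f g :: "real \<Rightarrow> (real ^ 'd) \<Rightarrow>\<^sub>L (real ^ 'm::finite)"
  assumes x: "holder 1 L u v x" and f: "continuous_on {u..v} f" and g: "continuous_on {u..v} g"
    and uv: "u \<le> v" and B: "\<And>s. u \<le> s \<Longrightarrow> s \<le> v \<Longrightarrow> norm (f s - g s) \<le> B"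
  shows "norm (control_integral x f u v - control_integral x g u v) \<le> real CARD('d) * L * B * (v - u)"
proof -
  let ?I = "\<lambda>f j. rs_integral (\<lambda>s. blinfun_apply (f s) (axis j 1)) (\<lambda>s. x s $ j) u v"
  have B0: "0 \<le> B" using order_trans[OF norm_ge_zero B[OF order_refl uv]] .
  have "norm (?I f j - ?I g j) \<le> B * L * (v - u)" for j
  proof (rule has_rs_integral_lipschitz_bound[OF _ uv holder_component[OF x] B0])
    show "has_rs_integral (\<lambda>s. blinfun_apply (f s) (axis j 1) - blinfun_apply (g s) (axis j 1))
        (\<lambda>s. x s $ j) u v (?I f j - ?I g j)"
      using uv by (intro has_rs_integral_diff has_rs_integral_column[OF x f] has_rs_integral_column[OF x g]) auto
    show "norm (blinfun_apply (f s) (axis j 1) - blinfun_apply (g s) (axis j 1)) \<le> B" if "u \<le> s" "s \<le> v" for s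
      using order_trans[OF norm_blinfun[of "f s - g s" "axis j 1"]] B[OF that]
      by (simp add: blinfun.diff_left norm_axis_1)
  qed
  then have "norm (\<Sum>j\<in>UNIV. ?I f j - ?I g j) \<le> (\<Sum>j\<in>(UNIV :: 'd set). B * L * (v - u))"
    by (rule sum_norm_le)
  then show ?thesis by (simp add: control_integral_def sum_subtractf mult_ac)
qed

lemma control_integral_zero: "control_integral x (\<lambda>_. 0) u v = (0 :: real ^ 'm::finite)"
proof -
  have "has_rs_integral (\<lambda>s. 0 :: real ^ 'm) g u v 0" for g :: "real \<Rightarrow> real"
    unfolding has_rs_integral_def by (auto intro: exI[of _ 1])
  from rs_integral_eq[OF this] show ?thesis by (simp add: control_integral_def)
qed

lemma control_integral_bound:
  fixes f :: "real \<Rightarrow> (real ^ 'd) \<Rightarrow>\<^sub>L (real ^ 'm::finite)"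
  assumes x: "holder 1 L u v x" and f: "continuous_on {u..v} f" and uv: "u \<le> v"
    and B: "\<And>s. u \<le> s \<Longrightarrow> s \<le> v \<Longrightarrow> norm (f s) \<le> B"
  shows "norm (control_integral x f u v) \<le> real CARD('d) * L * B * (v - u)"
  using control_integral_diff_bound[OF x f _ uv, of "\<lambda>_. 0" B] B
  by (simp add: control_integral_zero)

end

lemma control_integral_cong:
  assumes "\<And>s. u \<le> s \<Longrightarrow> s \<le> v \<Longrightarrow> f s = g s"
  shows "control_integral x f u v = control_integral x g u v"
proof -
  have "has_rs_integral (\<lambda>s. blinfun_apply (f s) c) h u v = has_rs_integral (\<lambda>s. blinfun_apply (g s) c) h u v" for h c
    using assms by (intro ext has_rs_integral_cong) simp
  then show ?thesis by (simp add: control_integral_def rs_integral_def)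
qed

section \<open>Functional equations driven by a Lipschitz control\<close>

text \<open>The reference path is \<open>y\<close> frozen at \<open>s\<close>, and one pair
  \<open>\<rho>\<close>, \<open>K\<close> serves all times from \<open>s\<close> to
  \<open>T\<close>. Only increments are compared; values at 0 are left free, in accord with the
  translation invariance of signatures.\<close>

definition lipschitz_near ::
    "(real \<Rightarrow> (real \<Rightarrow> 'a::real_normed_vector) \<Rightarrow> 'b::real_normed_vector) \<Rightarrow> real \<Rightarrow> real \<Rightarrow> real \<Rightarrow>
      (real \<Rightarrow> 'a) \<Rightarrow> real \<Rightarrow> real \<Rightarrow> bool" where
  "lipschitz_near \<psi> \<beta> T s y \<rho> K \<longleftrightarrow>
    (\<forall>t z z' e. s \<le> t \<longrightarrow> t \<le> T \<longrightarrow> holder \<beta> \<rho> 0 t (\<lambda>r. z r - y (min r s)) \<longrightarrow>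
      holder \<beta> \<rho> 0 t (\<lambda>r. z' r - y (min r s)) \<longrightarrow> 0 \<le> e \<longrightarrow> holder \<beta> e 0 t (\<lambda>r. z r - z' r) \<longrightarrow>
      norm (\<psi> t z - \<psi> t z') \<le> K * e)"

lemma lipschitz_nearD:
  assumes "lipschitz_near \<psi> \<beta> T s y \<rho> K" and "s \<le> t" "t \<le> T"
    and "holder \<beta> \<rho> 0 t (\<lambda>r. z r - y (min r s))" "holder \<beta> \<rho> 0 t (\<lambda>r. z' r - y (min r s))"
    and "0 \<le> e" "holder \<beta> e 0 t (\<lambda>r. z r - z' r)"
  shows "norm (\<psi> t z - \<psi> t z') \<le> K * e"
  using assms unfolding lipschitz_near_def by blast

text \<open>The properties of F(S(y)) that existence and uniqueness rest on. \<open>stopped\<close>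
  makes values at different times comparable, by turning them into values of different paths at a
  common time.\<close>

locale path_functional =
  fixes \<psi> :: "real \<Rightarrow> (real \<Rightarrow> real ^ 'm::finite) \<Rightarrow> (real ^ 'd) \<Rightarrow>\<^sub>L (real ^ 'm)" and \<beta> T C :: real
  assumes \<beta>: "0 < \<beta>" "\<beta> < 1" and C: "0 \<le> C"
    and stopped: "\<And>H s t y. holder \<beta> H 0 s y \<Longrightarrow> 0 \<le> H \<Longrightarrow> 0 \<le> s \<Longrightarrow> s \<le> t \<Longrightarrow> t \<le> T \<Longrightarrow>
      \<psi> t (\<lambda>r. y (min r s)) = \<psi> s y"
    and cong: "\<And>H t y z. holder \<beta> H 0 t y \<Longrightarrow> 0 \<le> H \<Longrightarrow> 0 \<le> t \<Longrightarrow> t \<le> T \<Longrightarrow>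
      (\<And>s. 0 \<le> s \<Longrightarrow> s \<le> t \<Longrightarrow> z s = y s) \<Longrightarrow> \<psi> t z = \<psi> t y"
    and local_lipschitz: "\<And>H s y. holder \<beta> H 0 s y \<Longrightarrow> 0 \<le> H \<Longrightarrow> 0 \<le> s \<Longrightarrow> s \<le> T \<Longrightarrow>
      \<exists>\<rho>>0. \<exists>K\<ge>0. lipschitz_near \<psi> \<beta> T s y \<rho> K"
    and growth: "\<And>H t y. holder \<beta> H 0 t y \<Longrightarrow> 0 \<le> H \<Longrightarrow> 0 \<le> t \<Longrightarrow> t \<le> T \<Longrightarrow>
      norm (\<psi> t y) \<le> C * (1 + H)"
begin

text \<open>The values at two times are values, at the later one, of \<open>y\<close> and of
  \<open>y\<close> stopped at the earlier one. The \<open>\<beta>\<close>-distance of these paths is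
  R |t - s|^(\<gamma> - \<beta>), which tends to 0 because \<beta> < \<gamma>.\<close>

lemma continuous_along_path:
  assumes y: "holder \<beta> H 0 \<tau> y" "0 \<le> H" and a: "0 \<le> a" "\<tau> \<le> T"
    and R: "holder \<gamma> R a \<tau> y" "0 \<le> R" and \<gamma>: "\<beta> < \<gamma>"
  shows "continuous_on {a..\<tau>} (\<lambda>s. \<psi> s y)"
proof -
  have "((\<lambda>t. \<psi> t y) \<longlongrightarrow> \<psi> s y) (at s within {a..\<tau>})" if s: "s \<in> {a..\<tau>}" for s
  proof -
    have ys: "holder \<beta> H 0 s y" using holder_subinterval[OF y(1)] s by simp
    have s': "0 \<le> s" "s \<le> T" using s a by auto
    obtain \<rho> K where \<rho>: "0 < \<rho>" "0 \<le> K" and near: "lipschitz_near \<psi> \<beta> T s y \<rho> K"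
      using local_lipschitz[OF ys y(2) s'] by blast
    note lip = lipschitz_nearD[OF near]
    define e where "e t = R * \<bar>t - s\<bar> powr (\<gamma> - \<beta>)" for t
    have e0: "0 \<le> e t" for t using R by (simp add: e_def)
    have diff: "holder \<beta> (R * (v - u) powr (\<gamma> - \<beta>)) 0 v (\<lambda>r. y r - y (min r u))"
      if "a \<le> u" "u \<le> v" "v \<le> \<tau>" for u v
    proof (rule holder_constant_then)
      show "holder \<gamma> R u v (\<lambda>r. y r - y (min r u))"
      proof (rule holderI)
        fix p q assume "u \<le> p" "p \<le> q" "q \<le> v"
        with that holderD[OF R(1), of p q]
        show "norm (y q - y (min q u) - (y p - y (min p u))) \<le> R * (q - p) powr \<gamma>" by simp
      qed
    qed (use that \<beta> \<gamma> R in auto)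
    have bound: "norm (\<psi> t y - \<psi> s y) \<le> K * e t" if t: "t \<in> {a..\<tau>}" and small: "e t < \<rho>" for t
    proof (cases "s \<le> t")
      case True
      have "holder \<beta> (e t) 0 t (\<lambda>r. y r - y (min r s))"
        using diff[of s t] True s t by (simp add: e_def)
      then have "norm (\<psi> t y - \<psi> t (\<lambda>r. y (min r s))) \<le> K * e t"
        using small \<rho> e0 True t a by (intro lip) (auto intro: holder_const holder_weaken)
      then show ?thesis using stopped[OF ys y(2) s'(1) True] t a by simp
    next
      \<comment> \<open>For t < s the comparison takes place at time \<open>s\<close>, with the path
        stopped at \<open>t\<close>; near \<open>s\<close> this path lies in the neighbourhood of
        \<open>y\<close> itself.\<close>
      case False
      then have ts: "t \<le> s" by simp
      have D: "holder \<beta> (e t) 0 s (\<lambda>r. y r - y (min r t))"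
        using diff[of t s] ts s t by (simp add: e_def abs_minus_commute)
      have D': "holder \<beta> (e t) 0 s (\<lambda>r. y (min r t) - y r)"
        using holder_uminus[OF D] by simp
      have "holder \<beta> \<rho> 0 s (\<lambda>r. y (min r t) - y (min r s))"
        using holder_weaken[OF D', of \<rho>] small
          holder_cong[of 0 s "\<lambda>r. y (min r t) - y (min r s)" "\<lambda>r. y (min r t) - y r"] by simp
      moreover have "holder \<beta> \<rho> 0 s (\<lambda>r. y r - y (min r s))"
        using holder_const[of \<rho> \<beta> 0 s "0 :: real ^ 'm"] \<rho>
          holder_cong[of 0 s "\<lambda>r. y r - y (min r s)" "\<lambda>_. 0"] by simp
      ultimately have "norm (\<psi> s (\<lambda>r. y (min r t)) - \<psi> s y) \<le> K * e t"
        using s' D' e0 by (intro lip) auto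
      moreover have "\<psi> s (\<lambda>r. y (min r t)) = \<psi> t y"
        using holder_subinterval[OF y(1) order_refl, of t] y(2) t a ts s'
        by (intro stopped) auto
      ultimately show ?thesis by simp
    qed
    have "(e \<longlongrightarrow> R * \<bar>s - s\<bar> powr (\<gamma> - \<beta>)) (at s within {a..\<tau>})"
      unfolding e_def using \<gamma> by (intro tendsto_intros tendsto_powr') auto
    then have e_lim: "(e \<longlongrightarrow> 0) (at s within {a..\<tau>})" using \<gamma> by simp
    have "\<forall>\<^sub>F t in at s within {a..\<tau>}. t \<in> {a..\<tau>}"
      by (auto simp: eventually_at_topological intro!: exI[of _ UNIV])
    with order_tendstoD(2)[OF e_lim \<rho>(1)]
    have "\<forall>\<^sub>F t in at s within {a..\<tau>}. norm (\<psi> t y - \<psi> s y) \<le> K * e t"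
      by eventually_elim (rule bound)
    then have "((\<lambda>t. \<psi> t y - \<psi> s y) \<longlongrightarrow> 0) (at s within {a..\<tau>})"
      by (rule Lim_null_comparison[OF _ tendsto_mult_right_zero[OF e_lim]])
    then show ?thesis by (simp add: LIM_zero_iff)
  qed
  then show ?thesis by (auto simp: continuous_on_def)
qed

text \<open>On a short interval after \<open>\<tau>\<close> a Lipschitz perturbation of a path is small in the
  \<open>\<beta>\<close>-Hoelder norm by the factor \<open>h\<^bsup>1-\<beta>\<^esup>\<close>; this gives a contraction for the Lipschitz seminorm.\<close>

lemma local_contraction:
  assumes y: "holder \<beta> H 0 \<tau> y" "0 \<le> H" and \<tau>: "0 \<le> \<tau>" "\<tau> < T" and R: "0 \<le> R" and \<Lambda>: "0 \<le> \<Lambda>"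
  obtains h \<kappa> where "0 < h" "\<tau> + h \<le> T" "0 \<le> \<kappa>" "\<Lambda> * \<kappa> \<le> 1 / 2"
    "\<And>t z z' D. \<tau> \<le> t \<Longrightarrow> t \<le> \<tau> + h \<Longrightarrow> (\<And>s. 0 \<le> s \<Longrightarrow> s \<le> \<tau> \<Longrightarrow> z s = y s) \<Longrightarrow>
       (\<And>s. 0 \<le> s \<Longrightarrow> s \<le> \<tau> \<Longrightarrow> z' s = y s) \<Longrightarrow> holder 1 R \<tau> t z \<Longrightarrow> holder 1 R \<tau> t z' \<Longrightarrow> 0 \<le> D \<Longrightarrow>
       holder 1 D \<tau> t (\<lambda>r. z r - z' r) \<Longrightarrow> norm (\<psi> t z - \<psi> t z') \<le> \<kappa> * D"
    "\<And>t z. \<tau> \<le> t \<Longrightarrow> t \<le> \<tau> + h \<Longrightarrow> (\<And>s. 0 \<le> s \<Longrightarrow> s \<le> \<tau> \<Longrightarrow> z s = y s) \<Longrightarrow> holder 1 R \<tau> t z \<Longrightarrow>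
       norm (\<psi> t z) \<le> norm (\<psi> \<tau> y) + 1"
proof -
  obtain \<rho> K where \<rho>: "0 < \<rho>" "0 \<le> K" and lip_near: "lipschitz_near \<psi> \<beta> T \<tau> y \<rho> K"
    using local_lipschitz[OF y \<tau>(1) less_imp_le[OF \<tau>(2)]] by blast
  note lip = lipschitz_nearD[OF lip_near]
  \<comment> \<open>Each summand secures one requirement: R \<eta> \<le> \<rho> keeps the paths in
    the neighbourhood, K R \<eta> \<le> 1 bounds the change of the coefficient, \<Lambda> K \<eta>
    \<le> 1 / 2 gives the contraction. The length \<open>h\<close> is such that \<eta> = h^(1 -
    \<beta>) \<le> 1 / M.\<close>
  define M where "M = R / \<rho> + K * R + 2 * \<Lambda> * K + 1"
  have M: "0 < M" "R / \<rho> \<le> M" "K * R \<le> M" "2 * \<Lambda> * K \<le> M"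
    using R \<rho> \<Lambda> by (auto simp: M_def add_nonneg_pos)
  define h where "h = min (T - \<tau>) ((1 / M) powr (1 / (1 - \<beta>)))"
  define \<eta> where "\<eta> = h powr (1 - \<beta>)"
  have h: "0 < h" "\<tau> + h \<le> T" using \<tau> M by (auto simp: h_def)
  have "\<eta> \<le> ((1 / M) powr (1 / (1 - \<beta>))) powr (1 - \<beta>)"
    unfolding \<eta>_def using h(1) \<beta> by (intro powr_mono2) (auto simp: h_def)
  also have "\<dots> = 1 / M" using \<beta> M by (simp add: powr_powr)
  finally have \<eta>: "0 \<le> \<eta>" "\<eta> \<le> 1 / M" by (simp_all add: \<eta>_def)
  have le: "c * \<eta> \<le> d" if "c \<le> d * M" "0 \<le> c" for c d
  proof -
    have "c * \<eta> \<le> c * (1 / M)" using that \<eta> by (intro mult_left_mono) auto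
    also have "\<dots> \<le> d" using that M by (simp add: pos_divide_le_eq)
    finally show ?thesis .
  qed
  have R\<eta>: "R * \<eta> \<le> \<rho>" using M \<rho> R by (intro le) (auto simp: pos_divide_le_eq mult.commute)
  have KR\<eta>: "K * R * \<eta> \<le> 1" using M \<rho> R by (intro le) auto
  have \<Lambda>K\<eta>: "\<Lambda> * K * \<eta> \<le> 1 / 2" using M \<rho> \<Lambda> by (intro le) auto
  have small: "holder \<beta> (D * \<eta>) 0 t f"
    if "\<tau> \<le> t" "t \<le> \<tau> + h" "\<And>s. 0 \<le> s \<Longrightarrow> s \<le> \<tau> \<Longrightarrow> f s = 0" "holder 1 D \<tau> t f" "0 \<le> D"
    for t D and f :: "real \<Rightarrow> real ^ 'm"
  proof (rule holder_weaken)
    show "holder \<beta> (D * (t - \<tau>) powr (1 - \<beta>)) 0 t f"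
      using that \<beta> \<tau> by (intro holder_constant_then) auto
    show "D * (t - \<tau>) powr (1 - \<beta>) \<le> D * \<eta>"
      unfolding \<eta>_def using that \<beta> by (intro mult_left_mono powr_mono2) auto
  qed
  have near: "holder \<beta> (R * \<eta>) 0 t (\<lambda>r. z r - y (min r \<tau>))"
    if "\<tau> \<le> t" "t \<le> \<tau> + h" "\<And>s. 0 \<le> s \<Longrightarrow> s \<le> \<tau> \<Longrightarrow> z s = y s" "holder 1 R \<tau> t z" for t z
  proof (rule small[OF that(1,2)])
    have "holder 1 R \<tau> t (\<lambda>r. z r - y \<tau>)"
      using holder_diff[OF that(4) holder_const[of 0 1 \<tau> t "y \<tau>"]] by simp
    then show "holder 1 R \<tau> t (\<lambda>r. z r - y (min r \<tau>))"
      by (subst holder_cong[of _ _ _ "\<lambda>r. z r - y \<tau>"]) (auto simp: min_def)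
  qed (use that R in auto)
  show thesis
  proof (rule that[of h "K * \<eta>"])
    fix t z z' D
    assume t: "\<tau> \<le> t" "t \<le> \<tau> + h" and z: "\<And>s. 0 \<le> s \<Longrightarrow> s \<le> \<tau> \<Longrightarrow> z s = y s"
      and z': "\<And>s. 0 \<le> s \<Longrightarrow> s \<le> \<tau> \<Longrightarrow> z' s = y s"
      and R: "holder 1 R \<tau> t z" "holder 1 R \<tau> t z'" and D: "0 \<le> D" "holder 1 D \<tau> t (\<lambda>r. z r - z' r)"
    have "norm (\<psi> t z - \<psi> t z') \<le> K * (D * \<eta>)"
    proof (rule lip)
      show "holder \<beta> (D * \<eta>) 0 t (\<lambda>r. z r - z' r)" using t D z z' by (intro small) auto
      show "holder \<beta> \<rho> 0 t (\<lambda>r. z r - y (min r \<tau>))" by (rule holder_weaken[OF near[OF t z R(1)] R\<eta>])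
      show "holder \<beta> \<rho> 0 t (\<lambda>r. z' r - y (min r \<tau>))" by (rule holder_weaken[OF near[OF t z' R(2)] R\<eta>])
    qed (use t h D \<eta> in auto)
    then show "norm (\<psi> t z - \<psi> t z') \<le> K * \<eta> * D" by (simp add: mult_ac)
  next
    fix t z
    assume t: "\<tau> \<le> t" "t \<le> \<tau> + h" and z: "\<And>s. 0 \<le> s \<Longrightarrow> s \<le> \<tau> \<Longrightarrow> z s = y s" and Rz: "holder 1 R \<tau> t z"
    have "norm (\<psi> t z - \<psi> t (\<lambda>r. y (min r \<tau>))) \<le> K * (R * \<eta>)"
    proof (rule lip)
      show "holder \<beta> \<rho> 0 t (\<lambda>r. z r - y (min r \<tau>))" by (rule holder_weaken[OF near[OF t z Rz] R\<eta>])
      show "holder \<beta> (R * \<eta>) 0 t (\<lambda>r. z r - y (min r \<tau>))" by (rule near[OF t z Rz])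
    qed (use t h R \<eta> \<rho> in \<open>auto intro: holder_const\<close>)
    moreover have "\<psi> t (\<lambda>r. y (min r \<tau>)) = \<psi> \<tau> y"
      using t h by (intro stopped[OF y \<tau>(1)]) auto
    ultimately show "norm (\<psi> t z) \<le> norm (\<psi> \<tau> y) + 1"
      using KR\<eta> norm_triangle_sub[of "\<psi> t z" "\<psi> \<tau> y"] by (simp add: mult.assoc)
  qed (use h \<rho> \<eta> \<Lambda>K\<eta> in \<open>auto simp: mult.assoc\<close>)
qed

end

locale functional_cde = path_functional \<psi> \<beta> T C
  for \<psi> :: "real \<Rightarrow> (real \<Rightarrow> real ^ 'm::finite) \<Rightarrow> (real ^ 'd) \<Rightarrow>\<^sub>L (real ^ 'm)" and \<beta> T C :: real +
  fixes x :: "real \<Rightarrow> real ^ 'd" and w :: "real \<Rightarrow> real ^ 'm" and L T0 W :: real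
  assumes L: "0 \<le> L" "holder 1 L 0 T x" and T0: "0 \<le> T0" "T0 < T" and w: "0 \<le> W" "holder \<beta> W 0 T0 w"
begin

definition \<Lambda> :: real where "\<Lambda> = real CARD('d) * L"

lemma \<Lambda>_nonneg: "0 \<le> \<Lambda>" using L by (simp add: \<Lambda>_def)

definition drift :: "(real \<Rightarrow> real ^ 'm) \<Rightarrow> real \<Rightarrow> real \<Rightarrow> real ^ 'm" where
  "drift y s t = control_integral x (\<lambda>r. \<psi> r y) s t"

text \<open>The Lipschitz property after \<open>T0\<close> is built in because the contraction works
  in that seminorm; \<open>solI\<close> recovers it for solutions known only to be Hoelder.\<close>

definition sol :: "real \<Rightarrow> (real \<Rightarrow> real ^ 'm) \<Rightarrow> bool" where
  "sol \<tau> y \<longleftrightarrow> (\<forall>t. 0 \<le> t \<longrightarrow> t \<le> T0 \<longrightarrow> y t = w t) \<and> (\<exists>R\<ge>0. holder 1 R T0 \<tau> y) \<and>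
     (\<forall>t. T0 \<le> t \<longrightarrow> t \<le> \<tau> \<longrightarrow> y t = w T0 + drift y T0 t)"

lemma holder_extend:
  assumes y: "\<And>t. 0 \<le> t \<Longrightarrow> t \<le> T0 \<Longrightarrow> y t = w t" and R: "0 \<le> R" "holder 1 R T0 \<tau> y" and \<tau>: "T0 \<le> \<tau>" "\<tau> \<le> T"
  shows "\<exists>H\<ge>0. holder \<beta> H 0 \<tau> y"
proof -
  have "holder \<beta> W 0 T0 y" using holder_cong[of 0 T0 y w] y w by simp
  then have "holder \<beta> (W + R * (\<tau> - T0) powr (1 - \<beta>)) 0 \<tau> y"
    using \<beta> R \<tau> w by (intro holder_join[OF _ holder_exponent[OF R(2)]]) auto
  moreover have "0 \<le> W + R * (\<tau> - T0) powr (1 - \<beta>)" using w R by simp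
  ultimately show ?thesis by blast
qed

lemma x_holder: "0 \<le> s \<Longrightarrow> t \<le> T \<Longrightarrow> holder 1 L s t x"
  using holder_subinterval[OF L(2)] .

lemma drift_increment_diff:
  assumes st: "0 \<le> s" "s \<le> t" "t \<le> T" and c: "continuous_on {s..t} (\<lambda>r. \<psi> r y)" "continuous_on {s..t} (\<lambda>r. \<psi> r z)"
    and B: "\<And>r. s \<le> r \<Longrightarrow> r \<le> t \<Longrightarrow> norm (\<psi> r y - \<psi> r z) \<le> B"
  shows "norm (drift y s t - drift z s t) \<le> \<Lambda> * B * (t - s)"
  using control_integral_diff_bound[OF L(1) x_holder[OF st(1,3)] c st(2) B] by (simp add: drift_def \<Lambda>_def)

lemma drift_bound:
  assumes st: "0 \<le> s" "s \<le> t" "t \<le> T" and c: "continuous_on {s..t} (\<lambda>r. \<psi> r y)"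
    and B: "\<And>r. s \<le> r \<Longrightarrow> r \<le> t \<Longrightarrow> norm (\<psi> r y) \<le> B"
  shows "norm (drift y s t) \<le> \<Lambda> * B * (t - s)"
  using control_integral_bound[OF L(1) x_holder[OF st(1,3)] c st(2) B] by (simp add: drift_def \<Lambda>_def)

lemma drift_additive:
  assumes "0 \<le> s" "s \<le> t" "t \<le> u" "u \<le> T" and c: "continuous_on {s..u} (\<lambda>r. \<psi> r y)"
  shows "drift y s u = drift y s t + drift y t u"
  using control_integral_additive[OF L(1) x_holder c assms(2,3) order_refl] assms by (simp add: drift_def)

lemma drift_cong:
  assumes y: "holder \<beta> H 0 t y" "0 \<le> H" and st: "0 \<le> s" "s \<le> t" "t \<le> T"
    and yz: "\<And>r. 0 \<le> r \<Longrightarrow> r \<le> t \<Longrightarrow> z r = y r"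
  shows "drift z s t = drift y s t"
  unfolding drift_def
proof (rule control_integral_cong)
  fix r assume "s \<le> r" "r \<le> t"
  then show "\<psi> r z = \<psi> r y"
    using st yz y by (intro cong[OF holder_subinterval[OF y(1) order_refl]]) auto
qed

lemma drift_self: "0 \<le> s \<Longrightarrow> s \<le> T \<Longrightarrow> drift y s s = 0"
  using drift_bound[of s s y "norm (\<psi> s y)"] by (force simp: order_antisym_conv)

lemma continuous_lipschitz_path:
  assumes "\<And>t. 0 \<le> t \<Longrightarrow> t \<le> T0 \<Longrightarrow> y t = w t" "0 \<le> R" "holder 1 R T0 \<tau> y" "T0 \<le> \<tau>" "\<tau> \<le> T"
  shows "continuous_on {T0..\<tau>} (\<lambda>s. \<psi> s y)"
proof -
  obtain H where "0 \<le> H" "holder \<beta> H 0 \<tau> y" using holder_extend[OF assms] by blast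
  then show ?thesis using assms T0 \<beta> by (intro continuous_along_path[OF _ _ _ _ assms(3,2)]) auto
qed

lemma solD:
  assumes "sol \<tau> y" and \<tau>: "T0 \<le> \<tau>" "\<tau> \<le> T"
  shows "0 \<le> t \<Longrightarrow> t \<le> T0 \<Longrightarrow> y t = w t"
    and "\<exists>R\<ge>0. holder 1 R T0 \<tau> y" and "\<exists>H\<ge>0. holder \<beta> H 0 \<tau> y"
    and "continuous_on {T0..\<tau>} (\<lambda>s. \<psi> s y)"
    and "T0 \<le> t \<Longrightarrow> t \<le> \<tau> \<Longrightarrow> y t = w T0 + drift y T0 t"
proof -
  from assms obtain R where y: "\<And>t. 0 \<le> t \<Longrightarrow> t \<le> T0 \<Longrightarrow> y t = w t" and R: "0 \<le> R" "holder 1 R T0 \<tau> y"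
    unfolding sol_def by blast
  show "\<exists>H\<ge>0. holder \<beta> H 0 \<tau> y" by (rule holder_extend[OF y R \<tau>])
  show "continuous_on {T0..\<tau>} (\<lambda>s. \<psi> s y)" by (rule continuous_lipschitz_path[OF y R \<tau>])
qed (use assms in \<open>auto simp: sol_def\<close>)

lemma sol_increment:
  assumes y: "sol \<tau> y" and \<tau>: "T0 \<le> \<tau>" "\<tau> \<le> T" and st: "T0 \<le> s" "s \<le> t" "t \<le> \<tau>"
  shows "y t - y s = drift y s t"
proof -
  have "drift y T0 t = drift y T0 s + drift y s t"
    using solD(4)[OF y \<tau>] st \<tau> T0 by (intro drift_additive) (auto elim: continuous_on_subset)
  then show ?thesis using solD(5)[OF y \<tau>, of s] solD(5)[OF y \<tau>, of t] st by simp
qed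

lemma sol_subinterval:
  assumes y: "sol \<tau> y" and "\<sigma> \<le> \<tau>"
  shows "sol \<sigma> y"
proof -
  obtain R where "0 \<le> R" "holder 1 R T0 \<tau> y" using y by (auto simp: sol_def)
  then have "\<exists>R\<ge>0. holder 1 R T0 \<sigma> y" using holder_subinterval[of 1 R T0 \<tau> y T0 \<sigma>] assms by blast
  then show ?thesis using assms by (auto simp: sol_def)
qed

text \<open>Agreement is continued in time. Beyond a time of agreement, each passage through the
  equation halves the Lipschitz constant of y - z on a short interval, so the difference is constant
  there.\<close>

lemma sol_unique:
  assumes y: "sol \<tau> y" and z: "sol \<tau> z" and \<tau>: "T0 \<le> \<tau>" "\<tau> \<le> T" and t: "0 \<le> t" "t \<le> \<tau>"
  shows "y t = z t"
proof -
  obtain R1 where R1: "0 \<le> R1" "holder 1 R1 T0 \<tau> y" using solD(2)[OF y \<tau>] by blast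
  obtain R2 where R2: "0 \<le> R2" "holder 1 R2 T0 \<tau> z" using solD(2)[OF z \<tau>] by blast
  define R where "R = R1 + R2"
  have R: "0 \<le> R" "holder 1 R T0 \<tau> y" "holder 1 R T0 \<tau> z" "holder 1 R T0 \<tau> (\<lambda>r. y r - z r)"
    using R1 R2 holder_weaken[OF R1(2), of R] holder_weaken[OF R2(2), of R] holder_diff[OF R1(2) R2(2)]
    by (auto simp: R_def)
  obtain H where H: "0 \<le> H" "holder \<beta> H 0 \<tau> y" using solD(3)[OF y \<tau>] by blast
  have "\<forall>t. 0 \<le> t \<longrightarrow> t \<le> \<tau> \<longrightarrow> y t = z t"
  proof (rule interval_continuation[where P = "\<lambda>s. \<forall>t. 0 \<le> t \<longrightarrow> t \<le> s \<longrightarrow> y t = z t", OF \<tau>(1)])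
    show "\<forall>t. 0 \<le> t \<longrightarrow> t \<le> T0 \<longrightarrow> y t = z t"
      using solD(1)[OF y \<tau>] solD(1)[OF z \<tau>] by simp
  next
    fix s assume s: "T0 \<le> s" "s < \<tau>" and eq: "\<forall>t. 0 \<le> t \<longrightarrow> t \<le> s \<longrightarrow> y t = z t"
    have s': "0 \<le> s" "s < T" using s T0 \<tau> by auto
    obtain h0 \<kappa> where h0: "0 < h0" "s + h0 \<le> T" and \<kappa>: "0 \<le> \<kappa>" "\<Lambda> * \<kappa> \<le> 1 / 2"
      and contr: "\<And>t z z' D. s \<le> t \<Longrightarrow> t \<le> s + h0 \<Longrightarrow> (\<And>r. 0 \<le> r \<Longrightarrow> r \<le> s \<Longrightarrow> z r = y r) \<Longrightarrow>
       (\<And>r. 0 \<le> r \<Longrightarrow> r \<le> s \<Longrightarrow> z' r = y r) \<Longrightarrow> holder 1 R s t z \<Longrightarrow> holder 1 R s t z' \<Longrightarrow> 0 \<le> D \<Longrightarrow>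
       holder 1 D s t (\<lambda>r. z r - z' r) \<Longrightarrow> norm (\<psi> t z - \<psi> t z') \<le> \<kappa> * D"
      by (rule local_contraction[OF holder_subinterval[OF H(2) order_refl less_imp_le[OF s(2)]] H(1) s' R(1) \<Lambda>_nonneg])
        (rule that[of h \<kappa>' for h \<kappa>'], assumption+, blast)
    define h where "h = min h0 (\<tau> - s)"
    have h: "0 < h" "s + h \<le> \<tau>" "h \<le> h0" using h0 s by (auto simp: h_def)
    have D: "holder 1 (R * (1 / 2) ^ n) s (s + h) (\<lambda>r. y r - z r)" for n
    proof (induction n)
      case 0
      show ?case using holder_subinterval[OF R(4) s(1) h(2)] by simp
    next
      case (Suc n)
      let ?D = "R * (1 / 2) ^ n"
      have D0: "0 \<le> ?D" using R by simp
      have bound: "norm (\<psi> r y - \<psi> r z) \<le> \<kappa> * ?D" if "s \<le> r" "r \<le> s + h" for r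
        using that h eq s D0
        by (intro contr holder_subinterval[OF Suc] holder_subinterval[OF R(2)] holder_subinterval[OF R(3)]) auto
      show ?case
      proof (rule holderI)
        fix u v assume uv: "s \<le> u" "u \<le> v" "v \<le> s + h"
        have "y v - z v - (y u - z u) = (y v - y u) - (z v - z u)" by simp
        also have "\<dots> = drift y u v - drift z u v"
          using sol_increment[OF y \<tau>, of u v] sol_increment[OF z \<tau>, of u v] uv s h by simp
        also have "norm \<dots> \<le> \<Lambda> * (\<kappa> * ?D) * (v - u)"
        proof (rule drift_increment_diff)
          show "continuous_on {u..v} (\<lambda>r. \<psi> r y)" "continuous_on {u..v} (\<lambda>r. \<psi> r z)"
            using uv s h continuous_on_subset[OF solD(4)[OF y \<tau>]] continuous_on_subset[OF solD(4)[OF z \<tau>]] by auto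
        qed (use uv s' h \<tau> bound in auto)
        also have "\<dots> = (\<Lambda> * \<kappa>) * (?D * (v - u))" by simp
        also have "\<dots> \<le> 1 / 2 * (?D * (v - u))" using \<kappa> D0 uv by (intro mult_right_mono) auto
        finally show "norm (y v - z v - (y u - z u)) \<le> R * (1 / 2) ^ Suc n * (v - u) powr 1"
          using uv by simp
      qed
    qed
    have "(\<lambda>n. R * (1 / 2) ^ n) \<longlonglongrightarrow> R * 0" by (intro tendsto_intros LIMSEQ_power_zero) simp
    with D have "holder 1 0 s (s + h) (\<lambda>r. y r - z r)"
      using holder_limit[of 1 "\<lambda>n. R * (1 / 2) ^ n" s "s + h" "\<lambda>_ r. y r - z r" 0 "\<lambda>r. y r - z r"] by simp
    then have "y t - z t = y s - z s" if "s \<le> t" "t \<le> s + h" for t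
      using holderD[of 1 0 s "s + h" "\<lambda>r. y r - z r" s t] that by simp
    then have "y t = z t" if "0 \<le> t" "t \<le> s + h" for t
      using eq that s' by (cases "t \<le> s") (auto simp: not_le dest: less_imp_le)
    with h show "\<exists>h>0. s + h \<le> \<tau> \<and> (\<forall>t. 0 \<le> t \<longrightarrow> t \<le> s + h \<longrightarrow> y t = z t)" by blast
  next
    fix s assume s: "T0 \<le> s" "s \<le> \<tau>"
      and lim: "\<And>e. 0 < e \<Longrightarrow> \<exists>t. T0 \<le> t \<and> t \<le> s \<and> s - e < t \<and> (\<forall>r. 0 \<le> r \<longrightarrow> r \<le> t \<longrightarrow> y r = z r)"
    have "y r = z r" if "0 \<le> r" "r < s" for r
      using lim[of "s - r"] that by force
    moreover have "norm (y s - z s) \<le> 0"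
    proof (rule field_le_epsilon)
      fix e :: real assume e: "0 < e"
      then obtain t where t: "T0 \<le> t" "t \<le> s" "s - e / (R + 1) < t" "y t = z t"
        using lim[of "e / (R + 1)"] R T0 by (metis add_nonneg_pos divide_pos_pos order.trans order_refl zero_less_one)
      have "norm (y s - z s) \<le> R * (s - t)"
        using holderD[OF R(4), of t s] t s by simp
      also have "\<dots> \<le> R * (e / (R + 1))" using t R by (intro mult_left_mono) auto
      also have "\<dots> \<le> 0 + e" using R e by (simp add: field_simps)
      finally show "norm (y s - z s) \<le> 0 + e" .
    qed
    \<comment> \<open>Agreement before \<open>s\<close> comes from late times of agreement,
      agreement at \<open>s\<close> from the Lipschitz continuity of the difference.\<close>
    ultimately show "\<forall>t. 0 \<le> t \<longrightarrow> t \<le> s \<longrightarrow> y t = z t" by (metis eq_iff_diff_eq_0 norm_le_zero_iff order_le_less)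
  qed
  with t show ?thesis by blast
qed

text \<open>The growth bound involves the \<open>\<beta>\<close>-seminorm of the unknown solution
  itself. On a step of length \<open>h\<close> its contribution is at most half of it and is
  absorbed; \<open>h\<close> depends only on \<Lambda>, \<open>C\<close> and \<beta>, so a fixed
  number of steps covers the interval.\<close>

lemma a_priori_bound:
  obtains R where "0 \<le> R" "\<And>\<tau> y. T0 \<le> \<tau> \<Longrightarrow> \<tau> \<le> T \<Longrightarrow> sol \<tau> y \<Longrightarrow> holder 1 R T0 \<tau> y"
proof -
  \<comment> \<open>Chosen so that \<Lambda> C h^(1 - \<beta>) = \<Lambda> C / M \<le> 1 /
    2.\<close>
  define M where "M = 2 * \<Lambda> * C + 1"
  have M: "0 < M" using \<Lambda>_nonneg C by (auto simp: M_def add_nonneg_pos)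
  define h where "h = (1 / M) powr (1 / (1 - \<beta>))"
  have h: "0 < h" using M by (simp add: h_def)
  have "h powr (1 - \<beta>) = 1 / M" using M \<beta> by (simp add: h_def powr_powr)
  then have "\<Lambda> * C * h powr (1 - \<beta>) = \<Lambda> * C / M" by simp
  then have h\<Lambda>: "\<Lambda> * C * h powr (1 - \<beta>) \<le> 1 / 2" using M by (simp add: pos_divide_le_eq) (simp add: M_def)
  have lipschitz: "holder 1 (\<Lambda> * (C * (1 + B))) s t y"
    if y: "sol \<tau> y" "T0 \<le> \<tau>" "\<tau> \<le> T" and st: "T0 \<le> s" "t \<le> \<tau>" and B: "0 \<le> B" "holder \<beta> B 0 t y" for \<tau> y s t B
  proof (rule holderI)
    fix u v assume uv: "s \<le> u" "u \<le> v" "v \<le> t"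
    have "y v - y u = drift y u v" using sol_increment[OF y] uv st by simp
    also have "norm \<dots> \<le> \<Lambda> * (C * (1 + B)) * (v - u)"
    proof (rule drift_bound)
      show "continuous_on {u..v} (\<lambda>r. \<psi> r y)"
        using uv st continuous_on_subset[OF solD(4)[OF y]] by auto
      show "norm (\<psi> r y) \<le> C * (1 + B)" if "u \<le> r" "r \<le> v" for r
        using that uv st T0 B y by (intro growth holder_subinterval[OF B(2)]) auto
    qed (use uv st T0 y in auto)
    finally show "norm (y v - y u) \<le> \<Lambda> * (C * (1 + B)) * (v - u) powr 1" using uv by simp
  qed
  have step: "holder \<beta> (2 * A + 1) 0 t y"
    if y: "sol \<tau> y" "T0 \<le> \<tau>" "\<tau> \<le> T" and st: "T0 \<le> s" "s \<le> t" "t \<le> \<tau>" "t - s \<le> h"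
      and A: "0 \<le> A" "holder \<beta> A 0 s y" for \<tau> y s t A
  proof -
    obtain H where H: "0 \<le> H" "holder \<beta> H 0 \<tau> y" using solD(3)[OF y] by blast
    have "holder \<beta> (2 * (A + 1 / 2)) 0 t y"
    proof (rule holder_absorb)
      show "holder \<beta> H 0 t y" using holder_subinterval[OF H(2)] st by simp
      fix B assume B: "0 \<le> B" "holder \<beta> B 0 t y"
      let ?l = "\<Lambda> * (C * (1 + B))"
      have l: "0 \<le> ?l" using \<Lambda>_nonneg C B by simp
      have "holder \<beta> (A + ?l * (t - s) powr (1 - \<beta>)) 0 t y"
        using lipschitz[OF y st(1,3) B] A st l \<beta> by (intro holder_join[OF A(2)] holder_exponent) auto
      moreover have "?l * (t - s) powr (1 - \<beta>) \<le> 1 / 2 + B / 2"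
      proof -
        have "?l * (t - s) powr (1 - \<beta>) \<le> ?l * h powr (1 - \<beta>)"
          using l st \<beta> by (intro mult_left_mono powr_mono2) auto
        also have "\<dots> = (\<Lambda> * C * h powr (1 - \<beta>)) * (1 + B)" by (simp add: mult_ac)
        also have "\<dots> \<le> 1 / 2 * (1 + B)" using h\<Lambda> B by (intro mult_right_mono) auto
        finally show ?thesis by (simp add: distrib_left)
      qed
      ultimately show "holder \<beta> (A + 1 / 2 + B / 2) 0 t y" by (elim holder_weaken) simp
    qed (use H A in auto)
    then show ?thesis by (simp add: distrib_left)
  qed
  \<comment> \<open>2^n (W + 1) - 1 solves the recursion A' = 2 A + 1 of \<open>step\<close>,
    started with the constant \<open>W\<close> of the history.\<close>
  have iter: "holder \<beta> (2 ^ n * (W + 1) - 1) 0 t y"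
    if y: "sol \<tau> y" "T0 \<le> \<tau>" "\<tau> \<le> T" and t: "T0 \<le> t" "t \<le> \<tau>" "t \<le> T0 + real n * h" for \<tau> y n t
    using t
  proof (induction n arbitrary: t)
    case 0
    then have "t = T0" by simp
    then show ?case using holder_cong[of 0 T0 y w] solD(1)[OF y] w by simp
  next
    case (Suc n)
    define s where "s = max T0 (t - h)"
    have s: "T0 \<le> s" "s \<le> t" "t - s \<le> h" "s \<le> \<tau>" using h Suc.prems by (auto simp: s_def)
    have "s \<le> T0 + real n * h" using h Suc.prems(3) by (auto simp: s_def algebra_simps)
    then have IH: "holder \<beta> (2 ^ n * (W + 1) - 1) 0 s y" using s by (intro Suc.IH) auto
    have "1 * 1 \<le> 2 ^ n * (W + 1)" using w by (intro mult_mono) auto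
    then have "holder \<beta> (2 * (2 ^ n * (W + 1) - 1) + 1) 0 t y"
      using Suc.prems s by (intro step[OF y _ _ _ _ _ IH]) auto
    then show ?case by (simp add: algebra_simps)
  qed
  obtain N where N: "T < real N * h" using reals_Archimedean3[OF h] by blast
  define H where "H = 2 ^ N * (W + 1) - 1"
  have "1 * 1 \<le> 2 ^ N * (W + 1)" using w by (intro mult_mono) auto
  then have H: "0 \<le> H" by (simp add: H_def)
  show thesis
  proof (rule that[of "\<Lambda> * (C * (1 + H))"])
    show "0 \<le> \<Lambda> * (C * (1 + H))" using \<Lambda>_nonneg C H by simp
    fix \<tau> y assume y: "T0 \<le> \<tau>" "\<tau> \<le> T" "sol \<tau> y"
    have "holder \<beta> H 0 \<tau> y" unfolding H_def using N y T0 by (intro iter[OF y(3,1,2)]) auto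
    with y H show "holder 1 (\<Lambda> * (C * (1 + H))) T0 \<tau> y" by (intro lipschitz[OF y(3,1,2)]) auto
  qed
qed

text \<open>Picard iteration among the continuations of \<open>y\<close> with Lipschitz constant
  \<open>R\<close>. \<open>R\<close> is fixed before the step length: it allows the coefficient to
  exceed its norm at \<open>\<tau>\<close> by 1, and the step is then so short that it exceeds it by
  no more.\<close>

lemma local_existence:
  assumes y: "sol \<tau> y" and \<tau>: "T0 \<le> \<tau>" "\<tau> < T"
  shows "\<exists>h>0. \<tau> + h \<le> T \<and> (\<exists>z. sol (\<tau> + h) z)"
proof -
  have \<tau>': "0 \<le> \<tau>" "\<tau> \<le> T" using \<tau> T0 by auto
  note y' = y \<tau>(1) \<tau>'(2)
  obtain H where H: "0 \<le> H" "holder \<beta> H 0 \<tau> y" using solD(3)[OF y'] by blast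
  obtain Ry where Ry: "0 \<le> Ry" "holder 1 Ry T0 \<tau> y" using solD(2)[OF y'] by blast
  define M where "M = norm (\<psi> \<tau> y) + 1"
  define R where "R = \<Lambda> * M"
  have R: "0 \<le> R" using \<Lambda>_nonneg by (simp add: R_def M_def)
  obtain h \<kappa> where h: "0 < h" "\<tau> + h \<le> T" and \<kappa>: "0 \<le> \<kappa>" "\<Lambda> * \<kappa> \<le> 1 / 2"
    and contr: "\<And>t z z' D. \<tau> \<le> t \<Longrightarrow> t \<le> \<tau> + h \<Longrightarrow> (\<And>r. 0 \<le> r \<Longrightarrow> r \<le> \<tau> \<Longrightarrow> z r = y r) \<Longrightarrow>
       (\<And>r. 0 \<le> r \<Longrightarrow> r \<le> \<tau> \<Longrightarrow> z' r = y r) \<Longrightarrow> holder 1 R \<tau> t z \<Longrightarrow> holder 1 R \<tau> t z' \<Longrightarrow> 0 \<le> D \<Longrightarrow>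
       holder 1 D \<tau> t (\<lambda>r. z r - z' r) \<Longrightarrow> norm (\<psi> t z - \<psi> t z') \<le> \<kappa> * D"
    and bounded: "\<And>t z. \<tau> \<le> t \<Longrightarrow> t \<le> \<tau> + h \<Longrightarrow> (\<And>r. 0 \<le> r \<Longrightarrow> r \<le> \<tau> \<Longrightarrow> z r = y r) \<Longrightarrow>
       holder 1 R \<tau> t z \<Longrightarrow> norm (\<psi> t z) \<le> norm (\<psi> \<tau> y) + 1"
    by (rule local_contraction[OF H(2,1) \<tau>'(1) \<tau>(2) R \<Lambda>_nonneg])
      (rule that[of h \<kappa>' for h \<kappa>'], assumption+, blast, blast)
  define b where "b = \<tau> + h"
  have b: "\<tau> < b" "b \<le> T" using h by (auto simp: b_def)
  define \<Gamma> where "\<Gamma> z t = (if t \<le> \<tau> then y t else y \<tau> + drift z \<tau> t)" for z t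
  \<comment> \<open>Admissible paths share their past, so the Lipschitz constant of a difference
    controls the difference itself.\<close>
  define adm where "adm z \<longleftrightarrow> (\<forall>r. r \<le> \<tau> \<longrightarrow> z r = y r) \<and> holder 1 R \<tau> b z" for z
  have adm_eq: "z r = y r" if "adm z" "r \<le> \<tau>" for z r
    using that by (simp add: adm_def)
  have adm_lip: "holder 1 R \<tau> t z" if "adm z" "t \<le> b" for z t
    using that holder_subinterval[of 1 R \<tau> b z \<tau> t] by (simp add: adm_def)
  have ext: "holder 1 (Ry + R) T0 b z" if "adm z" for z
  proof (rule holder_join)
    show "holder 1 Ry T0 \<tau> z"
      using holder_cong[of T0 \<tau> z y 1 Ry] Ry(2) adm_eq[OF that] by simp
    show "holder 1 R \<tau> b z" using adm_lip[OF that order_refl] by simp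
  qed (use Ry R in auto)
  have cont: "continuous_on {T0..b} (\<lambda>r. \<psi> r z)" if "adm z" for z
    using ext[OF that] Ry R b \<tau> adm_eq[OF that] solD(1)[OF y']
    by (intro continuous_lipschitz_path[of z "Ry + R"]) auto
  have psi: "norm (\<psi> t z) \<le> M" if "adm z" "\<tau> \<le> t" "t \<le> b" for z t
    unfolding M_def using that adm_eq[OF that(1)] adm_lip[OF that(1)] by (intro bounded) (auto simp: b_def)
  have \<Gamma>_inc: "\<Gamma> z v - \<Gamma> z u = drift z u v" if "adm z" "\<tau> \<le> u" "u \<le> v" "v \<le> b" for z u v
  proof -
    have \<Gamma>: "\<Gamma> z t = y \<tau> + drift z \<tau> t" if "\<tau> \<le> t" for t
      using that drift_self[OF \<tau>', of z] by (auto simp: \<Gamma>_def)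
    have "drift z \<tau> v = drift z \<tau> u + drift z u v"
      using that \<tau> \<tau>' b by (intro drift_additive) (auto intro: continuous_on_subset[OF cont])
    then show ?thesis using that by (simp add: \<Gamma>)
  qed
  have \<Gamma>_adm: "adm (\<Gamma> z)" if z: "adm z" for z
    unfolding adm_def
  proof (intro conjI holderI)
    show "\<forall>r. r \<le> \<tau> \<longrightarrow> \<Gamma> z r = y r" by (simp add: \<Gamma>_def)
    fix u v assume uv: "\<tau> \<le> u" "u \<le> v" "v \<le> b"
    have "norm (\<Gamma> z v - \<Gamma> z u) \<le> \<Lambda> * M * (v - u)"
      unfolding \<Gamma>_inc[OF z uv]
    proof (rule drift_bound)
      show "continuous_on {u..v} (\<lambda>r. \<psi> r z)" using uv \<tau> by (intro continuous_on_subset[OF cont[OF z]]) auto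
      show "norm (\<psi> r z) \<le> M" if "u \<le> r" "r \<le> v" for r using that uv by (intro psi z) auto
    qed (use uv \<tau>' b in auto)
    then show "norm (\<Gamma> z v - \<Gamma> z u) \<le> R * (v - u) powr 1" using uv by (simp add: R_def)
  qed
  have \<Gamma>_contr: "holder 1 (D / 2) \<tau> b (\<lambda>r. \<Gamma> z r - \<Gamma> z' r)"
    if z: "adm z" "adm z'" and D: "0 \<le> D" "holder 1 D \<tau> b (\<lambda>r. z r - z' r)" for z z' D
  proof (rule holderI)
    fix u v assume uv: "\<tau> \<le> u" "u \<le> v" "v \<le> b"
    have "norm ((\<Gamma> z v - \<Gamma> z u) - (\<Gamma> z' v - \<Gamma> z' u)) \<le> \<Lambda> * (\<kappa> * D) * (v - u)"
      unfolding \<Gamma>_inc[OF z(1) uv] \<Gamma>_inc[OF z(2) uv]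
    proof (rule drift_increment_diff)
      show "continuous_on {u..v} (\<lambda>r. \<psi> r z)" "continuous_on {u..v} (\<lambda>r. \<psi> r z')"
        using uv \<tau> by (intro continuous_on_subset[OF cont] z; auto)+
      show "norm (\<psi> r z - \<psi> r z') \<le> \<kappa> * D" if "u \<le> r" "r \<le> v" for r
        using that uv D adm_eq[OF z(1)] adm_lip[OF z(1)] adm_eq[OF z(2)] adm_lip[OF z(2)]
        by (intro contr holder_subinterval[OF D(2)]) (auto simp: b_def)
    qed (use uv \<tau>' b in auto)
    also have "\<dots> = (\<Lambda> * \<kappa>) * (D * (v - u))" by simp
    also have "\<dots> \<le> 1 / 2 * (D * (v - u))" using \<kappa> D uv by (intro mult_right_mono) auto
    finally show "norm (\<Gamma> z v - \<Gamma> z' v - (\<Gamma> z u - \<Gamma> z' u)) \<le> D / 2 * (v - u) powr 1"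
      using uv by (simp add: algebra_simps)
  qed
  \<comment> \<open>The iteration starts from the path frozen at \<open>\<tau>\<close>, which is
    admissible for every nonnegative \<open>R\<close>.\<close>
  define Z where "Z n = (\<Gamma> ^^ n) (\<lambda>r. y (min r \<tau>))" for n
  have Z_Suc: "Z (Suc n) = \<Gamma> (Z n)" for n by (simp add: Z_def)
  have Z_adm: "adm (Z n)" for n
  proof (induction n)
    case 0
    have "holder 1 R \<tau> b (\<lambda>r. y (min r \<tau>))"
      using R by (intro holderI) simp
    then show ?case by (simp add: Z_def adm_def)
  next
    case (Suc n)
    then show ?case by (simp add: Z_Suc \<Gamma>_adm)
  qed
  have Z_step: "holder 1 (2 * R * (1 / 2) ^ n) \<tau> b (\<lambda>r. Z (Suc n) r - Z n r)" for n
  proof (induction n)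
    case 0
    show ?case
      using holder_diff[OF adm_lip[OF Z_adm order_refl] adm_lip[OF Z_adm order_refl], of 1 0] by simp
  next
    case (Suc n)
    have "0 \<le> 2 * R * (1 / 2) ^ n" using R by simp
    from \<Gamma>_contr[OF Z_adm Z_adm this Suc] show ?case by (simp add: Z_Suc)
  qed
  have Z_tail: "holder 1 (4 * R * (1 / 2) ^ n) \<tau> b (\<lambda>r. Z (n + m) r - Z n r)" for n m
  proof -
    \<comment> \<open>The exact geometric partial sum of the constants in \<open>Z_step\<close>, so
      that the induction on \<open>m\<close> closes with equality.\<close>
    have "holder 1 (4 * R * (1 / 2) ^ n - 4 * R * (1 / 2) ^ (n + m)) \<tau> b (\<lambda>r. Z (n + m) r - Z n r)"
    proof (induction m)
      case 0
      show ?case by (simp add: holder_const)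
    next
      case (Suc m)
      from holder_add[OF Suc Z_step[of "n + m"]] show ?case by simp
    qed
    then show ?thesis by (rule holder_weaken) (use R in simp)
  qed
  have Z_close: "norm (Z (n + m) t - Z n t) \<le> 4 * R * h * (1 / 2) ^ n" if t: "\<tau> \<le> t" "t \<le> b" for n m t
  proof -
    have "norm (Z (n + m) t - Z n t) \<le> 4 * R * (1 / 2) ^ n * (t - \<tau>)"
      using holderD[OF Z_tail order_refl t, of n m] t adm_eq[OF Z_adm order_refl, of "n + m"]
        adm_eq[OF Z_adm order_refl, of n] by simp
    also have "\<dots> \<le> 4 * R * (1 / 2) ^ n * h" using R t by (intro mult_left_mono) (auto simp: b_def)
    finally show ?thesis by (simp add: mult_ac)
  qed
  have null: "(\<lambda>n. c * (1 / 2) ^ n) \<longlonglongrightarrow> 0" for c :: real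
    using tendsto_mult[OF tendsto_const[of c] LIMSEQ_power_zero[of "1 / 2 :: real"]] by simp
  have "\<exists>l. (\<lambda>n. Z n t) \<longlonglongrightarrow> l" if t: "\<tau> \<le> t" "t \<le> b" for t
  proof -
    have "Cauchy (\<lambda>n. Z n t)"
    proof (rule CauchyI')
      fix e :: real assume "0 < e"
      from order_tendstoD(2)[OF null this, of "4 * R * h"]
      obtain N where N: "\<And>n. N \<le> n \<Longrightarrow> 4 * R * h * (1 / 2) ^ n < e"
        by (auto simp: eventually_sequentially)
      have "dist (Z m t) (Z n t) < e" if "N \<le> m" "m < n" for m n
        using Z_close[OF t, of m "n - m"] N[OF that(1)] that by (simp add: dist_norm norm_minus_commute)
      then show "\<exists>M. \<forall>m\<ge>M. \<forall>n>m. dist (Z m t) (Z n t) < e" by blast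
    qed
    then show ?thesis by (auto simp: Cauchy_convergent_iff convergent_def)
  qed
  then obtain l where l: "\<And>t. \<tau> \<le> t \<Longrightarrow> t \<le> b \<Longrightarrow> (\<lambda>n. Z n t) \<longlonglongrightarrow> l t" by metis
  define Y where "Y t = (if t \<le> \<tau> then y t else l t)" for t
  have Y_lim: "(\<lambda>n. Z n t) \<longlonglongrightarrow> Y t" if "t \<le> b" for t
    using l[of t] that adm_eq[OF Z_adm, of t] by (auto simp: Y_def)
  have Y: "adm Y"
    unfolding adm_def
  proof
    show "\<forall>r. r \<le> \<tau> \<longrightarrow> Y r = y r" by (simp add: Y_def)
    show "holder 1 R \<tau> b Y"
      by (rule holder_limit[OF adm_lip[OF Z_adm order_refl] tendsto_const Y_lim])
  qed
  have Y_Z: "holder 1 (4 * R * (1 / 2) ^ n) \<tau> b (\<lambda>r. Y r - Z n r)" for n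
  proof (rule holder_limit[OF Z_tail tendsto_const])
    fix t assume "\<tau> \<le> t" "t \<le> b"
    then show "(\<lambda>m. Z (n + m) t - Z n t) \<longlonglongrightarrow> Y t - Z n t"
      using LIMSEQ_ignore_initial_segment[OF Y_lim, of t n] by (intro tendsto_intros) (simp add: add.commute)
  qed
  have fixpoint: "Y t = \<Gamma> Y t" if t: "\<tau> \<le> t" "t \<le> b" for t
  proof -
    \<comment> \<open>The contraction turns the distance of \<open>Y\<close> from \<open>Z n\<close>
      into one of \<Gamma> Y from \<open>Z (Suc n)\<close>, so the iterates converge to \<Gamma> Y
      as well.\<close>
    have "norm (Z (Suc n) t - \<Gamma> Y t) \<le> 2 * R * h * (1 / 2) ^ n" for n
    proof -
      have "0 \<le> 4 * R * (1 / 2) ^ n" using R by simp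
      from holderD[OF \<Gamma>_contr[OF Y Z_adm this Y_Z] order_refl t]
      have "norm (\<Gamma> Y t - Z (Suc n) t) \<le> 2 * R * (1 / 2) ^ n * (t - \<tau>)"
        using t by (simp add: Z_Suc \<Gamma>_def[of _ \<tau>])
      also have "\<dots> \<le> 2 * R * (1 / 2) ^ n * h" using R t by (intro mult_left_mono) (auto simp: b_def)
      finally show ?thesis by (simp add: mult_ac norm_minus_commute)
    qed
    then have "(\<lambda>n. Z (Suc n) t - \<Gamma> Y t) \<longlonglongrightarrow> 0"
      by (intro Lim_null_comparison[OF always_eventually null]) auto
    then have "(\<lambda>n. Z (Suc n) t) \<longlonglongrightarrow> \<Gamma> Y t" by (simp add: LIM_zero_iff)
    with LIMSEQ_Suc[OF Y_lim[OF t(2)]] show ?thesis using LIMSEQ_unique by blast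
  qed
  have "sol b Y"
    unfolding sol_def
  proof (intro conjI allI impI)
    show "Y t = w t" if "0 \<le> t" "t \<le> T0" for t
      using that solD(1)[OF y'] \<tau> by (simp add: Y_def)
    show "\<exists>R\<ge>0. holder 1 R T0 b Y" using ext[OF Y] Ry R by (intro exI[of _ "Ry + R"]) simp
    fix t assume t: "T0 \<le> t" "t \<le> b"
    have eq: "Y s = w T0 + drift Y T0 s" if "T0 \<le> s" "s \<le> \<tau>" for s
    proof -
      have "drift Y T0 s = drift y T0 s"
        using that T0 \<tau>' by (intro drift_cong[OF holder_subinterval[OF H(2) order_refl that(2)] H(1)]) (auto simp: Y_def)
      then show ?thesis using solD(5)[OF y' that] that by (simp add: Y_def)
    qed
    show "Y t = w T0 + drift Y T0 t"
    proof (cases "t \<le> \<tau>")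
      case True
      then show ?thesis using eq t by simp
    next
      case False
      then have "Y t = y \<tau> + drift Y \<tau> t" using fixpoint[of t] t by (simp add: \<Gamma>_def)
      moreover have "drift Y T0 t = drift Y T0 \<tau> + drift Y \<tau> t"
        using False t \<tau> T0 b by (intro drift_additive) (auto intro: continuous_on_subset[OF cont[OF Y]])
      ultimately show ?thesis using eq[OF \<tau>(1) order_refl] by (simp add: Y_def)
    qed
  qed
  with h show ?thesis unfolding b_def by blast
qed

text \<open>The closedness step is the critical one. Solutions on shorter intervals fit together by
  uniqueness, and the common Lipschitz constant of \<open>a_priori_bound\<close> provides a limit at
  the end point and keeps the extension Lipschitz.\<close>

lemma global_existence: "\<exists>y. sol T y"
proof (rule interval_continuation[where P = "\<lambda>s. \<exists>y. sol s y", OF less_imp_le[OF T0(2)]])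
  have "holder 1 0 T0 T0 w" by (rule holderI) (metis diff_self mult_zero_left norm_zero order_antisym order_refl order_trans)
  then show "\<exists>y. sol T0 y"
    using T0 drift_self[of T0 w] by (intro exI[of _ w]) (auto simp: sol_def)
next
  fix s assume "T0 \<le> s" "s < T" "\<exists>y. sol s y"
  then show "\<exists>h>0. s + h \<le> T \<and> (\<exists>y. sol (s + h) y)" using local_existence by blast
next
  fix s assume s: "T0 \<le> s" "s \<le> T" and lim: "\<And>e. 0 < e \<Longrightarrow> \<exists>t. T0 \<le> t \<and> t \<le> s \<and> s - e < t \<and> (\<exists>y. sol t y)"
  show "\<exists>y. sol s y"
  proof (cases "s = T0 \<or> (\<exists>y. sol s y)")
    case True
    then show ?thesis using lim[of 1] by force
  next
    case False
    then have s': "T0 < s" using s by simp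
    have "\<exists>y. sol t y" if "t < s" for t
      using lim[of "s - t"] that sol_subinterval[of _ _ t] by force
    then obtain y where y: "\<And>t. t < s \<Longrightarrow> sol t (y t)" by metis
    obtain R where R: "0 \<le> R" "\<And>\<tau> y. T0 \<le> \<tau> \<Longrightarrow> \<tau> \<le> T \<Longrightarrow> sol \<tau> y \<Longrightarrow> holder 1 R T0 \<tau> y"
      using a_priori_bound by blast
    \<comment> \<open>A diagonal choice: at time \<open>t\<close> the solution that reaches just
      \<open>t\<close>. By uniqueness any solution reaching further has the same value; the
      \<open>max\<close> serves the times in the history.\<close>
    define Y0 where "Y0 t = y (max T0 t) t" for t
    have Y0: "Y0 r = y t r" if "0 \<le> r" "r \<le> t" "T0 \<le> t" "t < s" for r t
    proof -
      have "sol (max T0 r) (y t)" using that by (intro sol_subinterval[OF y]) auto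
      with that s s' show ?thesis
        unfolding Y0_def by (intro sol_unique[OF y]) auto
    qed
    have Y0_lip: "norm (Y0 v - Y0 u) \<le> R * (v - u)" if "T0 \<le> u" "u \<le> v" "v < s" for u v
      using holderD[OF R(2)[OF _ _ y], of v u v] Y0[of u v] Y0[of v v] that s T0 by simp
    \<comment> \<open>Times increasing to \<open>s\<close>; with \<open>Suc n\<close> the first is
      \<open>T0\<close>, so all lie in [T0, s).\<close>
    define t where "t n = s - (s - T0) / real (Suc n)" for n
    have t: "T0 \<le> t n" "t n < s" for n
    proof -
      have "(s - T0) / real (Suc n) \<le> (s - T0) / 1" using s' by (intro divide_left_mono) auto
      then show "T0 \<le> t n" by (simp add: t_def)
      show "t n < s" using s' by (simp add: t_def)
    qed
    have "(\<lambda>n. s - (s - T0) / real (Suc n)) \<longlonglongrightarrow> s - 0"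
      using tendsto_mult[OF tendsto_const[of "s - T0"] LIMSEQ_inverse_real_of_nat]
      by (intro tendsto_intros) (simp add: divide_inverse)
    then have t_lim: "t \<longlonglongrightarrow> s" by (simp add: t_def[abs_def])
    have Y0_lip': "norm (Y0 v - Y0 u) \<le> R * \<bar>v - u\<bar>" if "T0 \<le> u" "T0 \<le> v" "u < s" "v < s" for u v
      using Y0_lip[of u v] Y0_lip[of v u] that by (cases "u \<le> v") (auto simp: norm_minus_commute)
    have "Cauchy (\<lambda>n. Y0 (t n))"
    proof (rule metric_CauchyI)
      fix e :: real assume "0 < e"
      then have "0 < e / (R + 1)" using R by simp
      then obtain N where N: "\<And>m n. N \<le> m \<Longrightarrow> N \<le> n \<Longrightarrow> dist (t m) (t n) < e / (R + 1)"
        using metric_CauchyD[OF LIMSEQ_imp_Cauchy[OF t_lim]] by blast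
      have "dist (Y0 (t m)) (Y0 (t n)) < e" if "N \<le> m" "N \<le> n" for m n
      proof -
        have "dist (Y0 (t m)) (Y0 (t n)) \<le> R * dist (t m) (t n)"
          using Y0_lip'[OF t(1) t(1) t(2) t(2)] by (simp add: dist_norm)
        also have "\<dots> \<le> R * (e / (R + 1))" using N[OF that] R by (intro mult_left_mono) auto
        also have "\<dots> < e" using R \<open>0 < e\<close> by (simp add: field_simps)
        finally show ?thesis .
      qed
      then show "\<exists>N. \<forall>m\<ge>N. \<forall>n\<ge>N. dist (Y0 (t m)) (Y0 (t n)) < e" by blast
    qed
    then obtain l where l: "(\<lambda>n. Y0 (t n)) \<longlonglongrightarrow> l" by (auto simp: Cauchy_convergent_iff convergent_def)
    define Y where "Y r = (if r < s then Y0 r else l)" for r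
    have Y_lt: "Y r = y u r" if "0 \<le> r" "r \<le> u" "T0 \<le> u" "u < s" for r u
      using Y0[OF that] that by (simp add: Y_def)
    have Yt_lim: "(\<lambda>n. Y (t n)) \<longlonglongrightarrow> Y s" using l t by (simp add: Y_def)
    have Y_lip: "holder 1 R T0 s Y"
    proof (rule holderI)
      fix u v assume uv: "T0 \<le> u" "u \<le> v" "v \<le> s"
      consider "v < s" | "v = s" "u < s" | "u = s" "v = s" using uv by linarith
      then show "norm (Y v - Y u) \<le> R * (v - u) powr 1"
      proof cases
        case 1
        then show ?thesis using Y0_lip[OF uv(1,2)] uv by (simp add: Y_def)
      next
        case 2
        have "norm (Y s - Y u) \<le> R * \<bar>s - u\<bar>"
        proof (rule LIMSEQ_le)
          show "(\<lambda>n. norm (Y (t n) - Y u)) \<longlonglongrightarrow> norm (Y s - Y u)" by (intro tendsto_intros Yt_lim)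
          show "(\<lambda>n. R * \<bar>t n - u\<bar>) \<longlonglongrightarrow> R * \<bar>s - u\<bar>" by (intro tendsto_intros t_lim)
          show "\<exists>N. \<forall>n\<ge>N. norm (Y (t n) - Y u) \<le> R * \<bar>t n - u\<bar>"
            using Y0_lip'[OF uv(1) t(1) 2(2) t(2)] 2 t(2) by (simp add: Y_def)
        qed
        then show ?thesis using 2 by simp
      qed simp
    qed
    have Yw: "Y r = w r" if "0 \<le> r" "r \<le> T0" for r
      using Y_lt[OF that(1,2) order_refl s'] solD(1)[OF y[OF s'] order_refl] that T0 by simp
    obtain H where H: "0 \<le> H" "holder \<beta> H 0 s Y" using holder_extend[OF Yw R(1) Y_lip s] by blast
    have cont: "continuous_on {T0..s} (\<lambda>r. \<psi> r Y)" by (rule continuous_lipschitz_path[OF Yw R(1) Y_lip s])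
    have eq: "Y u = w T0 + drift Y T0 u" if u: "T0 \<le> u" "u < s" for u
    proof -
      have "drift (y u) T0 u = drift Y T0 u"
        using u s T0 Y_lt[of _ u]
        by (intro drift_cong[OF holder_subinterval[OF H(2) order_refl less_imp_le[OF u(2)]] H(1)]) auto
      then show ?thesis using solD(5)[OF y[OF u(2)], of u] Y_lt[of u u] u s T0 by simp
    qed
    \<comment> \<open>The equation holds before \<open>s\<close>, and the drift over [t n, s]
      vanishes in the limit because the coefficient is bounded along \<open>Y\<close>.\<close>
    have "Y s = w T0 + drift Y T0 s"
    proof (rule LIMSEQ_unique[OF Yt_lim])
      have psi: "norm (\<psi> r Y) \<le> C * (1 + H)" if "0 \<le> r" "r \<le> s" for r
        using that s H by (intro growth holder_subinterval[OF H(2)]) auto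
      have "norm (Y (t n) - (w T0 + drift Y T0 s)) \<le> \<Lambda> * (C * (1 + H)) * (s - t n)" for n
      proof -
        have "drift Y T0 s = drift Y T0 (t n) + drift Y (t n) s"
          using t[of n] s T0 cont by (intro drift_additive) auto
        then have "norm (Y (t n) - (w T0 + drift Y T0 s)) = norm (drift Y (t n) s)"
          using eq[OF t[of n]] by (simp add: algebra_simps)
        also have "\<dots> \<le> \<Lambda> * (C * (1 + H)) * (s - t n)"
        proof (rule drift_bound)
          show "continuous_on {t n..s} (\<lambda>r. \<psi> r Y)" using t[of n] by (intro continuous_on_subset[OF cont]) auto
          show "norm (\<psi> r Y) \<le> C * (1 + H)" if "t n \<le> r" "r \<le> s" for r
            using that t[of n] T0 by (intro psi) auto
        qed (use t[of n] s T0 in auto)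
        finally show ?thesis .
      qed
      then have "\<forall>\<^sub>F n in sequentially. norm (Y (t n) - (w T0 + drift Y T0 s)) \<le> \<Lambda> * (C * (1 + H)) * (s - t n)"
        by (intro always_eventually allI)
      moreover have "(\<lambda>n. \<Lambda> * (C * (1 + H)) * (s - t n)) \<longlonglongrightarrow> 0"
        using tendsto_mult_right_zero[OF tendsto_diff[OF tendsto_const[of s] t_lim, unfolded diff_self]] .
      ultimately have "(\<lambda>n. Y (t n) - (w T0 + drift Y T0 s)) \<longlonglongrightarrow> 0"
        by (rule Lim_null_comparison)
      then show "(\<lambda>n. Y (t n)) \<longlonglongrightarrow> w T0 + drift Y T0 s" by (simp add: LIM_zero_iff)
    qed
    with eq have "Y u = w T0 + drift Y T0 u" if "T0 \<le> u" "u \<le> s" for u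
      using that by (cases "u = s") auto
    then have "sol s Y" unfolding sol_def using Yw Y_lip R(1) by blast
    then show ?thesis by blast
  qed
qed

end

text \<open>Bootstrap: an exponent above \<beta> makes the coefficient continuous along
  \<open>z\<close>, the growth bound makes it bounded, and the Lipschitz control then turns the
  equation into a Lipschitz bound.\<close>

lemma (in functional_cde) solI:
  assumes z: "\<And>t. 0 \<le> t \<Longrightarrow> t \<le> T0 \<Longrightarrow> z t = w t" and H: "0 \<le> H" "holder \<gamma> H 0 T z" "\<beta> < \<gamma>"
    and eq: "\<And>t. T0 \<le> t \<Longrightarrow> t \<le> T \<Longrightarrow> continuous_on {T0..T} (\<lambda>s. \<psi> s z) \<Longrightarrow> z t = w T0 + drift z T0 t"
  shows "sol T z"
proof -
  have T: "0 \<le> T" using T0 by simp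
  define B where "B = H * (T - 0) powr (\<gamma> - \<beta>)"
  have B: "0 \<le> B" "holder \<beta> B 0 T z"
    using holder_exponent[OF H(2) less_imp_le[OF H(3)] T H(1)] H by (auto simp: B_def)
  have cont: "continuous_on {T0..T} (\<lambda>s. \<psi> s z)"
    using T0 by (intro continuous_along_path[OF B(2,1) _ _ holder_subinterval[OF H(2)] H(1,3)]) auto
  have "holder 1 (\<Lambda> * (C * (1 + B))) T0 T z"
  proof (rule holderI)
    fix u v assume uv: "T0 \<le> u" "u \<le> v" "v \<le> T"
    have "drift z T0 v = drift z T0 u + drift z u v"
      using uv T0 by (intro drift_additive continuous_on_subset[OF cont]) auto
    then have "z v - z u = drift z u v"
      using eq[OF _ _ cont, of u] eq[OF _ _ cont, of v] uv by simp
    also have "norm \<dots> \<le> \<Lambda> * (C * (1 + B)) * (v - u)"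
    proof (rule drift_bound)
      show "continuous_on {u..v} (\<lambda>r. \<psi> r z)" using uv by (intro continuous_on_subset[OF cont]) auto
      show "norm (\<psi> r z) \<le> C * (1 + B)" if "u \<le> r" "r \<le> v" for r
        using that uv T0 B by (intro growth holder_subinterval[OF B(2)]) auto
    qed (use uv T0 in auto)
    finally show "norm (z v - z u) \<le> \<Lambda> * (C * (1 + B)) * (v - u) powr 1" using uv by simp
  qed
  moreover have "0 \<le> \<Lambda> * (C * (1 + B))" using \<Lambda>_nonneg C B by simp
  ultimately show ?thesis unfolding sol_def using z eq cont by blast
qed

section \<open>Signature controlled equations\<close>

lemma hoelder_space_imp_holder:
  assumes "y \<in> hoelder_space \<gamma> T"
  obtains H where "0 \<le> H" "holder \<gamma> H 0 T y"
proof -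
  have fin: "hoelder_seminorm \<gamma> T y < \<infinity>"
    using assms by (simp add: hoelder_space_def hoelder_norm_def less_top[symmetric])
  define H where "H = enn2real (hoelder_seminorm \<gamma> T y)"
  have H: "hoelder_seminorm \<gamma> T y = ennreal H" "0 \<le> H"
    using fin by (auto simp: H_def less_top[symmetric])
  have "norm (y t - y s) \<le> H * (t - s) powr \<gamma>" if st: "0 \<le> s" "s \<le> t" "t \<le> T" for s t
  proof (cases "s = t")
    case False
    with st have "ennreal (norm (y t - y s) / \<bar>t - s\<bar> powr \<gamma>) \<le> hoelder_seminorm \<gamma> T y"
      unfolding hoelder_seminorm_def by (intro SUP_upper2[of "(s, t)"]) auto
    then have "norm (y t - y s) / \<bar>t - s\<bar> powr \<gamma> \<le> H" using H by simp
    then show ?thesis using False st by (simp add: pos_divide_le_eq)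
  qed simp
  with H(2) show thesis by (intro that[of H] holderI)
qed

lemma hoelder_norm_le:
  assumes H: "holder \<gamma> H 0 T y" "0 \<le> H"
  shows "hoelder_norm \<gamma> T y \<le> ennreal (norm (y 0) + H)"
proof -
  have "hoelder_seminorm \<gamma> T y \<le> ennreal H"
    unfolding hoelder_seminorm_def
  proof (rule SUP_least, clarify)
    fix s t assume "0 \<le> s" "s < t" "t \<le> T"
    then show "ennreal (norm (y t - y s) / \<bar>t - s\<bar> powr \<gamma>) \<le> ennreal H"
      using holderD[OF H(1), of s t] by (intro ennreal_leI) (simp add: pos_divide_le_eq)
  qed
  then show ?thesis using H(2) by (simp add: hoelder_norm_def ennreal_plus)
qed

text \<open>Local Lipschitz continuity of \<open>F\<close> is pulled back along the signature, which
  is Lipschitz on the class with constant H + 1. The growth bound comes from the dilation hypothesis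
  after stopping, centring and rescaling the path.\<close>

lemma signature_path_functional:
  fixes F :: "'m::finite tensor_series \<Rightarrow> (real ^ 'd) \<Rightarrow>\<^sub>L (real ^ 'm)"
  assumes \<beta>: "1 / 2 < \<beta>" "\<beta> < 1" and T: "0 \<le> T" and p: "1 < p" and lam: "\<And>k. 0 < lam k"
    and lim: "(\<lambda>k. lam k powr (1 / \<beta>) / real k powr p) \<longlonglongrightarrow> 0"
    and F: "locally_lipschitz p lam F" and C: "0 \<le> C"
    and growth: "\<And>g \<mu>. g \<in> (\<lambda>y. signature y T) ` hoelder_ball \<beta> T 1 \<Longrightarrow> 0 \<le> \<mu> \<Longrightarrow>
      norm (F (dilation \<mu> g)) \<le> C * (1 + \<mu>)"
  shows "path_functional (\<lambda>t y. F (signature y t)) \<beta> T (2 * C)"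
proof unfold_locales
  show "0 < \<beta>" "\<beta> < 1" "0 \<le> 2 * C" using \<beta> C by auto
next
  fix H s t and y :: "real \<Rightarrow> real ^ 'm"
  assume "holder \<beta> H 0 s y" "0 \<le> H" "0 \<le> s" "s \<le> t" "t \<le> T"
  then show "F (signature (\<lambda>r. y (min r s)) t) = F (signature y s)"
    using signature_stopped[OF \<beta>(1)] by metis
next
  fix H t and y z :: "real \<Rightarrow> real ^ 'm"
  assume y: "holder \<beta> H 0 t y" "0 \<le> H" and "0 \<le> t" and "\<And>s. 0 \<le> s \<Longrightarrow> s \<le> t \<Longrightarrow> z s = y s"
  then show "F (signature z t) = F (signature y t)"
    using signature_cong[OF \<beta>(1) y, of z t] by simp
next
  fix H s and y :: "real \<Rightarrow> real ^ 'm"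
  assume y: "holder \<beta> H 0 s y" "0 \<le> H" and s: "0 \<le> s" "s \<le> T"
  have H1: "1 \<le> H + 1" using y by simp
  obtain K where K: "0 \<le> K"
    and K1: "\<And>t (z :: real \<Rightarrow> real ^ 'm). 0 \<le> t \<Longrightarrow> t \<le> T \<Longrightarrow> holder \<beta> (H + 1) 0 t z \<Longrightarrow>
       weighted_norm p lam (signature z t) \<le> ennreal K"
    and K2: "\<And>t e (y :: real \<Rightarrow> real ^ 'm) z. 0 \<le> t \<Longrightarrow> t \<le> T \<Longrightarrow> holder \<beta> (H + 1) 0 t y \<Longrightarrow>
       holder \<beta> (H + 1) 0 t z \<Longrightarrow> 0 \<le> e \<Longrightarrow> holder \<beta> e 0 t (\<lambda>s. y s - z s) \<Longrightarrow>
       weighted_norm p lam (signature y t - signature z t) \<le> ennreal (K * e)"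
    by (rule signature_weighted_norm_bounds[OF \<beta>(1) p lam lim H1 T, where 'm = 'm])
      (rule that[of K' for K'], assumption, blast, blast)
  have space: "signature z t \<in> weighted_space p lam" if "0 \<le> t" "t \<le> T" "holder \<beta> (H + 1) 0 t z"
    for t and z :: "real \<Rightarrow> real ^ 'm"
    using le_less_trans[OF K1[OF that] ennreal_less_top] by (simp add: weighted_space_def)
  have "holder \<beta> (H + 1) 0 s y" using holder_weaken[OF y(1)] by simp
  from F[unfolded locally_lipschitz_def, rule_format, OF space[OF s this]] obtain r M where r: "0 < r" and M: "0 \<le> M"
    and lip: "\<And>b c. b \<in> weighted_space p lam \<Longrightarrow> c \<in> weighted_space p lam \<Longrightarrow>
      weighted_norm p lam (b - signature y s) < ennreal r \<Longrightarrow> weighted_norm p lam (c - signature y s) < ennreal r \<Longrightarrow>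
      ennreal (norm (F b - F c)) \<le> ennreal M * weighted_norm p lam (b - c)"
    by blast
  \<comment> \<open>At most 1, so that perturbed paths stay in the class with constant H + 1, and
    small enough that their signatures stay in the ball of radius \<open>r\<close> on which
    \<open>F\<close> is Lipschitz.\<close>
  define \<rho> where "\<rho> = min 1 (r / (2 * (K + 1)))"
  have \<rho>: "0 < \<rho>" "\<rho> \<le> 1" using r K by (auto simp: \<rho>_def)
  have "K * \<rho> \<le> K * (r / (2 * (K + 1)))" using K by (intro mult_left_mono) (auto simp: \<rho>_def)
  also have "\<dots> = r * (K / (2 * (K + 1)))" by simp
  also have "\<dots> < r * 1" using r K by (intro mult_strict_left_mono) (auto simp: pos_divide_less_eq)
  finally have K\<rho>: "K * \<rho> < r" by simp
  have near: "holder \<beta> (H + 1) 0 t z" "weighted_norm p lam (signature z t - signature y s) < ennreal r"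
    if t: "s \<le> t" "t \<le> T" and z: "holder \<beta> \<rho> 0 t (\<lambda>r. z r - y (min r s))" for t z
  proof -
    have ys: "holder \<beta> H 0 t (\<lambda>r. y (min r s))" using holder_stopped[OF y(1) s(1) y(2)] \<beta> by simp
    show z': "holder \<beta> (H + 1) 0 t z"
      using holder_weaken[OF holder_add[OF z ys], of "H + 1"] \<rho> by simp
    have "weighted_norm p lam (signature z t - signature (\<lambda>r. y (min r s)) t) \<le> ennreal (K * \<rho>)"
      using t s \<rho> holder_weaken[OF ys, of "H + 1"] by (intro K2 z' z) auto
    also have "\<dots> < ennreal r" using K\<rho> K \<rho> by (intro ennreal_lessI) (auto intro: r)
    finally show "weighted_norm p lam (signature z t - signature y s) < ennreal r"
      using signature_stopped[OF \<beta>(1) y s(1) t(1)] by simp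
  qed
  have "lipschitz_near (\<lambda>t y. F (signature y t)) \<beta> T s y \<rho> (M * K)"
    unfolding lipschitz_near_def
  proof (intro allI impI)
    fix t z z' e
    assume t: "s \<le> t" "t \<le> T" and z: "holder \<beta> \<rho> 0 t (\<lambda>r. z r - y (min r s))"
      and z': "holder \<beta> \<rho> 0 t (\<lambda>r. z' r - y (min r s))" and e: "0 \<le> e" "holder \<beta> e 0 t (\<lambda>r. z r - z' r)"
    have t0: "0 \<le> t" using t s by simp
    have "ennreal (norm (F (signature z t) - F (signature z' t)))
        \<le> ennreal M * weighted_norm p lam (signature z t - signature z' t)"
      using t0 t near[OF t z] near[OF t z'] by (intro lip space) auto
    also have "\<dots> \<le> ennreal M * ennreal (K * e)"
      by (intro mult_left_mono K2 t0 t near(1)[OF t z] near(1)[OF t z'] e) simp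
    also have "\<dots> = ennreal (M * K * e)" using M K e by (simp add: ennreal_mult mult.assoc)
    finally show "norm (F (signature z t) - F (signature z' t)) \<le> M * K * e"
      using M K e by simp
  qed
  then show "\<exists>\<rho>>0. \<exists>K\<ge>0. lipschitz_near (\<lambda>t y. F (signature y t)) \<beta> T s y \<rho> K"
    using \<rho> M K by (meson mult_nonneg_nonneg)
next
  fix H t and y :: "real \<Rightarrow> real ^ 'm"
  assume y: "holder \<beta> H 0 t y" "0 \<le> H" and t: "0 \<le> t" "t \<le> T"
  define \<mu> where "\<mu> = 1 + H"
  have \<mu>: "0 < \<mu>" using y by (simp add: \<mu>_def)
  \<comment> \<open>Stopping at \<open>t\<close> extends the path to [0, T], subtracting
    \<open>y 0\<close> reduces the Hoelder norm to the seminorm, and dividing by 1 + H brings it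
    into the unit ball also when H = 0.\<close>
  define z where "z r = (1 / \<mu>) *\<^sub>R (y (min r t) - y 0)" for r
  have yt: "holder \<beta> H 0 T (\<lambda>r. y (min r t))" using holder_stopped[OF y(1) t(1) y(2)] \<beta> by simp
  have "holder \<beta> (\<bar>1 / \<mu>\<bar> * (H + 0)) 0 T z"
    unfolding z_def by (intro holder_scaleR holder_diff yt holder_const order_refl)
  then have "holder \<beta> 1 0 T z" by (rule holder_weaken) (use \<mu> y in \<open>simp add: \<mu>_def\<close>)
  from hoelder_norm_le[OF this] have "hoelder_norm \<beta> T z \<le> ennreal 1" using t by (simp add: z_def)
  then have "z \<in> hoelder_ball \<beta> T 1"
    using le_less_trans[of "hoelder_norm \<beta> T z" 1 top] by (simp add: hoelder_ball_def hoelder_space_def)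
  then have "norm (F (dilation \<mu> (signature z T))) \<le> C * (1 + \<mu>)"
    using \<mu> by (intro growth imageI) auto
  moreover have "dilation \<mu> (signature z T) = signature y t"
  proof -
    have "signature z T = dilation (1 / \<mu>) (signature (\<lambda>r. y (min r t)) T)"
      using T by (intro signature_scale[OF \<beta>(1) yt y(2), of z _ "y 0"]) (auto simp: z_def)
    also have "signature (\<lambda>r. y (min r t)) T = signature y t"
      by (rule signature_stopped[OF \<beta>(1) y t])
    finally show ?thesis
      using \<mu> by (simp add: dilation_def fun_eq_iff power_one_over)
  qed
  \<comment> \<open>C (1 + \<mu>) = C (2 + H), which accounts for the constant 2 C of the
    locale.\<close>
  moreover have "C * (1 + \<mu>) \<le> 2 * C * (1 + H)" using C y by (simp add: \<mu>_def algebra_simps)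
  ultimately show "norm (F (signature y t)) \<le> 2 * C * (1 + H)" by simp
qed

text \<open>Solutions are sought among \<open>\<alpha>\<close>-Hoelder paths, while
  \<open>sol\<close> speaks of paths that are Lipschitz after \<open>T0\<close>. \<open>solI\<close>
  with \<beta> < \<alpha> leads from the former to the latter, \<alpha> < 1 leads back.\<close>

theorem proposition4p5:
  fixes T0 T1 \<alpha> \<beta> p :: real
    and lam :: "nat \<Rightarrow> real"
    and F :: "'m::finite tensor_series \<Rightarrow> (real ^ 'd) \<Rightarrow>\<^sub>L (real ^ 'm)"
  assumes "0 < T1" and "0 \<le> T0" and "T0 < T1"
    and "1/2 < \<beta>" and "\<beta> < \<alpha>" and "\<alpha> < 1"
    and "1 < p"
    and "\<And>k. 0 < lam k"
    and "filterlim lam at_top sequentially"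
    and "(\<lambda>k. lam k powr (1/\<beta>) / real k powr p) \<longlonglongrightarrow> 0"
    and "locally_lipschitz p lam F"
    and "\<forall>r>0. \<exists>C>0. \<forall>g \<in> (\<lambda>y. signature y T1) ` hoelder_ball \<beta> T1 r. \<forall>\<mu>\<ge>0.
           norm (F (dilation \<mu> g)) \<le> C * (1 + \<mu>)"
  shows "\<forall>x w. (\<exists>L. L-lipschitz_on {0..T1} x) \<longrightarrow> w \<in> hoelder_space \<alpha> T0 \<longrightarrow>
           (\<exists>y. signature_cde_solution \<alpha> T0 T1 F x w y \<and>
                (\<forall>z. signature_cde_solution \<alpha> T0 T1 F x w z \<longrightarrow> (\<forall>t\<in>{0..T1}. z t = y t)))"
proof (intro allI impI)
  fix x :: "real \<Rightarrow> real ^ 'd" and w :: "real \<Rightarrow> real ^ 'm"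
  assume "\<exists>L. L-lipschitz_on {0..T1} x" and "w \<in> hoelder_space \<alpha> T0"
  then obtain L A where L: "L-lipschitz_on {0..T1} x" and A: "0 \<le> A" "holder \<alpha> A 0 T0 w"
    using hoelder_space_imp_holder by metis
  obtain C where C: "0 < C" "\<And>g \<mu>. g \<in> (\<lambda>y. signature y T1) ` hoelder_ball \<beta> T1 1 \<Longrightarrow> 0 \<le> \<mu> \<Longrightarrow>
      norm (F (dilation \<mu> g)) \<le> C * (1 + \<mu>)"
    using assms(12)[rule_format, of 1] by auto
  interpret path_functional "\<lambda>t y. F (signature y t)" \<beta> T1 "2 * C"
    by (rule signature_path_functional[OF assms(4) _ _ assms(7,8,10,11)]) (use assms(1-6) C in auto)
  have L0: "0 \<le> L" using L by (rule lipschitz_on_nonneg)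
  have w': "holder \<beta> (A * (T0 - 0) powr (\<alpha> - \<beta>)) 0 T0 w"
    using assms(2,5) by (intro holder_exponent A) auto
  have "holder 1 L 0 T1 x"
  proof (rule holderI)
    fix s t assume "0 \<le> s" "s \<le> t" "t \<le> T1"
    then show "norm (x t - x s) \<le> L * (t - s) powr 1"
      using lipschitz_onD[OF L, of t s] by (simp add: dist_norm)
  qed
  \<comment> \<open>The functional framework measures paths with exponent \<beta>, so the history
    enters with its \<open>\<alpha>\<close>-constant converted to that exponent on [0, T0].\<close>
  then interpret functional_cde "\<lambda>t y. F (signature y t)" \<beta> T1 "2 * C" x w L T0 "A * (T0 - 0) powr (\<alpha> - \<beta>)"
    using L0 A(1) w' assms(2,3) by unfold_locales auto
  have column: "has_rs_integral (\<lambda>s. blinfun_apply (F (signature y s)) (axis j 1)) (\<lambda>s. x s $ j) T0 t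
      (rs_integral (\<lambda>s. blinfun_apply (F (signature y s)) (axis j 1)) (\<lambda>s. x s $ j) T0 t)"
    if "continuous_on {T0..T1} (\<lambda>s. F (signature y s))" "T0 \<le> t" "t \<le> T1" for y t j
    using has_rs_integral_column[OF L0 x_holder that(1), OF assms(2) order_refl order_refl that(2,3)] .
  have unique: "sol T1 z" if z: "signature_cde_solution \<alpha> T0 T1 F x w z" for z
  proof -
    obtain H where H: "0 \<le> H" "holder \<alpha> H 0 T1 z"
      using z hoelder_space_imp_holder unfolding signature_cde_solution_def by metis
    show ?thesis
    proof (rule solI[OF _ H assms(5)])
      show "z t = w t" if "0 \<le> t" "t \<le> T0" for t
        using z that by (simp add: signature_cde_solution_def)
      fix t assume "T0 \<le> t" "t \<le> T1"
      with z obtain I where I: "\<And>j. has_rs_integral (\<lambda>s. blinfun_apply (F (signature z s)) (axis j 1))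
          (\<lambda>s. x s $ j) T0 t (I j)" and eq: "z t = w T0 + (\<Sum>j\<in>UNIV. I j)"
        unfolding signature_cde_solution_def by force
      show "z t = w T0 + drift z T0 t"
        unfolding drift_def control_integral_def eq using rs_integral_eq[OF I] by simp
    qed
  qed
  obtain y where y: "sol T1 y" using global_existence by blast
  note T = less_imp_le[OF assms(3)] order_refl
  obtain R where R: "0 \<le> R" "holder 1 R T0 T1 y" using solD(2)[OF y T] by blast
  have yw: "y t = w t" if "0 \<le> t" "t \<le> T0" for t using solD(1)[OF y T that] .
  \<comment> \<open>The history contributes its own constant \<open>A\<close>, the Lipschitz part
    its constant lowered to the exponent \<alpha>; joining at \<open>T0\<close> adds them.\<close>
  have "holder \<alpha> (A + R * (T1 - T0) powr (1 - \<alpha>)) 0 T1 y"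
    using R A assms(1-6) holder_cong[of 0 T0 y w] yw
    by (intro holder_join[of _ _ 0 T0] holder_exponent) auto
  from hoelder_norm_le[OF this] have "hoelder_norm \<alpha> T1 y \<le> ennreal (norm (y 0) + (A + R * (T1 - T0) powr (1 - \<alpha>)))"
    using A R by simp
  from le_less_trans[OF this ennreal_less_top] have "y \<in> hoelder_space \<alpha> T1"
    by (simp add: hoelder_space_def)
  moreover have "\<exists>I. (\<forall>j. has_rs_integral (\<lambda>s. blinfun_apply (F (signature y s)) (axis j 1)) (\<lambda>s. x s $ j) T0 t (I j)) \<and>
      y t = w T0 + (\<Sum>j\<in>UNIV. I j)" if "t \<in> {T0..T1}" for t
    by (rule exI[of _ "\<lambda>j. rs_integral (\<lambda>s. blinfun_apply (F (signature y s)) (axis j 1)) (\<lambda>s. x s $ j) T0 t"])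
      (use column[OF solD(4)[OF y T]] solD(5)[OF y T, of t] that in \<open>simp add: drift_def control_integral_def\<close>)
  ultimately have "signature_cde_solution \<alpha> T0 T1 F x w y"
    unfolding signature_cde_solution_def using yw by simp
  moreover have "z t = y t" if "signature_cde_solution \<alpha> T0 T1 F x w z" "t \<in> {0..T1}" for z t
    using sol_unique[OF unique[OF that(1)] y T, of t] that(2) by simp
  ultimately show "\<exists>y. signature_cde_solution \<alpha> T0 T1 F x w y \<and>
      (\<forall>z. signature_cde_solution \<alpha> T0 T1 F x w z \<longrightarrow> (\<forall>t\<in>{0..T1}. z t = y t))"
    by blast
qed

end
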